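(* There is an absolute constant $C>0$ such that for every sufficiently large prime $q$, every $d\geq 2$ with $d\mid(q-1)$ and every primitive Dirichlet character $\chi$ modulo $q$ of order $d$, $$\frac{1}{d}\sum_{1 \leq \ell \leq d-1} M(\chi^\ell) \leq C\,(\sqrt{q}\log q)\left(\sqrt{\frac{\log\log\log q}{\log \log q}} + \frac{1}{P^-(d)}\right).$$
   Context: For a Dirichlet character $\psi$ modulo $q$, $M(\psi) := \max_{1 \leq t \leq q} \left|\sum_{1\le n \leq t} \psi(n)\right|$. $P^-(d)$ denotes the smallest prime factor of $d$. *)

theory Defs
  imports "HOL-Analysis.Analysis" "HOL-Number_Theory.Number_Theory"
begin

definition dirichlet_char :: "nat \<Rightarrow> (int \<Rightarrow> complex) \<Rightarrow> bool" where
  "dirichlet_char q chi \<longleftrightarrow> q \<ge> 1 \<and>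
     (\<forall>n. chi (n + int q) = chi n) \<and>
     (\<forall>m n. chi (m * n) = chi m * chi n) \<and>
     chi 1 = 1 \<and>
     (\<forall>n. chi n = 0 \<longleftrightarrow> \<not> coprime n (int q))"

definition primitive_char :: "nat \<Rightarrow> (int \<Rightarrow> complex) \<Rightarrow> bool" where
  "primitive_char q chi \<longleftrightarrow> dirichlet_char q chi \<and>
     (\<forall>e. e dvd q \<and> e < q \<longrightarrow>
        (\<exists>n. coprime n (int q) \<and> [n = 1] (mod int e) \<and> chi n \<noteq> 1))"

definition char_order :: "nat \<Rightarrow> (int \<Rightarrow> complex) \<Rightarrow> nat" where
  "char_order q chi = (LEAST k. k \<ge> 1 \<and> (\<forall>n. coprime n (int q) \<longrightarrow> chi n ^ k = 1))"

definition M_char :: "nat \<Rightarrow> (int \<Rightarrow> complex) \<Rightarrow> real" where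
  "M_char q \<psi> = Max ((\<lambda>t. norm (\<Sum>n\<in>{1..t}. \<psi> (int n))) ` {1..q})"

definition Pminus :: "nat \<Rightarrow> nat" where
  "Pminus d = Min (prime_factors d)"

end

theory Submission
  imports Defs "HOL-Real_Asymp.Real_Asymp"
begin

text \<open>
  If d is even then 1/P^-(d) = 1/2 and the Polya--Vinogradov inequality suffices. If d is odd, all powers
  of chi are even, and by Polya's Fourier expansion M(chi^l) is governed by the sums
  S(alpha) of f(n) sin(2 pi n alpha) / n over n < q/2, where f is the conjugate of chi^l. Put X = log q, Y = log X, Z = log Y.
  A Turan--Kubilius and Katai argument with the primes up to exp(sqrt X) bounds S(alpha) by X sqrt(Z/Y)
  unless alpha is close to a rational b/r with r at most Y^2; there the expansion of the odd function sin(2 pi n b/r)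
  into odd characters xi mod divisors of r together with a Hall type bound for logarithmic means shows that S(alpha) is small
  unless f is xi-pretentious for some odd xi, within squared distance O(Z).
  The latter happens for few l: if it held for a set of exponents of density kappa, then some odd signed sum of at most 4/kappa of
  them would vanish mod d, and multiplying the characters would make 1 pretend to be an odd character of small conductor.
  The squared distance between them is at least about Y, and at most O(kappa^(-2) Z), so kappa is O(sqrt(Z/Y)).
\<close>

section \<open>Harmonic and trigonometric sums\<close>

text \<open>Two losses are made to agree. In the bilinear argument the pairs of primes without
  cancellation have relative weight about Z/Y, and Cauchy-Schwarz takes its square root. In the
  count of exponents, a vanishing sum of k terms multiplies k characters; the triangle inequality
  followed by Cauchy-Schwarz bounds the resulting squared distance by about k^2 Z. It must reach Y,
  so k is at least about sqrt(Y/Z). The number of terms has to be odd because only then is the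
  product of the odd characters again odd, hence nonprincipal; d odd supplies such a sum, namely d
  copies of one exponent. All input on primes in progressions is one-sided: an upper bound for |L(s,
  \<xi>)| at real s > 1 bounds the sum of Re \<xi>(p) p^(-s) from above through the Euler product,
  wherever the zeros of L lie. Weights p^(-s) with s = 1 + 1/log q replace a cutoff at q at the cost
  of bounded factors, since n^(1/log q) is at most e for n up to q.\<close>

lemma harm_le_ln: "n \<ge> 1 \<Longrightarrow> (harm n :: real) \<le> ln (real n) + 1"
proof (induction n rule: nat_induct_at_least)
  case base
  then show ?case by (simp add: harm_expand)
next
  case (Suc n)
  have "ln (real n / (real n + 1)) \<le> - (1 / (real n + 1))"
    using ln_le_minus_one[of "real n / (real n + 1)"] Suc.hyps by (simp add: field_simps)
  then have "1 / (real n + 1) \<le> ln (real n + 1) - ln (real n)"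
    using Suc.hyps by (subst (asm) ln_div) auto
  then show ?case using Suc.IH by (simp add: harm_Suc inverse_eq_divide add.commute)
qed

text \<open>Abel summation: the differences of the decreasing weights are nonnegative and telescope,
  so only the first weight survives.\<close>

lemma abel_bound:
  fixes a :: "nat \<Rightarrow> complex" and w :: "nat \<Rightarrow> real"
  assumes bd: "\<And>m. m \<ge> A \<Longrightarrow> norm (\<Sum>n\<in>{A<..m}. a n) \<le> K"
    and dec: "\<And>n. n > A \<Longrightarrow> w (Suc n) \<le> w n" and pos: "\<And>n. n > A \<Longrightarrow> w n \<ge> 0"
  shows "norm (\<Sum>n\<in>{A<..B}. a n * of_real (w n)) \<le> K * w (Suc A)"
proof (cases "B > A")
  case False
  have "K \<ge> 0" using bd[of A] by simp
  with False pos[of "Suc A"] show ?thesis by simp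
next
  case True
  define S where "S m = (\<Sum>n\<in>{A<..m}. a n)" for m
  have *: "(\<Sum>n\<in>{A<..m}. a n * of_real (w n)) = S m * of_real (w m) + (\<Sum>n\<in>{A<..<m}. S n * of_real (w n - w (Suc n)))"
    if "m > A" for m
    using that
  proof (induction m rule: less_induct)
    case (less m)
    show ?case
    proof (cases "m = Suc A")
      case True
      have "{A<..Suc A} = {Suc A}" "{A<..<Suc A} = {}" by auto
      then show ?thesis using True by (simp add: S_def)
    next
      case False
      then obtain k where k: "m = Suc k" "k > A" using less.prems by (cases m) auto
      have e1: "{A<..m} = insert m {A<..k}" "{A<..<m} = insert k {A<..<k}" using k by auto
      have "(\<Sum>n\<in>{A<..m}. a n * of_real (w n)) = a m * of_real (w m) + (S k * of_real (w k) + (\<Sum>n\<in>{A<..<k}. S n * of_real (w n - w (Suc n))))"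
        unfolding e1 using less.IH[of k] k by simp
      moreover have "S m = a m + S k" unfolding S_def e1 using k by simp
      moreover have "(\<Sum>n\<in>{A<..<m}. S n * of_real (w n - w (Suc n))) = S k * of_real (w k - w m) + (\<Sum>n\<in>{A<..<k}. S n * of_real (w n - w (Suc n)))"
        unfolding e1 using k by simp
      ultimately show ?thesis by (simp add: algebra_simps)
    qed
  qed
  have tel: "(\<Sum>n\<in>{A<..<m}. w n - w (Suc n)) = w (Suc A) - w m" if "m > A" for m
    using that
  proof (induction m rule: less_induct)
    case (less m)
    show ?case
    proof (cases "m = Suc A")
      case True
      moreover have "{A<..<Suc A} = {}" by auto
      ultimately show ?thesis by simp
    next
      case False
      then obtain k where k: "m = Suc k" "k > A" using less.prems by (cases m) auto
      have e1: "{A<..<m} = insert k {A<..<k}" using k by auto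
      show ?thesis unfolding e1 using less.IH[of k] k by simp
    qed
  qed
  have "norm (\<Sum>n\<in>{A<..B}. a n * of_real (w n)) \<le> norm (S B) * w B + (\<Sum>n\<in>{A<..<B}. norm (S n) * (w n - w (Suc n)))"
    unfolding *[OF True] using True pos[of B] dec
    by (intro order.trans[OF norm_triangle_ineq] add_mono order.trans[OF norm_sum] sum_mono)
       (auto simp: norm_mult simp flip: of_real_diff)
  also have "\<dots> \<le> K * w B + (\<Sum>n\<in>{A<..<B}. K * (w n - w (Suc n)))"
    using bd True pos[of B] dec by (intro add_mono mult_right_mono sum_mono) (auto simp: S_def)
  also have "\<dots> = K * w (Suc A)"
    using tel[OF True] unfolding sum_distrib_left[symmetric] distrib_left[symmetric] by simp
  finally show ?thesis .
qed

lemma cos_sum_bound: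
  fixes \<theta> :: real
  assumes "sin (pi * \<theta>) \<noteq> 0"
  shows "\<bar>\<Sum>n\<in>{A<..B}. cos (2 * pi * real n * \<theta>)\<bar> \<le> 1 / \<bar>sin (pi * \<theta>)\<bar>"
proof (cases "B \<ge> A")
  case True
  have tel: "2 * sin (pi * \<theta>) * (\<Sum>n\<in>{A<..m}. cos (2 * pi * real n * \<theta>)) = sin ((2 * real m + 1) * pi * \<theta>) - sin ((2 * real A + 1) * pi * \<theta>)"
    if "m \<ge> A" for m using that
  proof (induction m rule: nat_induct_at_least)
    case (Suc m)
    have "{A<..Suc m} = insert (Suc m) {A<..m}" using Suc by auto
    moreover have "2 * sin (pi * \<theta>) * cos (2 * pi * real (Suc m) * \<theta>) = sin ((2 * real (Suc m) + 1) * pi * \<theta>) - sin ((2 * real m + 1) * pi * \<theta>)"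
    proof -
      have "(2 * real (Suc m) + 1) * pi * \<theta> = 2 * pi * real (Suc m) * \<theta> + pi * \<theta>"
        "(2 * real m + 1) * pi * \<theta> = 2 * pi * real (Suc m) * \<theta> - pi * \<theta>" by (simp_all add: algebra_simps)
      then show ?thesis by (simp only: sin_add sin_diff) (simp add: algebra_simps)
    qed
    ultimately show ?case using Suc by (simp add: distrib_left)
  qed auto
  have "\<bar>2 * sin (pi * \<theta>) * (\<Sum>n\<in>{A<..B}. cos (2 * pi * real n * \<theta>))\<bar> \<le> 2"
    unfolding tel[OF True] using abs_sin_le_one[of "(2 * real B + 1) * pi * \<theta>"] abs_sin_le_one[of "(2 * real A + 1) * pi * \<theta>"] by linarith
  then show ?thesis using assms by (simp add: abs_mult field_simps)
next
  case False
  then show ?thesis by simp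
qed

lemma cos_over_n_bound:
  fixes \<theta> :: real
  assumes "sin (pi * \<theta>) \<noteq> 0"
  shows "\<bar>\<Sum>n\<in>{A<..B}. cos (2 * pi * real n * \<theta>) / real n\<bar> \<le> 1 / (\<bar>sin (pi * \<theta>)\<bar> * (real A + 1))"
proof -
  have "norm (\<Sum>n\<in>{A<..B}. complex_of_real (cos (2 * pi * real n * \<theta>)) * of_real (1 / real n)) \<le> 1 / \<bar>sin (pi * \<theta>)\<bar> * (1 / real (Suc A))"
    using cos_sum_bound[OF assms] by (intro abel_bound) (auto simp flip: of_real_sum simp: frac_le)
  moreover have "(\<Sum>n\<in>{A<..B}. complex_of_real (cos (2 * pi * real n * \<theta>)) * of_real (1 / real n)) = complex_of_real (\<Sum>n\<in>{A<..B}. cos (2 * pi * real n * \<theta>) / real n)"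
    by simp
  ultimately show ?thesis by (metis (no_types, lifting) norm_of_real divide_divide_eq_left mult.right_neutral times_divide_eq_right of_nat_Suc add.commute)
qed

text \<open>Cut at 1/\<delta>: below it the harmonic sum costs ln (1/\<delta>) + 2, beyond it Abel
  summation leaves at most 1.\<close>

lemma cos_over_n_bound_log:
  fixes \<theta> :: real
  assumes d: "\<bar>sin (pi * \<theta>)\<bar> \<ge> \<delta>" and \<delta>: "0 < \<delta>" "\<delta> \<le> 1"
  shows "\<bar>\<Sum>n\<in>{A<..B}. cos (2 * pi * real n * \<theta>) / real n\<bar> \<le> ln (1 / \<delta>) + 3"
proof -
  define M where "M = nat \<lceil>1/\<delta>\<rceil>"
  have M: "real M \<ge> 1/\<delta>" "real M \<le> 1/\<delta> + 1" "M \<ge> 1"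
    using \<delta> unfolding M_def by (linarith, simp, metis One_nat_def Suc_leI divide_pos_pos zero_less_ceiling zero_less_nat_eq zero_less_one)
  have nz: "sin (pi * \<theta>) \<noteq> 0" using assms by auto
  define f where "f n = cos (2 * pi * real n * \<theta>) / real n" for n
  have tail: "\<bar>sum f {max A M<..B}\<bar> \<le> 1"
  proof -
    have "\<bar>sum f {max A M<..B}\<bar> \<le> 1 / (\<bar>sin (pi * \<theta>)\<bar> * (real (max A M) + 1))"
      unfolding f_def by (rule cos_over_n_bound[OF nz])
    also have "\<dots> \<le> 1 / (\<delta> * (1 / \<delta>))"
      using d \<delta> M by (intro divide_left_mono mult_mono) (auto intro!: mult_pos_pos)
    finally show ?thesis using \<delta> by simp
  qed
  have head: "\<bar>sum f {A<..min B M}\<bar> \<le> ln (1/\<delta>) + 2"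
  proof -
    have "\<bar>sum f {A<..min B M}\<bar> \<le> (\<Sum>n\<in>{A<..min B M}. \<bar>f n\<bar>)" by simp
    also have "\<dots> \<le> (\<Sum>n\<in>{A<..min B M}. inverse (real n))" unfolding f_def
      by (intro sum_mono) (simp add: field_simps)
    also have "\<dots> \<le> harm M" unfolding harm_def by (intro sum_mono2) auto
    also have "\<dots> \<le> ln (real M) + 1" by (rule harm_le_ln[OF M(3)])
    also have "ln (real M) \<le> ln (1/\<delta> * 2)"
      using M \<delta> by (intro ln_mono) (auto simp: field_simps)
    also have "\<dots> = ln (1/\<delta>) + ln 2" using \<delta> by (subst ln_mult) auto
    also have "ln (2::real) \<le> 1" using ln_le_minus_one[of "2::real"] by simp
    finally show ?thesis by simp
  qed
  have "sum f {A<..B} = sum f {A<..min B M} + sum f {max A M<..B}"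
    by (subst sum.union_disjoint[symmetric]) (auto intro!: sum.cong)
  then show ?thesis using tail head unfolding f_def by linarith
qed

section \<open>Dirichlet characters\<close>

lemma dirichlet_char_cong:
  assumes "dirichlet_char q \<psi>" "[a = b] (mod int q)"
  shows "\<psi> a = \<psi> b"
proof -
  have per: "\<psi> (n + int q * k) = \<psi> n" for n k
  proof (induction k rule: int_induct[where k = 0])
    case (step1 i)
    have "\<psi> (n + int q * (i + 1)) = \<psi> ((n + int q * i) + int q)" by (simp add: algebra_simps)
    then show ?case using assms(1) step1 unfolding dirichlet_char_def by metis
  next
    case (step2 i)
    have "\<psi> (n + int q * i) = \<psi> ((n + int q * (i - 1)) + int q)" by (simp add: algebra_simps)
    then show ?case using assms(1) step2 unfolding dirichlet_char_def by metis
  qed auto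
  obtain k where "b = a + int q * k" using assms(2) by (auto simp: cong_iff_lin)
  then show ?thesis using per by simp
qed

lemma coprime_pow_totient_int:
  assumes "coprime x (int q)" "q \<ge> 1"
  shows "[x ^ totient q = 1] (mod int q)"
proof -
  define y where "y = nat (x mod int q)"
  have y: "int y = x mod int q" using assms unfolding y_def by auto
  have "coprime (int y) (int q)" using assms by (simp add: y coprime_mod_left_iff)
  then have "[y ^ totient q = 1] (mod q)" using euler_theorem[of y q] by simp
  then have "[int y ^ totient q = 1] (mod int q)" by (metis cong_int_iff of_nat_1 of_nat_power)
  moreover have "[x ^ totient q = int y ^ totient q] (mod int q)"
    by (intro cong_pow) (simp add: y cong_def)
  ultimately show ?thesis using cong_trans by blast
qed

lemma dirichlet_char_pow:
  assumes "dirichlet_char q \<psi>"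
  shows "\<psi> (x ^ n) = \<psi> x ^ n"
  using assms by (induction n) (auto simp: dirichlet_char_def)

lemma dirichlet_char_root_of_unity:
  assumes "dirichlet_char q \<psi>" "coprime x (int q)"
  shows "\<psi> x ^ totient q = 1"
  using coprime_pow_totient_int[OF assms(2)] dirichlet_char_cong[OF assms(1)] dirichlet_char_pow[OF assms(1)] assms(1)
  unfolding dirichlet_char_def by metis

lemma dirichlet_char_norm:
  assumes "dirichlet_char q \<psi>"
  shows "norm (\<psi> x) = (if coprime x (int q) then 1 else 0)"
proof (cases "coprime x (int q)")
  case True
  have "totient q > 0" using assms by (simp add: dirichlet_char_def)
  moreover have "norm (\<psi> x) ^ totient q = 1"
    using dirichlet_char_root_of_unity[OF assms True] by (metis norm_one norm_power)
  ultimately show ?thesis using True power_eq_1_iff[of "norm (\<psi> x)" "totient q"] by simp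
qed (use assms in \<open>auto simp: dirichlet_char_def\<close>)

lemma dirichlet_char_norm_le: "dirichlet_char q \<psi> \<Longrightarrow> norm (\<psi> x) \<le> 1"
  by (simp add: dirichlet_char_norm)

lemma dirichlet_char_mult:
  "dirichlet_char q \<psi> \<Longrightarrow> dirichlet_char q' \<xi> \<Longrightarrow> dirichlet_char (q * q') (\<lambda>n. \<psi> n * \<xi> n)"
proof -
  assume a: "dirichlet_char q \<psi>" "dirichlet_char q' \<xi>"
  have "\<psi> (n + int (q * q')) = \<psi> n" "\<xi> (n + int (q * q')) = \<xi> n" for n
    by (rule dirichlet_char_cong[OF a(1)] dirichlet_char_cong[OF a(2)], simp add: cong_def)+
  then show ?thesis using a unfolding dirichlet_char_def by auto
qed

lemma dirichlet_char_mult_same: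
  "dirichlet_char q \<psi> \<Longrightarrow> dirichlet_char q \<xi> \<Longrightarrow> dirichlet_char q (\<lambda>n. \<psi> n * \<xi> n)"
  unfolding dirichlet_char_def by auto

lemma dirichlet_char_cnj: "dirichlet_char q \<psi> \<Longrightarrow> dirichlet_char q (\<lambda>n. cnj (\<psi> n))"
  unfolding dirichlet_char_def by auto

lemma dirichlet_char_minus_one: "dirichlet_char q \<psi> \<Longrightarrow> \<psi> (-1) = 1 \<or> \<psi> (-1) = -1"
proof -
  assume a: "dirichlet_char q \<psi>"
  have "\<psi> ((-1) * (-1)) = \<psi> (-1) * \<psi> (-1)" using a unfolding dirichlet_char_def by blast
  moreover have "\<psi> ((-1) * (-1)) = 1" using a unfolding dirichlet_char_def by simp
  ultimately show ?thesis by (metis square_eq_1_iff)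
qed

lemma dirichlet_char_uminus: "dirichlet_char q \<psi> \<Longrightarrow> \<psi> (- n) = \<psi> (-1) * \<psi> n"
  unfolding dirichlet_char_def by (metis mult_minus1)

section \<open>Orthogonality of Dirichlet characters\<close>

definition dchars :: "nat \<Rightarrow> (int \<Rightarrow> complex) set" where
  "dchars q = {\<psi>. dirichlet_char q \<psi>}"

definition dprinc :: "nat \<Rightarrow> int \<Rightarrow> complex" where
  "dprinc q n = (if coprime n (int q) then 1 else 0)"

lemma coprime_add_modulus: "coprime (n + int q) (int q) = coprime n (int q)"
  by (metis coprime_iff_gcd_eq_1 gcd_add1)

lemma dprinc_dirichlet: "q \<ge> 1 \<Longrightarrow> dirichlet_char q (dprinc q)"
  unfolding dirichlet_char_def dprinc_def by (auto simp: coprime_add_modulus)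

text \<open>A character is determined by its values on residues, and these are 0 or roots of unity
  of order dividing \<open>totient q\<close>.\<close>

lemma finite_dchars: "finite (dchars q)"
proof (cases "q \<ge> 1")
  case False
  then have "dchars q = {}" by (auto simp: dchars_def dirichlet_char_def)
  then show ?thesis by simp
next
  case True
  define V where "V = insert (0::complex) {z. z ^ totient q = 1}"
  have V: "finite V" unfolding V_def using finite_roots_unity[of "totient q"] True by auto
  have "inj_on (\<lambda>\<psi>. restrict \<psi> {0..<int q}) (dchars q)"
  proof (rule inj_onI, rule ext)
    fix \<psi> \<xi> x assume a: "\<psi> \<in> dchars q" "\<xi> \<in> dchars q" "restrict \<psi> {0..<int q} = restrict \<xi> {0..<int q}"
    have "x mod int q \<in> {0..<int q}" using True by auto
    then have "\<psi> (x mod int q) = \<xi> (x mod int q)" using a(3) by (metis restrict_apply)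
    moreover have "\<psi> (x mod int q) = \<psi> x" "\<xi> (x mod int q) = \<xi> x"
      using a by (auto simp: dchars_def intro!: dirichlet_char_cong)
    ultimately show "\<psi> x = \<xi> x" by simp
  qed
  moreover have "(\<lambda>\<psi>. restrict \<psi> {0..<int q}) ` dchars q \<subseteq> {0..<int q} \<rightarrow>\<^sub>E V"
    using dirichlet_char_root_of_unity unfolding V_def dchars_def
    by (auto simp: dirichlet_char_def restrict_def)
  moreover have "finite ({0..<int q} \<rightarrow>\<^sub>E V)" using V by (intro finite_PiE) auto
  ultimately show ?thesis by (meson finite_imageD finite_subset)
qed

lemma sum_roots_of_unity_pow:
  assumes "n \<ge> 1" "j < n"
  shows "(\<Sum>k<n. exp (2 * of_real pi * \<i> * of_nat k / of_nat n) ^ j) = (if j = 0 then of_nat n else (0::complex))"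
proof (cases "j = 0")
  case False
  define x :: complex where "x = exp (2 * of_real pi * \<i> * of_nat j / of_nat n)"
  have e: "exp (2 * of_real pi * \<i> * of_nat k / of_nat n) ^ j = x ^ k" for k
    unfolding x_def by (simp add: exp_of_nat_mult[symmetric] field_simps)
  have "x \<noteq> 1" unfolding x_def using complex_root_unity_eq_1[of n j] assms False
    by (auto dest: dvd_imp_le)
  moreover have "x ^ n = 1" unfolding x_def using complex_root_unity[of n j] assms by simp
  ultimately show ?thesis using False by (simp add: e geometric_sum)
qed simp

text \<open>Starting from the indicator of the class of 1, project successively onto
  eigenspaces of the dilations x \<mapsto> g x; a joint eigenfunction is a multiple of a character.\<close>
lemma dilation_eigenfunction:
  assumes q: "q \<ge> 1" and a: "\<not> [a = 1] (mod int q)"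
    and fin: "finite gs" and gs: "\<And>g. g \<in> gs \<Longrightarrow> coprime g (int q)"
  shows "\<exists>F :: int \<Rightarrow> complex. (\<forall>x y. [x = y] (mod int q) \<longrightarrow> F x = F y) \<and> (\<forall>x. \<not> coprime x (int q) \<longrightarrow> F x = 0) \<and>
     F a \<noteq> F 1 \<and> (\<forall>g\<in>gs. \<exists>\<omega>. \<forall>x. F (g * x) = \<omega> * F x)"
  using fin gs
proof (induction gs rule: finite_induct)
  case empty
  define F :: "int \<Rightarrow> complex" where "F x = (if [x = 1] (mod int q) then 1 else 0)" for x
  have "F x = F y" if "[x = y] (mod int q)" for x y
    using that unfolding F_def by (auto simp: cong_def)
  moreover have "F x = 0" if "\<not> coprime x (int q)" for x
    using that unfolding F_def by (metis cong_imp_coprime cong_sym coprime_1_left)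
  moreover have "F a \<noteq> F 1" using a by (simp add: F_def)
  ultimately show ?case by blast
next
  case (insert g gs)
  have "\<exists>F :: int \<Rightarrow> complex. (\<forall>x y. [x = y] (mod int q) \<longrightarrow> F x = F y) \<and> (\<forall>x. \<not> coprime x (int q) \<longrightarrow> F x = 0) \<and>
     F a \<noteq> F 1 \<and> (\<forall>g\<in>gs. \<exists>\<omega>. \<forall>x. F (g * x) = \<omega> * F x)"
    by (rule insert.IH) (simp add: insert.prems)
  then obtain F :: "int \<Rightarrow> complex" where F: "\<And>x y. [x = y] (mod int q) \<Longrightarrow> F x = F y" "\<And>x. \<not> coprime x (int q) \<Longrightarrow> F x = 0"
     "F a \<noteq> F 1" "\<And>h. h \<in> gs \<Longrightarrow> \<exists>\<omega>. \<forall>x. F (h * x) = \<omega> * F x"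
    by blast
  have g: "coprime g (int q)" using insert.prems by simp
  define n where "n = totient q"
  have n: "n \<ge> 1" using q by (simp add: n_def Suc_leI)
  define \<eta> :: "nat \<Rightarrow> complex" where "\<eta> k = exp (2 * of_real pi * \<i> * of_nat k / of_nat n)" for k
  \<comment> \<open>Up to the factor n this is the projection of F to the eigenspace of dilation by
    g with eigenvalue \<open>inverse (\<eta> k)\<close>. The projections average to F, so one of
    them still separates a from 1.\<close>
  define G where "G k x = (\<Sum>j<n. \<eta> k ^ j * F (g ^ j * x))" for k x
  have Gsum: "(\<Sum>k<n. G k x) = of_nat n * F x" for x
  proof -
    have "(\<Sum>k<n. G k x) = (\<Sum>j<n. (\<Sum>k<n. \<eta> k ^ j) * F (g ^ j * x))"
      unfolding G_def by (subst sum.swap) (simp add: sum_distrib_right)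
    also have "\<dots> = (\<Sum>j<n. if j = 0 then of_nat n * F x else 0)"
      unfolding \<eta>_def using n by (intro sum.cong) (auto simp: sum_roots_of_unity_pow)
    also have "\<dots> = of_nat n * F x" using n by (simp add: sum.delta)
    finally show ?thesis .
  qed
  have "\<exists>k<n. G k a \<noteq> G k 1"
  proof (rule ccontr)
    assume "\<not> ?thesis"
    then have "(\<Sum>k<n. G k a) = (\<Sum>k<n. G k 1)" by (intro sum.cong) auto
    then have "of_nat n * F a = of_nat n * F 1" by (simp only: Gsum)
    then show False using F(3) n by simp
  qed
  then obtain k where k: "k < n" "G k a \<noteq> G k 1" by blast
  have \<eta>n: "\<eta> k ^ n = 1" unfolding \<eta>_def using complex_root_unity[of n k] n by simp
  then have \<eta>0: "\<eta> k \<noteq> 0" using n by (auto simp: power_0_left)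
  have eig: "\<eta> k * G k (g * x) = G k x" for x
  proof -
    define h where "h j = \<eta> k ^ j * F (g ^ j * x)" for j
    have "[g ^ n * x = 1 * x] (mod int q)"
      unfolding n_def using coprime_pow_totient_int[OF g q] by (intro cong_mult) auto
    then have hn: "h n = h 0" unfolding h_def using \<eta>n F(1)[of "g ^ n * x" x] by simp
    have "\<eta> k * G k (g * x) = (\<Sum>j<n. h (Suc j))"
      unfolding G_def h_def by (simp add: sum_distrib_left mult_ac)
    also have "\<dots> = (\<Sum>j<n. h j)"
      using sum.lessThan_Suc_shift[of h n] sum.lessThan_Suc[of h n] hn by simp
    finally show ?thesis by (simp add: G_def h_def)
  qed
  show ?case
  proof (intro exI[of _ "G k"] conjI allI impI ballI)
    fix x y assume "[x = y] (mod int q)"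
    then show "G k x = G k y" unfolding G_def by (intro sum.cong refl arg_cong2[of _ _ _ _ "(*)"] F(1) cong_mult) auto
  next
    fix x assume "\<not> coprime x (int q)"
    then show "G k x = 0" unfolding G_def by (intro sum.neutral ballI) (simp add: F(2))
  next
    fix h assume "h \<in> insert g gs"
    then consider "h = g" | "h \<in> gs" by blast
    then show "\<exists>\<omega>. \<forall>x. G k (h * x) = \<omega> * G k x"
    proof cases
      case 1
      have "\<forall>x. G k (h * x) = inverse (\<eta> k) * G k x" using eig \<eta>0 1 by (simp add: field_simps)
      then show ?thesis by blast
    next
      case 2
      then obtain \<omega> where w: "\<forall>x. F (h * x) = \<omega> * F x" using F(4) by blast
      have "G k (h * x) = \<omega> * G k x" for x
      proof -
        have "F (g ^ j * (h * x)) = \<omega> * F (g ^ j * x)" for j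
          using w by (metis mult.left_commute)
        then show ?thesis unfolding G_def by (simp add: sum_distrib_left mult_ac)
      qed
      then show ?thesis by blast
    qed
  qed (use k in simp)
qed

text \<open>A joint eigenfunction F of all dilations satisfies F(xy) F(1) = F(x) F(y), so F / F(1)
  is a character once F(1) is nonzero.\<close>

lemma exists_char_neq_one:
  assumes q: "q \<ge> 1" and a: "\<not> [a = 1] (mod int q)" and cop: "coprime a (int q)"
  shows "\<exists>\<psi>. dirichlet_char q \<psi> \<and> \<psi> a \<noteq> 1"
proof -
  define gs where "gs = {g\<in>{0..<int q}. coprime g (int q)}"
  have "finite gs" unfolding gs_def by (rule finite_subset[of _ "{0..<int q}"]) auto
  moreover have "\<And>g. g \<in> gs \<Longrightarrow> coprime g (int q)" by (auto simp: gs_def)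
  ultimately have "finite gs" "\<And>g. g \<in> gs \<Longrightarrow> coprime g (int q)" by blast+
  from dilation_eigenfunction[OF q a this]
  obtain F :: "int \<Rightarrow> complex" where F: "\<And>x y. [x = y] (mod int q) \<Longrightarrow> F x = F y" "\<And>x. \<not> coprime x (int q) \<Longrightarrow> F x = 0"
     "F a \<noteq> F 1" "\<And>h. h \<in> gs \<Longrightarrow> \<exists>\<omega>. \<forall>x. F (h * x) = \<omega> * F x"
    by blast
  have eig: "F (x * y) * F 1 = F x * F y" if x: "coprime x (int q)" for x y
  proof -
    have "x mod int q \<in> gs" using x q unfolding gs_def by (simp add: coprime_mod_left_iff)
    then obtain \<omega> where w: "\<And>y. F ((x mod int q) * y) = \<omega> * F y" using F(4) by blast
    have w': "F (x * y) = \<omega> * F y" for y using w[of y] F(1)[of "x mod int q * y" "x * y"]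
      by (simp add: cong_def mod_mult_left_eq)
    show ?thesis using w'[of y] w'[of 1] by simp
  qed
  \<comment> \<open>If F 1 vanished, the relation at x = y = a would give F a = 0 = F 1.\<close>
  have F1: "F 1 \<noteq> 0"
  proof
    assume z: "F 1 = 0"
    have "F a * F a = 0" using eig[OF cop, of a] z by simp
    with z F(3) show False by simp
  qed
  define \<psi> where "\<psi> x = F x / F 1" for x
  have mult: "\<psi> (x * y) = \<psi> x * \<psi> y" for x y
  proof (cases "coprime x (int q)")
    case True
    then show ?thesis using eig[OF True, of y] F1 unfolding \<psi>_def by (simp add: field_simps)
  next
    case False
    then have "\<not> coprime (x * y) (int q)" by simp
    then show ?thesis using False F(2) unfolding \<psi>_def by simp
  qed
  have "\<psi> x \<noteq> 0" if x: "coprime x (int q)" for x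
  proof -
    obtain b where b: "[x * b = 1] (mod int q)" using x cong_solve_coprime_int by blast
    have "\<psi> x * \<psi> b = 1" using mult[of x b] F(1)[OF b] F1 by (simp add: \<psi>_def)
    then show ?thesis by auto
  qed
  moreover have "\<psi> (x + int q) = \<psi> x" for x unfolding \<psi>_def by (subst F(1)[of "x + int q" x]) (auto simp: cong_def)
  ultimately have "dirichlet_char q \<psi>" unfolding dirichlet_char_def using q mult F(2) F1 by (auto simp: \<psi>_def)
  moreover have "\<psi> a \<noteq> 1" using F(3) F1 by (simp add: \<psi>_def)
  ultimately show ?thesis by blast
qed

text \<open>Multiplication by a character \<xi> with \<xi>(a) \<noteq> 1 permutes
  \<open>dchars q\<close> and multiplies the sum by \<xi>(a). The number of characters stays
  unevaluated here, because this very relation is used to compute it.\<close>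

lemma sum_dchars_raw:
  assumes cop: "coprime a (int q)"
  shows "(\<Sum>\<psi>\<in>dchars q. \<psi> a) = (if [a = 1] (mod int q) then of_nat (card (dchars q)) else 0)"
proof (cases "[a = 1] (mod int q)")
  case True
  have "\<psi> a = 1" if "\<psi> \<in> dchars q" for \<psi>
    using that dirichlet_char_cong[OF _ True, of \<psi>] by (auto simp: dchars_def dirichlet_char_def)
  then have "(\<Sum>\<psi>\<in>dchars q. \<psi> a) = (\<Sum>\<psi>\<in>dchars q. 1)" by (intro sum.cong) auto
  then show ?thesis using True by simp
next
  case False
  show ?thesis
  proof (cases "q \<ge> 1")
    case True
    then obtain \<xi> where \<xi>: "dirichlet_char q \<xi>" "\<xi> a \<noteq> 1" using exists_char_neq_one[OF True False cop] by blast
    have id: "\<psi> n * \<xi> n * cnj (\<xi> n) = \<psi> n" if "dirichlet_char q \<psi>" for \<psi> n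
    proof (cases "coprime n (int q)")
      case c: True
      have "\<xi> n * cnj (\<xi> n) = 1" using dirichlet_char_norm[OF \<xi>(1), of n] c
        by (simp add: complex_norm_square[symmetric])
      then show ?thesis by (simp add: mult.assoc)
    qed (use that in \<open>auto simp: dirichlet_char_def\<close>)
    have id': "\<psi> n * cnj (\<xi> n) * \<xi> n = \<psi> n" if "dirichlet_char q \<psi>" for \<psi> n
      using id[OF that, of n] by (simp add: mult_ac)
    have "(\<Sum>\<psi>\<in>dchars q. \<psi> a * \<xi> a) = (\<Sum>\<psi>\<in>dchars q. \<psi> a)"
      by (rule sum.reindex_bij_witness[where i = "\<lambda>\<psi> n. \<psi> n * cnj (\<xi> n)" and j = "\<lambda>\<psi> n. \<psi> n * \<xi> n"])
         (auto simp: dchars_def fun_eq_iff id \<xi> dirichlet_char_mult_same dirichlet_char_cnj id')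
    then have "(\<Sum>\<psi>\<in>dchars q. \<psi> a) * \<xi> a = (\<Sum>\<psi>\<in>dchars q. \<psi> a)" by (simp only: sum_distrib_right)
    then show ?thesis using \<xi> False by simp
  next
    case f: False
    then have "dchars q = {}" by (auto simp: dchars_def dirichlet_char_def)
    then show ?thesis using False by simp
  qed
qed

lemma sum_residues_dilate:
  fixes F :: "int \<Rightarrow> 'a :: comm_monoid_add"
  assumes per: "\<And>x y. [x = y] (mod int q) \<Longrightarrow> F x = F y" and b: "coprime b (int q)" and q: "q \<ge> 1"
  shows "(\<Sum>x\<in>{0..<int q}. F (b * x)) = (\<Sum>x\<in>{0..<int q}. F x)"
proof -
  obtain c where c: "[b * c = 1] (mod int q)" using b cong_solve_coprime_int by blast
  have c1: "c * (b * x mod int q) mod int q = x" "b * (c * x mod int q) mod int q = x" if "x \<in> {0..<int q}" for x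
  proof -
    have "[c * (b * x mod int q) = b * c * x] (mod int q)"
      by (simp add: cong_def mod_mult_right_eq mult_ac)
    moreover have "[b * c * x = 1 * x] (mod int q)" using c by (intro cong_mult) auto
    ultimately have "[c * (b * x mod int q) = x] (mod int q)" by (metis cong_trans mult_1)
    then show "c * (b * x mod int q) mod int q = x" using that by (simp add: cong_def)
    have "[b * (c * x mod int q) = b * c * x] (mod int q)"
      by (simp add: cong_def mod_mult_right_eq mult_ac)
    moreover have "[b * c * x = 1 * x] (mod int q)" using c by (intro cong_mult) auto
    ultimately have "[b * (c * x mod int q) = x] (mod int q)" by (metis cong_trans mult_1)
    then show "b * (c * x mod int q) mod int q = x" using that by (simp add: cong_def)
  qed
  show ?thesis
    by (rule sum.reindex_bij_witness[where i = "\<lambda>x. c * x mod int q" and j = "\<lambda>x. b * x mod int q"])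
       (use c1 q in \<open>auto intro!: per simp: cong_def\<close>)
qed

lemma sum_residues_nonprincipal:
  assumes \<psi>: "dirichlet_char q \<psi>" and b: "coprime b (int q)" "\<psi> b \<noteq> 1"
  shows "(\<Sum>x\<in>{0..<int q}. \<psi> x) = 0"
proof -
  have "(\<Sum>x\<in>{0..<int q}. \<psi> x) = (\<Sum>x\<in>{0..<int q}. \<psi> (b * x))"
    by (rule sum_residues_dilate[symmetric]) (use dirichlet_char_cong[OF \<psi>] b \<psi> in \<open>auto simp: dirichlet_char_def\<close>)
  also have "\<dots> = \<psi> b * (\<Sum>x\<in>{0..<int q}. \<psi> x)"
    using \<psi> by (simp add: dirichlet_char_def sum_distrib_left)
  finally show ?thesis using b(2) by (simp add: algebra_simps)
qed

lemma card_coprime_residues: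
  assumes "q \<ge> 1"
  shows "card {x\<in>{0..<int q}. coprime x (int q)} = totient q"
proof -
  have "card (totatives q) = card {x\<in>{0..<int q}. coprime x (int q)}"
  \<comment> \<open>For q = 1 the only residue is 0, whereas \<open>totatives\<close> lists
    1.\<close>
  proof (cases "q = 1")
    case True
    have "{x\<in>{0..<int q}. coprime x (int q)} = {0}" using True by auto
    then show ?thesis using True by simp
  next
    case False
    have "{x\<in>{0..<int q}. coprime x (int q)} = int ` totatives q"
    proof (intro equalityI subsetI)
      fix x assume x: "x \<in> {x\<in>{0..<int q}. coprime x (int q)}"
      then have "x \<noteq> 0" using False assms by auto
      then have "x = int (nat x)" "nat x \<in> totatives q" using x
        by (auto simp: in_totatives_iff simp flip: coprime_int_iff)
      then show "x \<in> int ` totatives q" by blast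
    next
      fix x assume "x \<in> int ` totatives q"
      then show "x \<in> {x\<in>{0..<int q}. coprime x (int q)}"
        using totatives_less[of _ q] False assms by (auto simp: in_totatives_iff)
    qed
    then show ?thesis by (simp add: card_image)
  qed
  then show ?thesis by (simp add: totient_def)
qed

lemma nonprincipal_witness:
  assumes "dirichlet_char q \<psi>" "\<psi> \<noteq> dprinc q"
  shows "\<exists>b. coprime b (int q) \<and> \<psi> b \<noteq> 1"
  using assms unfolding dprinc_def dirichlet_char_def by (metis ext)

text \<open>Double counting of the sum of \<psi>(x) over all characters and residues: summing over x
  first leaves only the principal character, summing over \<psi> first leaves only the class of 1,
  with the unknown cardinality as its weight.\<close>

lemma card_dchars:
  assumes "q \<ge> 1"
  shows "card (dchars q) = totient q"
proof -
  have inner: "(\<Sum>x\<in>{0..<int q}. \<psi> x) = (if \<psi> = dprinc q then of_nat (totient q) else 0)" if "\<psi> \<in> dchars q" for \<psi>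
  proof (cases "\<psi> = dprinc q")
    case True
    have "(\<Sum>x\<in>{0..<int q}. \<psi> x) = (\<Sum>x\<in>{x\<in>{0..<int q}. coprime x (int q)}. 1)"
      unfolding True dprinc_def by (intro sum.mono_neutral_cong_right) auto
    then show ?thesis using True card_coprime_residues[OF assms] by simp
  next
    case False
    then show ?thesis using that nonprincipal_witness[of q \<psi>] sum_residues_nonprincipal[of q \<psi>] by (auto simp: dchars_def)
  qed
  have "(\<Sum>\<psi>\<in>dchars q. \<Sum>x\<in>{0..<int q}. \<psi> x) = (\<Sum>\<psi>\<in>dchars q. if \<psi> = dprinc q then of_nat (totient q) else 0)"
    using inner by simp
  also have "\<dots> = of_nat (totient q)"
    using finite_dchars dprinc_dirichlet[OF assms] by (simp add: sum.delta dchars_def)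
  finally have 1: "(\<Sum>\<psi>\<in>dchars q. \<Sum>x\<in>{0..<int q}. \<psi> x) = of_nat (totient q)" .
  have "(\<Sum>\<psi>\<in>dchars q. \<Sum>x\<in>{0..<int q}. \<psi> x) = (\<Sum>x\<in>{0..<int q}. \<Sum>\<psi>\<in>dchars q. \<psi> x)" by (rule sum.swap)
  \<comment> \<open>Writing \<open>1 mod int q\<close> for the class of 1 covers q = 1, where the
    representative is 0.\<close>
  also have "\<dots> = (\<Sum>x\<in>{0..<int q}. if x = 1 mod int q then of_nat (card (dchars q)) else 0)"
  proof (rule sum.cong[OF refl])
    fix x assume x: "x \<in> {0..<int q}"
    show "(\<Sum>\<psi>\<in>dchars q. \<psi> x) = (if x = 1 mod int q then of_nat (card (dchars q)) else 0)"
    proof (cases "coprime x (int q)")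
      case True
      have "[x = 1] (mod int q) \<longleftrightarrow> x = 1 mod int q" using x by (simp add: cong_def)
      then show ?thesis using sum_dchars_raw[OF True] by simp
    next
      case False
      then have "x \<noteq> 1 mod int q" using assms coprime_mod_left_iff[of "int q" 1] by auto
      moreover have "\<psi> x = 0" if "\<psi> \<in> dchars q" for \<psi> using that False by (auto simp: dchars_def dirichlet_char_def)
      then have "(\<Sum>\<psi>\<in>dchars q. \<psi> x) = 0" by (intro sum.neutral ballI)
      ultimately show ?thesis by simp
    qed
  qed
  also have "\<dots> = of_nat (card (dchars q))" using assms by (simp add: sum.delta)
  finally show ?thesis using 1 by (metis of_nat_eq_iff)
qed

lemma sum_dchars:
  assumes "q \<ge> 1" "coprime a (int q)"
  shows "(\<Sum>\<psi>\<in>dchars q. \<psi> a) = (if [a = 1] (mod int q) then of_nat (totient q) else 0)"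
  using sum_dchars_raw[OF assms(2)] card_dchars[OF assms(1)] by simp

lemma sum_dchars_cnj:
  assumes q: "q \<ge> 1" and x: "coprime x (int q)" and m: "coprime m (int q)"
  shows "(\<Sum>\<psi>\<in>dchars q. cnj (\<psi> x) * \<psi> m) = (if [x = m] (mod int q) then of_nat (totient q) else 0)"
proof -
  obtain y where y: "[x * y = 1] (mod int q)" using x cong_solve_coprime_int by blast
  have cy: "coprime y (int q)" using y
    by (metis cong_imp_coprime cong_sym coprime_1_left coprime_mult_left_iff)
  have "cnj (\<psi> x) = \<psi> y" if "\<psi> \<in> dchars q" for \<psi>
  proof -
    have c: "dirichlet_char q \<psi>" using that by (simp add: dchars_def)
    have "\<psi> x * \<psi> y = 1" using dirichlet_char_cong[OF c y] c by (simp add: dirichlet_char_def)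
    moreover have "\<psi> x * cnj (\<psi> x) = 1" using dirichlet_char_norm[OF c, of x] x
        by (simp add: complex_norm_square[symmetric])
    ultimately show ?thesis by (metis mult.left_commute mult.right_neutral)
  qed
  then have "(\<Sum>\<psi>\<in>dchars q. cnj (\<psi> x) * \<psi> m) = (\<Sum>\<psi>\<in>dchars q. \<psi> (y * m))"
    by (intro sum.cong) (auto simp: dchars_def dirichlet_char_def)
  also have "\<dots> = (if [y * m = 1] (mod int q) then of_nat (totient q) else 0)"
    using sum_dchars[OF q, of "y * m"] cy m by simp
  also have "[y * m = 1] (mod int q) \<longleftrightarrow> [x = m] (mod int q)"
  proof
    assume "[y * m = 1] (mod int q)"
    then have "[x * (y * m) = x * 1] (mod int q)" by (intro cong_mult) auto
    moreover have "[x * y * m = 1 * m] (mod int q)" using y by (intro cong_mult) auto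
    ultimately show "[x = m] (mod int q)" by (simp add: mult.assoc cong_def)
  next
    assume "[x = m] (mod int q)"
    then have "[x * y = m * y] (mod int q)" by (intro cong_mult) auto
    then show "[y * m = 1] (mod int q)" using y by (simp add: mult.commute cong_def)
  qed
  finally show ?thesis .
qed

text \<open>The c \<psi> are the Fourier coefficients of G on the unit group: averages of terms of
  norm at most 1, hence bounded by 1. For an even \<psi> the substitution of -x for x shows that the
  coefficient is its own negative.\<close>

lemma odd_function_expansion:
  fixes G :: "int \<Rightarrow> complex"
  assumes q: "q \<ge> 1" and per: "\<And>x y. [x = y] (mod int q) \<Longrightarrow> G x = G y"
    and supp: "\<And>x. \<not> coprime x (int q) \<Longrightarrow> G x = 0" and odd: "\<And>x. G (- x) = - G x" and bd: "\<And>x. norm (G x) \<le> 1"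
  obtains c where "\<And>\<psi>. norm (c \<psi> :: complex) \<le> 1" "\<And>m. G m = (\<Sum>\<psi>\<in>{\<psi>\<in>dchars q. \<psi> (-1) = -1}. c \<psi> * \<psi> m)"
proof
  define c where "c \<psi> = (if \<psi> \<in> dchars q then (1 / of_nat (totient q)) * (\<Sum>x\<in>{0..<int q}. G x * cnj (\<psi> x)) else 0)" for \<psi> :: "int \<Rightarrow> complex"
  have tpos: "totient q > 0" using q by simp
  show "norm (c \<psi>) \<le> 1" for \<psi>
  proof (cases "\<psi> \<in> dchars q")
    case True
    have "norm (\<Sum>x\<in>{0..<int q}. G x * cnj (\<psi> x)) \<le> (\<Sum>x\<in>{0..<int q}. if coprime x (int q) then 1 else 0)"
      using True by (intro sum_norm_le) (auto simp: dchars_def norm_mult dirichlet_char_norm bd supp)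
    also have "\<dots> = real (card {x\<in>{0..<int q}. coprime x (int q)})"
      by (subst sum.inter_filter[symmetric]) auto
    also have "\<dots> = totient q" using card_coprime_residues[OF q] by simp
    finally show ?thesis using True tpos by (simp add: c_def norm_mult norm_divide field_simps)
  qed (simp add: c_def)
  show "G m = (\<Sum>\<psi>\<in>{\<psi>\<in>dchars q. \<psi> (-1) = -1}. c \<psi> * \<psi> m)" for m
  proof -
    have even0: "c \<psi> = 0" if "\<psi> \<in> dchars q" "\<psi> (-1) \<noteq> -1" for \<psi>
    proof -
      have d: "dirichlet_char q \<psi>" using that by (simp add: dchars_def)
      have e: "\<psi> (-x) = \<psi> x" for x
        using that dirichlet_char_minus_one[OF d] dirichlet_char_uminus[OF d, of x] by auto
      have "(\<Sum>x\<in>{0..<int q}. G x * cnj (\<psi> x)) = (\<Sum>x\<in>{0..<int q}. G (-1 * x) * cnj (\<psi> (-1 * x)))"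
      proof (rule sum_residues_dilate[symmetric, where F = "\<lambda>x. G x * cnj (\<psi> x)"])
        fix x y :: int assume "[x = y] (mod int q)"
        then show "G x * cnj (\<psi> x) = G y * cnj (\<psi> y)" using per dirichlet_char_cong[OF d] by metis
      qed (use q in auto)
      also have "\<dots> = - (\<Sum>x\<in>{0..<int q}. G x * cnj (\<psi> x))" by (simp add: e odd sum_negf)
      finally show ?thesis by (simp add: c_def)
    qed
    have "(\<Sum>\<psi>\<in>{\<psi>\<in>dchars q. \<psi> (-1) = -1}. c \<psi> * \<psi> m) = (\<Sum>\<psi>\<in>dchars q. c \<psi> * \<psi> m)"
      using finite_dchars even0 by (intro sum.mono_neutral_left) auto
    also have "\<dots> = (\<Sum>\<psi>\<in>dchars q. \<Sum>x\<in>{0..<int q}. (1 / of_nat (totient q)) * G x * (cnj (\<psi> x) * \<psi> m))"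
      by (intro sum.cong refl) (simp add: c_def sum_distrib_left sum_distrib_right mult_ac)
    also have "\<dots> = (\<Sum>x\<in>{0..<int q}. (1 / of_nat (totient q)) * G x * (\<Sum>\<psi>\<in>dchars q. cnj (\<psi> x) * \<psi> m))"
      by (subst sum.swap) (simp add: sum_distrib_left)
    also have "\<dots> = G m"
    proof (cases "coprime m (int q)")
      case True
      have "(\<Sum>x\<in>{0..<int q}. (1 / of_nat (totient q)) * G x * (\<Sum>\<psi>\<in>dchars q. cnj (\<psi> x) * \<psi> m)) =
            (\<Sum>x\<in>{0..<int q}. if x = m mod int q then G m else 0)"
      proof (rule sum.cong[OF refl])
        fix x assume x: "x \<in> {0..<int q}"
        have eq: "[x = m] (mod int q) \<longleftrightarrow> x = m mod int q" using x by (simp add: cong_def)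
        show "(1 / of_nat (totient q)) * G x * (\<Sum>\<psi>\<in>dchars q. cnj (\<psi> x) * \<psi> m) = (if x = m mod int q then G m else 0)"
        proof (cases "coprime x (int q)")
          case cx: True
          show ?thesis using sum_dchars_cnj[OF q cx True] eq tpos per[of x m] by auto
        next
          case cx: False
          then have "x \<noteq> m mod int q" using True q coprime_mod_left_iff[of "int q" m] by auto
          then show ?thesis using supp[OF cx] by simp
        qed
      qed
      also have "\<dots> = G m" using q by (simp add: sum.delta)
      finally show ?thesis .
    next
      case False
      then have "\<psi> m = 0" if "\<psi> \<in> dchars q" for \<psi> using that by (auto simp: dchars_def dirichlet_char_def)
      then have "(\<Sum>\<psi>\<in>dchars q. cnj (\<psi> x) * \<psi> m) = 0" for x by (intro sum.neutral) auto
      then show ?thesis using supp[OF False] by simp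
    qed
    finally show ?thesis by simp
  qed
qed

text \<open>Blocks of q consecutive integers cancel completely; fewer than q terms can remain after
  removing them, or q when the range is a single block.\<close>

lemma dirichlet_char_partial_sum:
  assumes \<psi>: "dirichlet_char q \<psi>" and np: "\<psi> \<noteq> dprinc q"
  shows "norm (\<Sum>n\<in>{A<..B}. \<psi> (int n)) \<le> real q"
proof -
  have q: "q \<ge> 1" using \<psi> by (simp add: dirichlet_char_def)
  obtain b where b: "coprime b (int q)" "\<psi> b \<noteq> 1" using nonprincipal_witness[OF \<psi> np] by blast
  have block: "(\<Sum>n\<in>{A<..A + q}. \<psi> (int n)) = 0" for A
  proof -
    have "(\<Sum>n\<in>{A<..A + q}. \<psi> (int n)) = (\<Sum>x\<in>{0..<int q}. \<psi> x)"
    proof (rule sum.reindex_bij_witness[where j = "\<lambda>n. int n mod int q" and i = "\<lambda>x. nat (int A + 1 + (x - (int A + 1)) mod int q)"])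
      fix n assume n: "n \<in> {A<..A+q}"
      have "(int n mod int q - (int A + 1)) mod int q = (int n - (int A + 1)) mod int q" by (simp add: mod_simps)
      also have "\<dots> = int n - (int A + 1)" using n by (intro mod_pos_pos_trivial) auto
      finally show "nat (int A + 1 + (int n mod int q - (int A + 1)) mod int q) = n" by simp
      show "int n mod int q \<in> {0..<int q}" using q by auto
      show "\<psi> (int n mod int q) = \<psi> (int n)" by (rule dirichlet_char_cong[OF \<psi>]) (simp add: cong_def)
    next
      fix x assume x: "x \<in> {0..<int q}"
      define y where "y = (x - (int A + 1)) mod int q"
      have y: "0 \<le> y" "y < int q" using q unfolding y_def by auto
      show "nat (int A + 1 + (x - (int A + 1)) mod int q) \<in> {A<..A+q}" using y unfolding y_def[symmetric] by auto
      have "(int A + 1 + y) mod int q = x mod int q" unfolding y_def by (simp add: mod_simps)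
      then show "int (nat (int A + 1 + (x - (int A + 1)) mod int q)) mod int q = x"
        using x y unfolding y_def[symmetric] by simp
    qed
    also have "\<dots> = 0" by (rule sum_residues_nonprincipal[OF \<psi> b])
    finally show ?thesis .
  qed
  show ?thesis
  proof (induction "B - A" arbitrary: A rule: less_induct)
    case less
    show ?case
    proof (cases "B \<le> A + q")
      case True
      have "norm (\<Sum>n\<in>{A<..B}. \<psi> (int n)) \<le> (\<Sum>n\<in>{A<..B}. 1)"
        using dirichlet_char_norm_le[OF \<psi>] by (intro sum_norm_le) auto
      also have "\<dots> \<le> real q" using True by simp
      finally show ?thesis .
    next
      case False
      have "{A<..B} = {A<..A+q} \<union> {A+q<..B}" using False by auto
      then have "(\<Sum>n\<in>{A<..B}. \<psi> (int n)) = (\<Sum>n\<in>{A+q<..B}. \<psi> (int n))"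
        using block by (simp add: sum.union_disjoint)
      then show ?thesis using less[of "A + q"] False q by simp
    qed
  qed
qed

section \<open>Euler products and prime sums of characters\<close>

definition primes_upto :: "nat \<Rightarrow> nat set" where "primes_upto N = {p. prime p \<and> p \<le> N}"

lemma eventually_sequentially_obtain:
  assumes "eventually P sequentially"
  obtains M where "M \<ge> N" "P M"
  using assms unfolding eventually_sequentially by (metis max.cobounded1 max.cobounded2)

lemma finite_primes_upto [simp]: "finite (primes_upto N)" unfolding primes_upto_def by (rule finite_subset[of _ "{..N}"]) auto

lemma primes_upto_mono: "M \<le> N \<Longrightarrow> primes_upto M \<subseteq> primes_upto N" unfolding primes_upto_def by auto

lemma sum_inverse_squares_le: "(\<Sum>n\<in>{2..N}. 1 / real n ^ 2) \<le> 1"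
proof -
  have "(\<Sum>n\<in>{2..N}. 1 / real n ^ 2) \<le> 1 - 1 / real N" if "N \<ge> 1"
    using that
  proof (induction N rule: nat_induct_at_least)
    case (Suc n)
    have "{2..Suc n} = insert (Suc n) {2..n}" using Suc.hyps by auto
    moreover have "1 / real (Suc n) ^ 2 \<le> 1 / real n - 1 / real (Suc n)"
    proof -
      have "1 / real (Suc n) ^ 2 \<le> 1 / (real n * real (Suc n))"
        unfolding power2_eq_square using Suc.hyps by (intro divide_left_mono mult_right_mono) auto
      also have "\<dots> = 1 / real n - 1 / real (Suc n)" using Suc.hyps by (simp add: field_simps)
      finally show ?thesis .
    qed
    ultimately show ?case using Suc.IH by simp
  qed simp
  moreover have "1 / real N \<ge> 0" by simp
  ultimately show ?thesis by (cases "N \<ge> 1") (linarith, simp)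
qed

lemma sum_primes_inverse_squares_le: "(\<Sum>p\<in>primes_upto N. 1 / real p ^ 2) \<le> 1"
proof -
  have "(\<Sum>p\<in>primes_upto N. 1 / real p ^ 2) \<le> (\<Sum>n\<in>{2..N}. 1 / real n ^ 2)"
    by (rule sum_mono2) (auto simp: primes_upto_def prime_ge_2_nat)
  then show ?thesis using sum_inverse_squares_le by (rule order.trans)
qed

text \<open>A sieve on the series: numbers free of the primes in P are either free of p as well, or
  p times a number free of P. So multiplication by 1 - f p removes exactly the multiples of
  p.\<close>

lemma rough_product:
  fixes f :: "nat \<Rightarrow> complex"
  assumes sm: "(\<lambda>n. norm (f n)) summable_on UNIV" and mult: "\<And>m n. f (m * n) = f m * f n"
    and P: "finite P" "\<And>p. p \<in> P \<Longrightarrow> prime p"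
  shows "(\<Prod>p\<in>P. 1 - f p) * infsum f UNIV = infsum f {n. \<forall>p\<in>P. \<not> p dvd n}"
  using P
proof (induction P rule: finite_induct)
  case (insert p P)
  define S where "S = {n. \<forall>p\<in>P. \<not> p dvd n}"
  define S' where "S' = {n. \<forall>q\<in>insert p P. \<not> q dvd n}"
  have pp: "prime p" using insert.prems by simp
  have smA: "f summable_on A" for A
    using sm abs_summable_summable summable_on_subset_banach by blast
  have "S = S' \<union> (\<lambda>n. p * n) ` S"
  proof (intro equalityI subsetI)
    fix n assume n: "n \<in> S"
    show "n \<in> S' \<union> (\<lambda>n. p * n) ` S"
    proof (cases "p dvd n")
      case True
      then obtain m where "n = p * m" by (auto simp: dvd_def)
      moreover from this have "m \<in> S" using n unfolding S_def by auto
      ultimately show ?thesis by blast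
    qed (use n in \<open>auto simp: S_def S'_def\<close>)
  next
    fix n assume "n \<in> S' \<union> (\<lambda>n. p * n) ` S"
    moreover have "\<not> q dvd p" if "q \<in> P" for q
      using primes_dvd_imp_eq[of q p] that insert.hyps insert.prems[of q] pp by auto
    ultimately show "n \<in> S" unfolding S_def S'_def using insert.prems by (auto simp: prime_dvd_mult_iff)
  qed
  moreover have "S' \<inter> (\<lambda>n. p * n) ` S = {}" unfolding S'_def by auto
  ultimately have "infsum f S = infsum f S' + infsum f ((\<lambda>n. p * n) ` S)"
    using infsum_Un_disjoint[OF smA smA, of S' "(\<lambda>n. p * n) ` S"] by simp
  also have "infsum f ((\<lambda>n. p * n) ` S) = infsum (f \<circ> (\<lambda>n. p * n)) S"
    using pp by (intro infsum_reindex) (auto simp: inj_on_def prime_gt_0_nat)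
  also have "\<dots> = f p * infsum f S" by (simp add: o_def mult infsum_cmult_right')
  finally have "(1 - f p) * infsum f S = infsum f S'" unfolding left_diff_distrib mult_1_left diff_eq_eq .
  moreover have "(\<Prod>q\<in>P. 1 - f q) * infsum f UNIV = infsum f S"
    unfolding S_def using insert.IH insert.prems by blast
  ultimately show ?case
    unfolding S'_def[symmetric] prod.insert[OF insert.hyps] by (simp only: mult.assoc)
qed simp

lemma infsum_tail_tendsto:
  fixes g :: "nat \<Rightarrow> real"
  assumes "g summable_on UNIV"
  shows "(\<lambda>N. infsum g {N<..}) \<longlonglongrightarrow> 0"
proof -
  have smA: "g summable_on A" for A using assms summable_on_subset_banach by blast
  have "(g has_sum infsum g UNIV) UNIV" using assms by simp
  then have "g sums infsum g UNIV" by (rule has_sum_imp_sums)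
  then have lim: "(\<lambda>n. sum g {..<n}) \<longlonglongrightarrow> infsum g UNIV" by (simp add: sums_def)
  have "infsum g {N<..} = infsum g UNIV - sum g {..<Suc N}" for N
  proof -
    have "UNIV = {..<Suc N} \<union> {N<..}" by auto
    then have "infsum g UNIV = infsum g {..<Suc N} + infsum g {N<..}"
      using infsum_Un_disjoint[OF smA smA, of "{..<Suc N}" "{N<..}"] by force
    then show ?thesis by simp
  qed
  moreover have "(\<lambda>N. infsum g UNIV - sum g {..<Suc N}) \<longlonglongrightarrow> infsum g UNIV - infsum g UNIV"
    by (intro tendsto_diff tendsto_const LIMSEQ_Suc[OF lim])
  ultimately show ?thesis by simp
qed

text \<open>Besides 1, every positive number without prime factors up to N exceeds N, so the error
  is a tail of the series. Keeping the sum as a factor, instead of inverting the product, yields the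
  nonvanishing of the sum as a by-product.\<close>

lemma euler_product_tendsto:
  fixes f :: "nat \<Rightarrow> complex"
  assumes sm: "(\<lambda>n. norm (f n)) summable_on UNIV" and mult: "\<And>m n. f (m * n) = f m * f n"
    and f: "f 0 = 0" "f 1 = 1"
  shows "(\<lambda>N. (\<Prod>p\<in>primes_upto N. 1 - f p) * infsum f UNIV) \<longlonglongrightarrow> 1"
proof -
  have smA: "f summable_on A" for A
    using sm abs_summable_summable summable_on_subset_banach by blast
  have smN: "(\<lambda>n. norm (f n)) summable_on A" for A using sm summable_on_subset_banach by blast
  have "norm ((\<Prod>p\<in>primes_upto N. 1 - f p) * infsum f UNIV - 1) \<le> infsum (\<lambda>n. norm (f n)) {N<..}" for N
  proof -
    define A where "A = {n. \<forall>p\<in>primes_upto N. \<not> p dvd n}"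
    define B where "B = A - {0, 1}"
    have sub: "B \<subseteq> {N<..}"
    proof
      fix n assume n: "n \<in> B"
      then obtain p where p: "prime p" "p dvd n" using prime_factor_nat[of n] unfolding B_def by auto
      then have "p > N" using n unfolding B_def A_def primes_upto_def by force
      moreover have "p \<le> n" using p n unfolding B_def by (intro dvd_imp_le) auto
      ultimately show "n \<in> {N<..}" by simp
    qed
    have "1 \<in> A" unfolding A_def primes_upto_def by auto
    \<comment> \<open>0 belongs to \<open>A\<close> precisely when there is no prime up to N; its
      term is f 0 = 0.\<close>
    then have AB: "A = insert 1 B \<or> A = insert 0 (insert 1 B)" unfolding B_def by auto
    have "0 \<notin> B" "1 \<notin> B" unfolding B_def by auto
    then have "infsum f A = 1 + infsum f B"
      using AB f smA by (auto simp: infsum_insert)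
    then have "(\<Prod>p\<in>primes_upto N. 1 - f p) * infsum f UNIV - 1 = infsum f B"
      using rough_product[OF sm mult finite_primes_upto, of N] unfolding A_def primes_upto_def by simp
    moreover have "norm (infsum f B) \<le> infsum (\<lambda>n. norm (f n)) B"
      using smN by (rule norm_infsum_bound)
    moreover have "infsum (\<lambda>n. norm (f n)) B \<le> infsum (\<lambda>n. norm (f n)) {N<..}"
      using smN sub by (intro infsum_mono2) auto
    ultimately show ?thesis by simp
  qed
  then have "(\<lambda>N. (\<Prod>p\<in>primes_upto N. 1 - f p) * infsum f UNIV - 1) \<longlonglongrightarrow> 0"
    by (intro Lim_null_comparison[OF _ infsum_tail_tendsto[OF sm]] always_eventually) simp
  then show ?thesis by (simp add: LIM_zero_iff)
qed

lemma norm_one_minus_le_exp: "norm (1 - w) \<le> exp (- Re w + norm w ^ 2 / 2)" for w :: complex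
proof -
  have "norm (1 - w) ^ 2 = 1 + (- 2 * Re w + norm w ^ 2)"
    by (simp only: cmod_power2) (simp add: power2_eq_square algebra_simps)
  also have "\<dots> \<le> exp (- 2 * Re w + norm w ^ 2)" by (rule exp_ge_add_one_self)
  also have "\<dots> = exp (- Re w + norm w ^ 2 / 2) ^ 2" by (simp add: exp_of_nat_mult[symmetric] flip: exp_double)
  finally show ?thesis by (rule power2_le_imp_le) simp
qed

text \<open>The Euler product times the sum is eventually larger than 1/2 in norm, while the product
  is at most exp(1/2 - sum of Re f(p)). Taking real logarithms of these norms avoids any complex
  logarithm; the constant 2 covers 1/2 + ln 2.\<close>

lemma euler_log_upper:
  fixes f :: "nat \<Rightarrow> complex"
  assumes sm: "(\<lambda>n. norm (f n)) summable_on UNIV" and mult: "\<And>m n. f (m * n) = f m * f n"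
    and f: "f 0 = 0" "f 1 = 1" and bd: "\<And>p. prime p \<Longrightarrow> norm (f p) \<le> 1 / real p"
    and L: "norm (infsum f UNIV) \<le> L"
  shows "L > 0" "\<forall>\<^sub>F N in sequentially. (\<Sum>p\<in>primes_upto N. Re (f p)) \<le> ln L + 2"
proof -
  have ev: "\<forall>\<^sub>F N in sequentially. norm ((\<Prod>p\<in>primes_upto N. 1 - f p) * infsum f UNIV) > 1/2"
    using order_tendstoD(1)[OF tendsto_norm[OF euler_product_tendsto[OF sm mult f]], of "1/2"] by simp
  have "infsum f UNIV \<noteq> 0"
  proof
    assume "infsum f UNIV = 0"
    with ev have "\<forall>\<^sub>F N::nat in sequentially. False" by simp
    then show False by simp
  qed
  then show Lpos: "L > 0" using L by (smt (verit) zero_less_norm_iff)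
  show "\<forall>\<^sub>F N in sequentially. (\<Sum>p\<in>primes_upto N. Re (f p)) \<le> ln L + 2"
    using ev
  proof eventually_elim
    case (elim N)
    have "norm (\<Prod>p\<in>primes_upto N. 1 - f p) \<le> (\<Prod>p\<in>primes_upto N. exp (- Re (f p) + norm (f p) ^ 2 / 2))"
      unfolding prod_norm[symmetric] by (intro prod_mono conjI norm_one_minus_le_exp) auto
    also have "\<dots> = exp (- (\<Sum>p\<in>primes_upto N. Re (f p)) + (\<Sum>p\<in>primes_upto N. norm (f p) ^ 2) / 2)"
      by (simp add: exp_sum[symmetric] sum.distrib sum_negf sum_divide_distrib sum_subtractf)
    also have "\<dots> \<le> exp (- (\<Sum>p\<in>primes_upto N. Re (f p)) + 1 / 2)"
    proof -
      have "(\<Sum>p\<in>primes_upto N. norm (f p) ^ 2) \<le> (\<Sum>p\<in>primes_upto N. 1 / real p ^ 2)"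
      proof (rule sum_mono)
        fix p assume "p \<in> primes_upto N"
        then have "norm (f p) ^ 2 \<le> (1 / real p) ^ 2" using bd by (intro power_mono) (auto simp: primes_upto_def)
        then show "norm (f p) ^ 2 \<le> 1 / real p ^ 2" by (simp add: power_divide)
      qed
      then show ?thesis using sum_primes_inverse_squares_le[of N] by simp
    qed
    finally have "1/2 \<le> exp (- (\<Sum>p\<in>primes_upto N. Re (f p)) + 1 / 2) * L"
      using elim L Lpos by (intro order.trans[OF less_imp_le[OF elim]]) (auto simp: norm_mult intro!: mult_mono)
    then have "ln (1/2) \<le> ln (exp (- (\<Sum>p\<in>primes_upto N. Re (f p)) + 1 / 2) * L)" using Lpos by (subst ln_le_cancel_iff) auto
    also have "\<dots> = - (\<Sum>p\<in>primes_upto N. Re (f p)) + 1 / 2 + ln L" using Lpos by (simp add: ln_mult)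
    also have "ln (1/2::real) = - ln 2" by (simp add: ln_div)
    finally show ?case using ln_le_minus_one[of "2::real"] by simp
  qed
qed

text \<open>The term at n = 0 vanishes because \<open>0 powr x\<close> is 0, so sums over all
  naturals are Dirichlet series.\<close>

definition dirichlet_term :: "(nat \<Rightarrow> complex) \<Rightarrow> real \<Rightarrow> nat \<Rightarrow> complex" where
  "dirichlet_term f s n = f n * of_real (real n powr - s)"

lemma norm_dirichlet_term: "norm (f n) \<le> 1 \<Longrightarrow> norm (dirichlet_term f s n) \<le> real n powr - s"
  by (simp add: dirichlet_term_def norm_mult mult_left_le_one_le)

lemma dirichlet_term_abs_summable:
  assumes "\<And>n. norm (f n) \<le> 1" "s > 1"
  shows "(\<lambda>n. norm (dirichlet_term f s n)) summable_on UNIV"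
proof -
  have "summable (\<lambda>n. real n powr - s)" using assms(2) by (simp add: summable_real_powr_iff)
  then have "summable (\<lambda>n. norm (dirichlet_term f s n))"
    by (rule summable_comparison_test'[where N = 0]) (simp add: norm_dirichlet_term assms(1))
  then show ?thesis by (subst summable_on_UNIV_nonneg_real_iff) auto
qed

lemma powr_minus_le_inverse: "s \<ge> 1 \<Longrightarrow> n \<ge> 1 \<Longrightarrow> real n powr - s \<le> 1 / real n"
  using powr_mono[of "-s" "-1" "real n"] by (simp add: powr_minus_divide)

lemma infsum_norm_le_partial:
  fixes f :: "nat \<Rightarrow> complex"
  assumes sm: "(\<lambda>n. norm (f n)) summable_on UNIV" and f0: "f 0 = 0"
    and bd: "\<And>B. norm (\<Sum>n\<in>{0<..B}. f n) \<le> L"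
  shows "norm (infsum f UNIV) \<le> L"
proof -
  have "(f has_sum infsum f UNIV) UNIV" using abs_summable_summable[OF sm] by simp
  then have "f sums infsum f UNIV" by (rule has_sum_imp_sums)
  then have "(\<lambda>n. sum f {..<Suc n}) \<longlonglongrightarrow> infsum f UNIV" unfolding sums_def by (rule LIMSEQ_Suc)
  moreover have "sum f {..<Suc n} = sum f {0<..n}" for n
  proof -
    have "{..<Suc n} = insert 0 {0<..n}" by auto
    then show ?thesis using f0 by simp
  qed
  ultimately have "(\<lambda>n. norm (sum f {0<..n})) \<longlonglongrightarrow> norm (infsum f UNIV)" by (intro tendsto_norm) simp
  then show ?thesis using bd by (rule Lim_bounded[where M = 0, rule_format])
qed

text \<open>The mean value theorem for x^(1-s) on [n, n+1] compares each summand with a telescoping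
  difference, as the integral test would.\<close>

lemma zeta_partial_bounds:
  assumes s: "s > 1"
  shows "(\<Sum>n\<in>{0<..B}. real n powr - s) \<le> 1 + 1 / (s - 1)"
    and "(1 - (real B + 1) powr (1 - s)) / (s - 1) \<le> (\<Sum>n\<in>{0<..B}. real n powr - s)"
proof -
  have mvt: "\<exists>x. real n < x \<and> x < real n + 1 \<and> (real n + 1) powr (1 - s) - real n powr (1 - s) = (1 - s) * x powr (- s)"
    if "n \<ge> 1" for n
  proof -
    have "\<exists>z>real n. z < real n + 1 \<and> (real n + 1) powr (1 - s) - real n powr (1 - s) = (real n + 1 - real n) * ((1 - s) * z powr (- s))"
    proof (rule MVT2)
      fix x assume "real n \<le> x" "x \<le> real n + 1"
      then have "x > 0" using that by linarith
      then have "((\<lambda>x. x powr (1 - s)) has_real_derivative (1 - s) * x powr (1 - s - 1)) (at x)"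
        by (rule has_real_derivative_powr)
      then show "((\<lambda>x. x powr (1 - s)) has_real_derivative (1 - s) * x powr (- s)) (at x)" by simp
    qed simp
    then show ?thesis by auto
  qed
  have up: "(s - 1) * (real n + 1) powr - s \<le> real n powr (1 - s) - (real n + 1) powr (1 - s)"
    and lo: "real n powr (1 - s) - (real n + 1) powr (1 - s) \<le> (s - 1) * real n powr - s" if "n \<ge> 1" for n
  proof -
    obtain x where x: "real n < x" "x < real n + 1" "(real n + 1) powr (1 - s) - real n powr (1 - s) = (1 - s) * x powr (- s)"
      using mvt[OF \<open>n \<ge> 1\<close>] by blast
    have "(real n + 1) powr - s \<le> x powr - s" "x powr - s \<le> real n powr - s"
      using x s that by (auto intro!: powr_mono2')
    then have "(s - 1) * (real n + 1) powr - s \<le> (s - 1) * x powr - s" "(s - 1) * x powr - s \<le> (s - 1) * real n powr - s"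
      using s by (auto intro!: mult_left_mono)
    then show "(s - 1) * (real n + 1) powr - s \<le> real n powr (1 - s) - (real n + 1) powr (1 - s)"
      "real n powr (1 - s) - (real n + 1) powr (1 - s) \<le> (s - 1) * real n powr - s"
      using x(3) by (auto simp: algebra_simps)
  qed
  have "(\<Sum>n\<in>{0<..B}. real n powr - s) * (s - 1) \<le> (s - 1) + 1 - real B powr (1 - s)" if "B \<ge> 1"
    using that
  proof (induction B rule: nat_induct_at_least)
    case base
    have "{0<..1::nat} = {1}" by auto
    then show ?case by simp
  next
    case (Suc n)
    have "{0<..Suc n} = insert (Suc n) {0<..n}" by auto
    then show ?case using Suc up[of n] by (simp add: algebra_simps)
  qed
  moreover have "real B powr (1 - s) \<ge> 0" for B by simp
  ultimately have "(\<Sum>n\<in>{0<..B}. real n powr - s) * (s - 1) \<le> (s - 1) + 1"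
    using s by (cases "B \<ge> 1") (smt (verit), simp)
  then have "(\<Sum>n\<in>{0<..B}. real n powr - s) \<le> ((s - 1) + 1) / (s - 1)" using s by (subst pos_le_divide_eq) auto
  then show "(\<Sum>n\<in>{0<..B}. real n powr - s) \<le> 1 + 1 / (s - 1)" using s by (simp only: add_divide_distrib) simp
  have "(1 - (real B + 1) powr (1 - s)) \<le> (\<Sum>n\<in>{0<..B}. real n powr - s) * (s - 1)"
  proof (induction B)
    case (Suc n)
    have "{0<..Suc n} = insert (Suc n) {0<..n}" by auto
    then show ?case using Suc lo[of "Suc n"] by (simp add: algebra_simps)
  qed simp
  then show "(1 - (real B + 1) powr (1 - s)) / (s - 1) \<le> (\<Sum>n\<in>{0<..B}. real n powr - s)"
    using s by (subst pos_divide_le_eq) auto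
qed

lemma dirichlet_term_mult:
  assumes "\<And>m n. f (m * n) = f m * f n"
  shows "dirichlet_term f s (m * n) = dirichlet_term f s m * dirichlet_term f s n"
  by (simp add: dirichlet_term_def assms powr_mult)

section \<open>Sums over primes near s = 1\<close>

lemma prime_powr_sum_upper:
  assumes s: "s > 1"
  shows "(\<Sum>p\<in>primes_upto N. real p powr - s) \<le> ln (1 + 1 / (s - 1)) + 2"
proof -
  define f where "f = dirichlet_term (\<lambda>_. 1) s"
  have fr: "f n = of_real (real n powr - s)" for n by (simp add: f_def dirichlet_term_def)
  have sm: "(\<lambda>n. norm (f n)) summable_on UNIV" unfolding f_def by (rule dirichlet_term_abs_summable) (use s in auto)
  have bd: "norm (\<Sum>n\<in>{0<..B}. f n) \<le> 1 + 1 / (s - 1)" for B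
  proof -
    have "(\<Sum>n\<in>{0<..B}. f n) = of_real (\<Sum>n\<in>{0<..B}. real n powr - s)" by (simp add: fr)
    then show ?thesis using zeta_partial_bounds(1)[OF s, of B] by (simp only: norm_of_real) (simp add: sum_nonneg)
  qed
  have f0: "f 0 = 0" "f 1 = 1" by (simp_all add: fr)
  have "\<forall>\<^sub>F N in sequentially. (\<Sum>p\<in>primes_upto N. Re (f p)) \<le> ln (1 + 1 / (s - 1)) + 2"
  proof (rule euler_log_upper(2)[OF sm _ f0])
    show "f (m * n) = f m * f n" for m n unfolding f_def by (rule dirichlet_term_mult) simp
    show "norm (f p) \<le> 1 / real p" if "prime p" for p
      using powr_minus_le_inverse[of s p] s prime_ge_1_nat[OF that] by (simp add: fr)
    show "norm (infsum f UNIV) \<le> 1 + 1 / (s - 1)" by (rule infsum_norm_le_partial[OF sm f0(1) bd])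
  qed
  \<comment> \<open>The terms are nonnegative, so a bound at one later M already holds at N.\<close>
  then obtain M where M: "M \<ge> N" "(\<Sum>p\<in>primes_upto M. Re (f p)) \<le> ln (1 + 1 / (s - 1)) + 2"
    by (rule eventually_sequentially_obtain)
  have "(\<Sum>p\<in>primes_upto N. real p powr - s) \<le> (\<Sum>p\<in>primes_upto M. real p powr - s)"
    using primes_upto_mono[OF M(1)] by (intro sum_mono2) auto
  also have "\<dots> = (\<Sum>p\<in>primes_upto M. Re (f p))" by (simp add: fr)
  finally show ?thesis using M(2) by simp
qed

text \<open>Here the Euler factors are bounded from below, by 1 - w \<ge> exp(-w - 2 w^2) for w
  \<le> 1/2, and the sum of the series is at least 1/(s-1). The bound is asymptotic in N, as a short
  sum over primes does not yet see the pole.\<close>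

lemma prime_powr_sum_lower:
  assumes s: "s > 1"
  shows "\<forall>\<^sub>F N in sequentially. (\<Sum>p\<in>primes_upto N. real p powr - s) \<ge> ln (1 / (s - 1)) - 3"
proof -
  define f where "f = dirichlet_term (\<lambda>_. 1) s"
  have fr: "f n = of_real (real n powr - s)" for n by (simp add: f_def dirichlet_term_def)
  have sm: "(\<lambda>n. norm (f n)) summable_on UNIV" unfolding f_def by (rule dirichlet_term_abs_summable) (use s in auto)
  have smr: "(\<lambda>n. real n powr - s) summable_on UNIV" using sm by (simp add: fr)
  define Z where "Z = infsum (\<lambda>n. real n powr - s) UNIV"
  have fZ: "infsum f UNIV = of_real Z"
    unfolding fr[abs_def] Z_def by (intro infsumI has_sum_of_real_iff[THEN iffD2] has_sum_infsum smr)
  have Zge: "Z \<ge> 1 / (s - 1)"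
  proof (rule LIMSEQ_le_const2)
    show "(\<lambda>B. (1 - (real B + 1) powr (1 - s)) / (s - 1)) \<longlonglongrightarrow> 1 / (s - 1)"
      using s by (real_asymp simp: field_simps)
    have "(1 - (real B + 1) powr (1 - s)) / (s - 1) \<le> Z" for B
    proof -
      have "(\<Sum>n\<in>{0<..B}. real n powr - s) \<le> Z" unfolding Z_def
        by (rule finite_sum_le_infsum) (use smr in auto)
      then show ?thesis using zeta_partial_bounds(2)[OF s, of B] by simp
    qed
    then show "\<exists>N. \<forall>n\<ge>N. (1 - (real n + 1) powr (1 - s)) / (s - 1) \<le> Z" by blast
  qed
  have "1 / (s - 1) > 0" using s by simp
  then have Zpos: "Z > 0" using Zge by linarith
  have "(\<lambda>N. (\<Prod>p\<in>primes_upto N. 1 - f p) * infsum f UNIV) \<longlonglongrightarrow> 1"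
    by (rule euler_product_tendsto[OF sm]) (unfold f_def, rule dirichlet_term_mult, simp_all add: dirichlet_term_def)
  then have "\<forall>\<^sub>F N in sequentially. norm ((\<Prod>p\<in>primes_upto N. 1 - f p) * infsum f UNIV) < 2"
    by (intro order_tendstoD(2)[OF tendsto_norm[of _ 1]]) auto
  then show ?thesis
  proof eventually_elim
    case (elim N)
    have small: "real p powr - s \<le> 1 / real p" "0 \<le> real p powr - s" "1 / real p \<le> 1 / 2" if "p \<in> primes_upto N" for p
    proof -
      have "prime p" using that by (simp add: primes_upto_def)
      then have "p \<ge> 2" by (rule prime_ge_2_nat)
      then show "real p powr - s \<le> 1 / real p" "0 \<le> real p powr - s" "1 / real p \<le> 1 / 2"
        using powr_minus_le_inverse[of s p] s by (auto simp: field_simps)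
    qed
    have "(\<Prod>p\<in>primes_upto N. exp (- (real p powr - s) - 2 / real p ^ 2)) \<le> (\<Prod>p\<in>primes_upto N. 1 - real p powr - s)"
    proof (rule prod_mono, safe)
      fix p assume p: "p \<in> primes_upto N"
      define w where "w = real p powr - s"
      have w: "0 \<le> w" "w \<le> 1 / 2" "w ^ 2 \<le> 1 / real p ^ 2" using small[OF p] power_mono[of w "1 / real p" 2]
        by (auto simp: w_def power_divide)
      have "- w - 2 * w ^ 2 \<le> ln (1 - w)" using ln_one_minus_pos_lower_bound[of w] w by simp
      then have "exp (- w - 2 * w ^ 2) \<le> 1 - w" using w by (subst (asm) ln_ge_iff) auto
      moreover have "exp (- w - 2 / real p ^ 2) \<le> exp (- w - 2 * w ^ 2)" using w by simp
      ultimately show "exp (- (real p powr - s) - 2 / real p ^ 2) \<le> 1 - real p powr - s" unfolding w_def by linarith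
    qed auto
    also have "\<dots> = norm (\<Prod>p\<in>primes_upto N. 1 - f p)"
    proof -
      have "norm (1 - f p) = 1 - real p powr - s" if "p \<in> primes_upto N" for p
      proof -
        have "1 - f p = of_real (1 - real p powr - s)" by (simp add: fr)
        then show ?thesis using small[OF that] by (simp only: norm_of_real)
      qed
      then show ?thesis unfolding prod_norm[symmetric] by (intro prod.cong) auto
    qed
    finally have prodle: "(\<Prod>p\<in>primes_upto N. exp (- (real p powr - s) - 2 / real p ^ 2)) \<le> norm (\<Prod>p\<in>primes_upto N. 1 - f p)" .
    have "exp (- (\<Sum>p\<in>primes_upto N. real p powr - s) - 2 * (\<Sum>p\<in>primes_upto N. 1 / real p ^ 2)) * Z \<le> 2"
    proof -
      from prodle have "(\<Prod>p\<in>primes_upto N. exp (- (real p powr - s) - 2 / real p ^ 2)) * Z \<le> norm (\<Prod>p\<in>primes_upto N. 1 - f p) * Z"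
        using Zpos by (intro mult_right_mono) auto
      also have "\<dots> = norm ((\<Prod>p\<in>primes_upto N. 1 - f p) * infsum f UNIV)" using Zpos by (simp add: fZ norm_mult)
      also have "\<dots> \<le> 2" using elim by simp
      finally show ?thesis by (simp add: exp_sum[symmetric] sum_subtractf sum_negf sum_distrib_left)
    qed
    then have "ln (exp (- (\<Sum>p\<in>primes_upto N. real p powr - s) - 2 * (\<Sum>p\<in>primes_upto N. 1 / real p ^ 2)) * Z) \<le> ln 2"
      using Zpos by (subst ln_le_cancel_iff) auto
    then have "- (\<Sum>p\<in>primes_upto N. real p powr - s) - 2 * (\<Sum>p\<in>primes_upto N. 1 / real p ^ 2) + ln Z \<le> ln 2"
      using Zpos by (simp add: ln_mult)
    moreover have "ln (1 / (s - 1)) \<le> ln Z" using Zge Zpos s by (subst ln_le_cancel_iff) auto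
    ultimately show ?case using sum_primes_inverse_squares_le[of N] ln_le_minus_one[of "2::real"] by simp
  qed
qed

text \<open>|L(s, \<xi>)| is at most ln r + 2 uniformly in s > 1: terms up to r are bounded
  trivially, and the others by Abel summation, since the partial sums of \<xi> are at most
  r.\<close>

lemma character_prime_sum:
  assumes \<xi>: "dirichlet_char r \<xi>" and np: "\<xi> \<noteq> dprinc r" and s: "s > 1"
  shows "\<forall>\<^sub>F N in sequentially. (\<Sum>p\<in>primes_upto N. Re (\<xi> (int p)) * real p powr - s) \<le> ln (ln (real r) + 2) + 2"
proof -
  have r: "r \<ge> 1" using \<xi> by (simp add: dirichlet_char_def)
  define g where "g n = \<xi> (int n)" for n
  have g: "norm (g n) \<le> 1" for n unfolding g_def by (rule dirichlet_char_norm_le[OF \<xi>])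
  define f where "f = dirichlet_term g s"
  have sm: "(\<lambda>n. norm (f n)) summable_on UNIV" unfolding f_def by (rule dirichlet_term_abs_summable[OF g s])
  have f0: "f 0 = 0" "f 1 = 1" using \<xi> by (auto simp: f_def dirichlet_term_def g_def dirichlet_char_def)
  have bd: "norm (\<Sum>n\<in>{0<..B}. f n) \<le> ln (real r) + 2" for B
  proof -
    have "(\<Sum>n\<in>{0<..B}. f n) = (\<Sum>n\<in>{0<..min r B}. f n) + (\<Sum>n\<in>{r<..B}. f n)"
      by (subst sum.union_disjoint[symmetric]) (auto intro!: sum.cong)
    moreover have "norm (\<Sum>n\<in>{0<..min r B}. f n) \<le> ln (real r) + 1"
    proof -
      have "norm (\<Sum>n\<in>{0<..min r B}. f n) \<le> (\<Sum>n\<in>{0<..min r B}. inverse (real n))"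
        unfolding f_def using s powr_minus_le_inverse
        by (intro sum_norm_le order.trans[OF norm_dirichlet_term[of g, OF g]]) (auto simp: inverse_eq_divide)
      also have "\<dots> \<le> harm r" unfolding harm_def by (intro sum_mono2) auto
      also have "\<dots> \<le> ln (real r) + 1" by (rule harm_le_ln[OF r])
      finally show ?thesis .
    qed
    moreover have "norm (\<Sum>n\<in>{r<..B}. f n) \<le> 1"
    proof -
      have "norm (\<Sum>n\<in>{r<..B}. g n * of_real (real n powr - s)) \<le> real r * (real (Suc r) powr - s)"
        unfolding g_def using dirichlet_char_partial_sum[OF \<xi> np] s
        by (intro abel_bound) (auto intro!: powr_mono2')
      also have "\<dots> \<le> real r * (1 / real (Suc r))"
        using s by (intro mult_left_mono powr_minus_le_inverse) auto
      also have "\<dots> \<le> 1" by simp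
      finally show ?thesis by (simp add: f_def dirichlet_term_def)
    qed
    ultimately show ?thesis using norm_triangle_ineq[of "\<Sum>n\<in>{0<..min r B}. f n" "\<Sum>n\<in>{r<..B}. f n"] by simp
  qed
  have "\<forall>\<^sub>F N in sequentially. (\<Sum>p\<in>primes_upto N. Re (f p)) \<le> ln (ln (real r) + 2) + 2"
  proof (rule euler_log_upper(2)[OF sm _ f0])
    show "f (m * n) = f m * f n" for m n unfolding f_def
      by (rule dirichlet_term_mult) (use \<xi> in \<open>simp add: g_def dirichlet_char_def\<close>)
    show "norm (f p) \<le> 1 / real p" if "prime p" for p
      using powr_minus_le_inverse[of s p] s prime_ge_1_nat[OF that] norm_dirichlet_term[of g p s, OF g] unfolding f_def by linarith
    show "norm (infsum f UNIV) \<le> ln (real r) + 2" by (rule infsum_norm_le_partial[OF sm f0(1) bd])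
  qed
  then show ?thesis by (simp add: f_def dirichlet_term_def g_def)
qed

text \<open>The constant function 1 cannot pretend to be a nonprincipal character of small
  conductor: for s = 1 + 1/log q the bound is close to log log q as long as log m is much smaller
  than log q. This contradicts an accumulation of pretentious exponents.\<close>

lemma character_prime_distance_lower:
  assumes \<xi>: "dirichlet_char m \<xi>" and np: "\<xi> \<noteq> dprinc m" and s: "s > 1"
  shows "\<forall>\<^sub>F N in sequentially. (\<Sum>p\<in>primes_upto N. (1 - Re (\<xi> (int p))) * real p powr - s) \<ge> ln (1 / (s - 1)) - ln (ln (real m) + 2) - 5"
  using character_prime_sum[OF assms] prime_powr_sum_lower[OF s]
  by eventually_elim (simp add: algebra_simps sum_subtractf)

text \<open>A substitute for the Brun--Titchmarsh inequality: the weight 1 + Re \<xi>(c) is nonnegative,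
  so the one-sided bounds for the prime sums of nonprincipal characters suffice.\<close>
lemma prime_sum_residue_class:
  assumes r: "r \<ge> 1" and c: "coprime c (int r)" and s: "s > 1"
  shows "(\<Sum>p\<in>{p\<in>primes_upto M. [int p = c] (mod int r)}. real p powr - s)
     \<le> 4 * (ln (1 + 1 / (s - 1)) + 2) / real (totient r) + 4 * (ln (ln (real r) + 2) + 2)"
proof -
  define T where "T = ln (1 + 1 / (s - 1)) + 2"
  define B where "B = ln (ln (real r) + 2) + 2"
  have B0: "B \<ge> 0" unfolding B_def using r by (simp add: ln_ge_zero_iff add_nonneg_nonneg)
  have T0: "T \<ge> 0" unfolding T_def using s by (simp add: add_nonneg_nonneg)
  define ph where "ph = real (totient r)"
  have ph: "ph > 0" using r by (simp add: ph_def)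
  have "\<forall>\<^sub>F N in sequentially. \<forall>\<xi>\<in>dchars r - {dprinc r}. (\<Sum>p\<in>primes_upto N. Re (\<xi> (int p)) * real p powr - s) \<le> B"
    using finite_dchars unfolding B_def
    by (intro eventually_ball_finite) (auto simp: dchars_def intro: character_prime_sum[OF _ _ s])
  \<comment> \<open>The bounds for the nonprincipal characters hold only for large N, so all of them
    are taken at one common N beyond M.\<close>
  then obtain N where N: "N \<ge> M" and NB: "\<forall>\<xi>\<in>dchars r - {dprinc r}. (\<Sum>p\<in>primes_upto N. Re (\<xi> (int p)) * real p powr - s) \<le> B"
    by (rule eventually_sequentially_obtain)
  define V where "V \<xi> = (\<Sum>p\<in>primes_upto N. Re (\<xi> (int p)) * real p powr - s)" for \<xi> :: "int \<Rightarrow> complex"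
  define K where "K p = (\<Sum>\<xi>\<in>dchars r. (1 + Re (\<xi> c)) * Re (\<xi> (int p)))" for p
  have re: "\<bar>Re (\<xi> n)\<bar> \<le> 1" if "\<xi> \<in> dchars r" for \<xi> n
    using dirichlet_char_norm_le[of r \<xi> n] that abs_Re_le_cmod[of "\<xi> n"] by (auto simp: dchars_def intro: order.trans)
  have "(\<Sum>\<xi>\<in>dchars r. (1 + Re (\<xi> c)) * V \<xi>) \<le> (\<Sum>\<xi>\<in>dchars r. 2 * B + (if \<xi> = dprinc r then 2 * T else 0))"
  proof (rule sum_mono)
    fix \<xi> assume \<xi>: "\<xi> \<in> dchars r"
    have w: "0 \<le> 1 + Re (\<xi> c)" "1 + Re (\<xi> c) \<le> 2" using re[OF \<xi>, of c] by auto
    have "V \<xi> \<le> (if \<xi> = dprinc r then T else B)"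
    proof (cases "\<xi> = dprinc r")
      case True
      have "V \<xi> \<le> (\<Sum>p\<in>primes_upto N. real p powr - s)" unfolding V_def using re[OF \<xi>]
        by (intro sum_mono mult_left_le_one_le) (auto simp: True dprinc_def)
      then show ?thesis using prime_powr_sum_upper[OF s, of N] True unfolding T_def by simp
    qed (use NB \<xi> in \<open>simp add: V_def\<close>)
    then have "(1 + Re (\<xi> c)) * V \<xi> \<le> (1 + Re (\<xi> c)) * (if \<xi> = dprinc r then T else B)"
      using w by (intro mult_left_mono) auto
    also have "\<dots> \<le> 2 * (if \<xi> = dprinc r then T else B)" using w T0 B0 by (intro mult_right_mono) auto
    also have "\<dots> \<le> 2 * B + (if \<xi> = dprinc r then 2 * T else 0)" using B0 by simp
    finally show "(1 + Re (\<xi> c)) * V \<xi> \<le> 2 * B + (if \<xi> = dprinc r then 2 * T else 0)" .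
  qed
  also have "\<dots> = 2 * B * ph + 2 * T"
    using finite_dchars dprinc_dirichlet[OF r] card_dchars[OF r]
    by (simp add: sum.distrib dchars_def[symmetric] ph_def) (simp add: dchars_def)
  finally have upper: "(\<Sum>\<xi>\<in>dchars r. (1 + Re (\<xi> c)) * V \<xi>) \<le> 2 * B * ph + 2 * T" .
  \<comment> \<open>By orthogonality, K p for p prime to r is ph times the indicator of p = 1 plus
    half the indicators of c p = 1 and of p = c modulo r. Dropping the first two, which are
    nonnegative, leaves the wanted class with weight ph / 2.\<close>
  have Keq: "K p \<ge> (if [int p = c] (mod int r) then ph / 2 else 0)" for p
  proof (cases "coprime (int p) (int r)")
    case True
    have "K p = Re (\<Sum>\<xi>\<in>dchars r. \<xi> (int p)) + Re (\<Sum>\<xi>\<in>dchars r. \<xi> (c * int p)) / 2 + Re (\<Sum>\<xi>\<in>dchars r. cnj (\<xi> c) * \<xi> (int p)) / 2"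
    proof -
      have "(1 + Re (\<xi> c)) * Re (\<xi> (int p)) = Re (\<xi> (int p)) + Re (\<xi> (c * int p)) / 2 + Re (cnj (\<xi> c) * \<xi> (int p)) / 2"
        if "\<xi> \<in> dchars r" for \<xi>
      proof -
        have "\<xi> (c * int p) = \<xi> c * \<xi> (int p)" using that by (simp add: dchars_def dirichlet_char_def)
        then show ?thesis by (simp add: field_simps)
      qed
      then have "K p = (\<Sum>\<xi>\<in>dchars r. Re (\<xi> (int p)) + Re (\<xi> (c * int p)) / 2 + Re (cnj (\<xi> c) * \<xi> (int p)) / 2)"
        unfolding K_def by (intro sum.cong) auto
      then show ?thesis by (simp only: sum.distrib Re_sum sum_divide_distrib)
    qed
    also have "\<dots> = (if [int p = 1] (mod int r) then ph else 0) + (if [c * int p = 1] (mod int r) then ph else 0) / 2 + (if [c = int p] (mod int r) then ph else 0) / 2"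
    proof -
      have "coprime (c * int p) (int r)" using c True by simp
      then show ?thesis
        by (simp only: sum_dchars[OF r True] sum_dchars[OF r] sum_dchars_cnj[OF r c True]) (simp add: ph_def)
    qed
    finally show ?thesis using ph by (simp add: cong_sym_eq[of c])
  next
    case False
    then have "\<xi> (int p) = 0" if "\<xi> \<in> dchars r" for \<xi> :: "int \<Rightarrow> complex" using that by (auto simp: dchars_def dirichlet_char_def)
    note z = this
    have "(1 + Re (\<xi> c)) * Re (\<xi> (int p)) = 0" if "\<xi> \<in> dchars r" for \<xi> by (subst z[OF that]) simp
    then have "K p = 0" unfolding K_def by (intro sum.neutral) blast
    moreover have "\<not> [int p = c] (mod int r)" using False c cong_imp_coprime[of c "int p" "int r"] cong_sym by blast
    ultimately show ?thesis by simp
  qed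
  have "ph / 2 * (\<Sum>p\<in>{p\<in>primes_upto M. [int p = c] (mod int r)}. real p powr - s) = (\<Sum>p\<in>primes_upto M. (if [int p = c] (mod int r) then ph / 2 else 0) * real p powr - s)"
    unfolding sum_distrib_left by (rule sum.mono_neutral_cong_left) auto
  also have "\<dots> \<le> (\<Sum>p\<in>primes_upto N. (if [int p = c] (mod int r) then ph / 2 else 0) * real p powr - s)"
    using primes_upto_mono[OF N] ph by (intro sum_mono2) auto
  also have "\<dots> \<le> (\<Sum>p\<in>primes_upto N. K p * real p powr - s)"
    using Keq by (intro sum_mono mult_right_mono) auto
  also have "\<dots> = (\<Sum>\<xi>\<in>dchars r. (1 + Re (\<xi> c)) * V \<xi>)"
    unfolding K_def V_def sum_distrib_right sum_distrib_left by (subst sum.swap) (simp only: mult.assoc)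
  also note upper
  finally have main: "ph / 2 * (\<Sum>p\<in>{p\<in>primes_upto M. [int p = c] (mod int r)}. real p powr - s) \<le> 2 * B * ph + 2 * T" .
  have "S \<le> 4 * T / ph + 4 * B" if "ph / 2 * S \<le> 2 * B * ph + 2 * T" for S
  proof -
    have "S = (ph / 2 * S) * (2 / ph)" using ph by simp
    also have "\<dots> \<le> (2 * B * ph + 2 * T) * (2 / ph)" using that ph by (intro mult_right_mono) auto
    also have "\<dots> = 4 * T / ph + 4 * B" using ph by (simp add: field_simps)
    finally show ?thesis .
  qed
  from this[OF main] show ?thesis unfolding T_def B_def ph_def .
qed

section \<open>Chebyshev and Hall bounds, logarithmic means\<close>

lemma prod_primes_dvd:
  assumes "finite P" "\<And>p. p \<in> P \<Longrightarrow> prime (p::nat)" "\<And>p. p \<in> P \<Longrightarrow> p dvd N"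
  shows "\<Prod>P dvd N"
  using assms
proof (induction P rule: finite_induct)
  case (insert p P)
  have "coprime p (\<Prod>P)"
    using insert by (intro prod_coprime_right) (auto intro: primes_coprime)
  then show ?case using insert by (simp add: divides_mult)
qed simp

lemma central_binomial_le: "(2 * m + 1) choose m \<le> 4 ^ m"
proof -
  have "(2 * m + 1) choose m = (2 * m + 1) choose (m + 1)"
    using binomial_symmetric[of m "2 * m + 1"] by simp
  then have "2 * ((2 * m + 1) choose m) = (\<Sum>k\<in>{m, m + 1}. (2 * m + 1) choose k)" by simp
  also have "\<dots> \<le> (\<Sum>k\<le>2 * m + 1. (2 * m + 1) choose k)" by (intro sum_mono2) auto
  also have "\<dots> = 2 * 4 ^ m" by (simp only: choose_row_sum) (simp add: power_mult)
  finally show ?thesis by simp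
qed

text \<open>Erdos' argument: all primes in (m + 1, 2m + 1] divide the binomial coefficient
  \<open>(2 * m + 1) choose m\<close>, which is at most 4^m. An even n > 2 is not prime and reduces
  to n - 1.\<close>

lemma prod_primes_le_four_pow: "(\<Prod>p\<in>primes_upto n. p) \<le> 4 ^ n"
proof (induction n rule: less_induct)
  case (less n)
  consider "n \<le> 2" | "n > 2" "even n" | m where "n = 2 * m + 1" "m \<ge> 1"
    by (metis One_nat_def add.commute le_0_eq nat_le_linear not_less not_less_eq_eq numeral_2_eq_2 oddE mult_0_right add_0 odd_one even_Suc le_SucE)
  then show ?case
  proof cases
    case 1
    have "primes_upto n \<subseteq> {2}" using 1 unfolding primes_upto_def by (auto dest: prime_ge_2_nat)
    then have "primes_upto n = {} \<or> (primes_upto n = {2})" by blast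
    moreover have "n \<ge> 2" if "primes_upto n = {2}" using that unfolding primes_upto_def by auto
    then have "2 \<le> (4::nat) ^ n" if "primes_upto n = {2}" using that self_le_power[of "4::nat" n] by force
    ultimately show ?thesis by auto
  next
    case 2
    have "primes_upto n = primes_upto (n - 1)"
    proof -
      have "\<not> prime n" using 2 prime_odd_nat by blast
      then have "p \<le> n \<longleftrightarrow> p \<le> n - 1" if "prime p" for p using that 2 by (cases "p = n") auto
      then show ?thesis unfolding primes_upto_def by auto
    qed
    then have "(\<Prod>p\<in>primes_upto n. p) \<le> 4 ^ (n - 1)" using less[of "n - 1"] 2 by simp
    also have "\<dots> \<le> 4 ^ n" by (intro power_increasing) auto
    finally show ?thesis .
  next
    case 3
    define R where "R = primes_upto n - primes_upto (m + 1)"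
    have sub: "primes_upto (m + 1) \<subseteq> primes_upto n" using 3 by (intro primes_upto_mono) auto
    have "\<Prod>R dvd (n choose m)"
    proof (rule prod_primes_dvd)
      fix p assume p: "p \<in> R"
      then have pp: "prime p" "p \<le> n" "p > m + 1" unfolding R_def primes_upto_def by auto
      have "p dvd fact n" using pp by (simp add: prime_dvd_fact_iff)
      then have "p dvd fact m * fact (n - m) * (n choose m)" using binomial_fact_lemma[of m n] 3 by simp
      moreover have "m < p" "n - m < p" using pp 3 by auto
      then have "\<not> p dvd fact m" "\<not> p dvd fact (n - m)" by (simp_all only: prime_dvd_fact_iff[OF pp(1)] not_le)
      ultimately show "p dvd n choose m" using pp(1) by (auto simp: prime_dvd_mult_iff)
    qed (auto simp: R_def primes_upto_def)
    then have "\<Prod>R \<le> n choose m" using 3 by (intro dvd_imp_le) auto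
    also have "\<dots> \<le> 4 ^ m" using central_binomial_le[of m] 3 by simp
    finally have R: "\<Prod>R \<le> 4 ^ m" .
    have "(\<Prod>p\<in>primes_upto n. p) = \<Prod>R * (\<Prod>p\<in>primes_upto (m + 1). p)"
      unfolding R_def using prod.subset_diff[OF sub, of "\<lambda>p. p"] by simp
    also have "\<dots> \<le> 4 ^ m * 4 ^ (m + 1)" using R less[of "m + 1"] 3 by (intro mult_mono) auto
    also have "\<dots> = 4 ^ n" using 3 by (simp add: power_add[symmetric])
    finally show ?thesis .
  qed
qed

lemma chebyshev_theta: "(\<Sum>p\<in>primes_upto n. ln (real p)) \<le> 2 * real n"
proof -
  have "(\<Sum>p\<in>primes_upto n. ln (real p)) = ln (\<Prod>p\<in>primes_upto n. real p)"
    by (rule ln_prod[symmetric]) (auto simp: primes_upto_def prime_gt_0_nat)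
  also have "\<dots> \<le> ln (4 ^ n)"
  proof (subst ln_le_cancel_iff)
    have "real (\<Prod>p\<in>primes_upto n. p) \<le> real (4 ^ n)" using prod_primes_le_four_pow[of n] of_nat_le_iff by blast
    then show "(\<Prod>p\<in>primes_upto n. real p) \<le> 4 ^ n" by simp
  qed (auto intro!: prod_pos simp: primes_upto_def prime_gt_0_nat)
  also have "\<dots> = real n * ln 4" by (simp add: ln_realpow)
  also have "\<dots> \<le> real n * 2"
    using ln_le_minus_one[of "2::real"] ln_realpow[of "2::real" 2] by (intro mult_left_mono) simp_all
  finally show ?thesis by (simp add: mult.commute)
qed

text \<open>28 = 4 * 7: one has w^k \<le> 4 w^2 2^(-k) for k \<ge> 2, and the sum of k (k+1) 2^(-k)
  over k \<ge> 2 equals 7. Higher prime powers thus contribute only O(1/p^2) to Euler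
  factors.\<close>

lemma geometric_quadratic_sum: "(\<Sum>k\<in>{2..K}. real k * (real k + 1) * w ^ k) \<le> 28 * w ^ 2"
  if "0 \<le> w" "w \<le> 1 / 2" for w :: real
proof -
  have e: "(\<Sum>k\<in>{2..K}. real k * (real k + 1) * (1 / 2) ^ k) \<le> 7 - (real K ^ 2 + 5 * real K + 8) * (1 / 2) ^ K" if "K \<ge> 1"
    using that
  proof (induction K rule: nat_induct_at_least)
    case (Suc n)
    have "{2..Suc n} = insert (Suc n) {2..n}" using Suc.hyps by auto
    then have "(\<Sum>k\<in>{2..Suc n}. real k * (real k + 1) * (1 / 2) ^ k) =
        real (Suc n) * (real (Suc n) + 1) * (1 / 2) ^ Suc n + (\<Sum>k\<in>{2..n}. real k * (real k + 1) * (1 / 2) ^ k)" by simp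
    moreover have "real (Suc n) * (real (Suc n) + 1) * (1 / 2) ^ Suc n
        = (real n ^ 2 + 5 * real n + 8) * (1 / 2) ^ n - (real (Suc n) ^ 2 + 5 * real (Suc n) + 8) * (1 / 2) ^ Suc n"
      by (simp add: field_simps power2_eq_square)
    ultimately show ?case using Suc.IH by linarith
  qed simp
  have "(\<Sum>k\<in>{2..K}. real k * (real k + 1) * w ^ k) \<le> (\<Sum>k\<in>{2..K}. 4 * w ^ 2 * (real k * (real k + 1) * (1 / 2) ^ k))"
  proof (rule sum_mono)
    fix k assume "k \<in> {2..K}"
    then have k: "k = (k - 2) + 2" by (simp only: le_add_diff_inverse2 atLeastAtMost_iff)
    have "w ^ k = w ^ (k - 2) * w ^ 2" by (subst k) (rule power_add)
    also have "\<dots> \<le> (1 / 2) ^ (k - 2) * w ^ 2" using that by (intro mult_right_mono power_mono) auto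
    also have "(1 / 2 :: real) ^ (k - 2) = 4 * (1 / 2) ^ k" by (subst (2) k) (simp add: power_add power2_eq_square)
    finally have "real k * (real k + 1) * w ^ k \<le> real k * (real k + 1) * (4 * (1 / 2) ^ k * w ^ 2)"
      by (intro mult_left_mono) auto
    then show "real k * (real k + 1) * w ^ k \<le> 4 * w ^ 2 * (real k * (real k + 1) * (1 / 2) ^ k)" by (simp add: mult_ac)
  qed
  also have "\<dots> = 4 * w ^ 2 * (\<Sum>k\<in>{2..K}. real k * (real k + 1) * (1 / 2) ^ k)" by (simp add: sum_distrib_left)
  also have "\<dots> \<le> 4 * w ^ 2 * 7"
  proof (intro mult_left_mono)
    show "(\<Sum>k\<in>{2..K}. real k * (real k + 1) * (1 / 2) ^ k) \<le> 7"
    proof (cases "K \<ge> 1")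
      case True
      have "(real K ^ 2 + 5 * real K + 8) * (1 / 2) ^ K \<ge> 0" by simp
      then show ?thesis using e[OF True] by linarith
    qed simp
  qed auto
  finally show ?thesis by simp
qed

definition prime_powers_upto :: "nat \<Rightarrow> (nat \<times> nat) set" where
  "prime_powers_upto Y = {(p, k). prime p \<and> k \<ge> 1 \<and> p ^ k \<le> Y}"

lemma prime_powers_upto_subset: "prime_powers_upto Y \<subseteq> primes_upto Y \<times> {1..Y}"
proof
  fix x assume "x \<in> prime_powers_upto Y"
  then obtain p k where x: "x = (p, k)" "prime p" "k \<ge> 1" "p ^ k \<le> Y" unfolding prime_powers_upto_def by auto
  have "p \<le> p ^ k" using x by (intro self_le_power) (auto simp: Suc_le_eq prime_gt_0_nat)
  moreover have "k < p ^ k" using x by (intro power_gt_expt) (auto intro: prime_gt_Suc_0_nat)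
  ultimately show "x \<in> primes_upto Y \<times> {1..Y}" using x by (auto simp: primes_upto_def)
qed

lemma finite_prime_powers_upto: "finite (prime_powers_upto Y)"
  by (rule finite_subset[OF prime_powers_upto_subset]) auto

text \<open>The weight is dictated by the use for \<open>divisor_sum\<close>: a factor k comes from
  the multiplicity of p in ln n, and k + 1 bounds the divisor sum at p^k.\<close>

lemma chebyshev_prime_powers:
  "(\<Sum>(p, k)\<in>prime_powers_upto Y. real k * (real k + 1) * ln (real p)) \<le> 200 * real Y"
proof -
  have lnp: "ln (real p) \<ge> 0" if "prime p" for p using prime_ge_1_nat[OF that] by simp
  \<comment> \<open>For k > 1 the bound 1 \<le> Y / p^k is inserted, so that the range of k may be
    extended to all of {2..Y} with a convergent sum; k = 1 is left to the bound for the sum of ln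
    p.\<close>
  define F where "F p k = (if k = 1 then 2 * ln (real p) else real k * (real k + 1) * ln (real p) * (real Y * (1 / real p) ^ k))" for p k :: nat
  have F0: "F p k \<ge> 0" if "prime p" for p k using lnp[OF that] by (simp add: F_def)
  have "(\<Sum>(p, k)\<in>prime_powers_upto Y. real k * (real k + 1) * ln (real p)) \<le> (\<Sum>(p, k)\<in>prime_powers_upto Y. F p k)"
  proof (rule sum_mono, safe)
    fix p k assume pk: "(p, k) \<in> prime_powers_upto Y"
    then have p: "prime p" "k \<ge> 1" "p ^ k \<le> Y" by (auto simp: prime_powers_upto_def)
    show "real k * (real k + 1) * ln (real p) \<le> F p k"
    proof (cases "k = 1")
      case False
      have "real (p ^ k) \<le> real Y" using p(3) of_nat_le_iff by blast
      moreover have "real p > 0" using p(1) by (simp add: prime_gt_0_nat)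
      ultimately have "1 \<le> real Y * (1 / real p) ^ k" by (simp add: field_simps)
      then have "real k * (real k + 1) * ln (real p) * 1 \<le> real k * (real k + 1) * ln (real p) * (real Y * (1 / real p) ^ k)"
        using lnp[OF p(1)] by (intro mult_left_mono) auto
      then show ?thesis using False by (simp add: F_def)
    qed (simp add: F_def)
  qed
  also have "\<dots> \<le> (\<Sum>(p, k)\<in>primes_upto Y \<times> {1..Y}. F p k)"
    using prime_powers_upto_subset[of Y] by (intro sum_mono2) (auto simp: primes_upto_def intro: F0)
  also have "\<dots> = (\<Sum>p\<in>primes_upto Y. \<Sum>k\<in>{1..Y}. F p k)" by (simp add: sum.cartesian_product)
  also have "\<dots> \<le> (\<Sum>p\<in>primes_upto Y. 2 * ln (real p) + 56 * real Y * real p powr - (3 / 2))"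
  proof (rule sum_mono)
    fix p assume "p \<in> primes_upto Y"
    then have p: "prime p" "p \<le> Y" by (auto simp: primes_upto_def)
    have p2: "p \<ge> 2" using p(1) by (rule prime_ge_2_nat)
    have "{1..Y} = insert 1 {2..Y}" using p2 p(2) by auto
    then have "(\<Sum>k\<in>{1..Y}. F p k) = 2 * ln (real p) + (\<Sum>k\<in>{2..Y}. F p k)" by (simp add: F_def)
    also have "(\<Sum>k\<in>{2..Y}. F p k) = ln (real p) * real Y * (\<Sum>k\<in>{2..Y}. real k * (real k + 1) * (1 / real p) ^ k)"
      unfolding sum_distrib_left by (intro sum.cong) (auto simp: F_def)
    also have "\<dots> \<le> ln (real p) * real Y * (28 * (1 / real p) ^ 2)"
      using lnp[OF p(1)] p2 by (intro mult_left_mono geometric_quadratic_sum) auto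
    also have "\<dots> \<le> (2 * real p powr (1 / 2)) * real Y * (28 * (1 / real p) ^ 2)"
    proof (intro mult_right_mono)
      have "ln (real p) = 2 * ln (real p powr (1 / 2))" using p2 by (simp add: ln_powr)
      also have "\<dots> \<le> 2 * (real p powr (1 / 2))" using p2 ln_le_minus_one[of "real p powr (1 / 2)"] by simp
      finally show "ln (real p) \<le> 2 * real p powr (1 / 2)" .
    qed auto
    also have "\<dots> = 56 * real Y * (real p powr (1 / 2) * (1 / real p) ^ 2)" by simp
    also have "real p powr (1 / 2) * (1 / real p) ^ 2 = real p powr - (3 / 2)"
    proof -
      have "(1 / real p) ^ 2 = real p powr - 2" using p2 by (simp add: powr_minus powr_numeral power_divide inverse_eq_divide)
      then show ?thesis by (simp add: powr_add[symmetric])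
    qed
    finally show "(\<Sum>k\<in>{1..Y}. F p k) \<le> 2 * ln (real p) + 56 * real Y * real p powr - (3 / 2)" by simp
  qed
  also have "\<dots> = 2 * (\<Sum>p\<in>primes_upto Y. ln (real p)) + 56 * real Y * (\<Sum>p\<in>primes_upto Y. real p powr - (3 / 2))"
    by (simp add: sum.distrib sum_distrib_left)
  also have "\<dots> \<le> 2 * (2 * real Y) + 56 * real Y * 3"
  proof (intro add_mono mult_left_mono chebyshev_theta)
    have "(\<Sum>p\<in>primes_upto Y. real p powr - (3 / 2)) \<le> (\<Sum>n\<in>{0<..Y}. real n powr - (3 / 2))"
      by (intro sum_mono2) (auto simp: primes_upto_def prime_gt_0_nat)
    also have "\<dots> \<le> 1 + 1 / (3 / 2 - 1)" by (rule zeta_partial_bounds) simp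
    finally show "(\<Sum>p\<in>primes_upto Y. real p powr - (3 / 2)) \<le> 3" by simp
  qed auto
  finally show ?thesis by simp
qed

text \<open>Every n up to N splits into exact prime powers with exponents at most N, so the expanded
  product contains g n; the remaining terms are nonnegative. The induction splits off one prime at a
  time.\<close>

lemma finite_euler_product_bound:
  fixes g :: "nat \<Rightarrow> real"
  assumes nonneg: "\<And>n. g n \<ge> 0" and g1: "g 1 = 1"
    and mult: "\<And>p k m. prime p \<Longrightarrow> \<not> p dvd m \<Longrightarrow> g (p ^ k * m) = g (p ^ k) * g m"
  shows "(\<Sum>n\<in>{1..N}. g n) \<le> (\<Prod>p\<in>primes_upto N. \<Sum>k\<in>{..N}. g (p ^ k))"
proof -
  define S where "S P = {n\<in>{1..N}. prime_factors n \<subseteq> P}" for P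
  have main: "(\<Sum>n\<in>S P. g n) \<le> (\<Prod>p\<in>P. \<Sum>k\<in>{..N}. g (p ^ k))" if "finite P" "\<And>p. p \<in> P \<Longrightarrow> prime p" for P
    using that
  proof (induction P rule: finite_induct)
    case empty
    have "S {} \<subseteq> {1}"
    proof
      fix n assume "n \<in> S {}"
      then have "n \<ge> 1" "prime_factors n = {}" by (auto simp: S_def)
      then show "n \<in> {1}" by (simp add: prime_factorization_empty_iff)
    qed
    then have "(\<Sum>n\<in>S {}. g n) \<le> (\<Sum>n\<in>{1}. g n)" using nonneg by (intro sum_mono2) auto
    then show ?case using g1 by simp
  next
    case (insert p P)
    have pp: "prime p" using insert.prems by simp
    have "(\<Sum>n\<in>S (insert p P). g n) \<le> (\<Sum>(k, m)\<in>{..N} \<times> S P. g (p ^ k) * g m)"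
    proof (rule sum_le_included[where i = "\<lambda>(k, m). p ^ k * m"])
      show "\<forall>n\<in>S (insert p P). \<exists>y\<in>{..N} \<times> S P. (case y of (k, m) \<Rightarrow> p ^ k * m) = n \<and> g n \<le> (case y of (k, m) \<Rightarrow> g (p ^ k) * g m)"
      proof
        fix n assume n: "n \<in> S (insert p P)"
        then have n1: "n \<noteq> 0" "n \<le> N" by (auto simp: S_def)
        define k where "k = multiplicity p n"
        obtain m where m: "n = p ^ k * m" "\<not> p dvd m"
          using multiplicity_decompose'[of n p] n1 pp unfolding k_def by (metis not_prime_unit)
        have m0: "m \<noteq> 0" using m n1 by auto
        have pk: "p ^ k \<le> n" "m \<le> n" using m n1 m0 pp by (auto simp: prime_gt_0_nat Suc_le_eq)
        have "k < p ^ k" using pp by (intro power_gt_expt) (auto intro: prime_gt_Suc_0_nat)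
        then have "k \<le> N" using pk n1 by simp
        moreover have "m \<in> S P"
        proof -
          have "prime_factors m \<subseteq> P"
          proof
            fix r assume r: "r \<in> prime_factors m"
            then have "r dvd m" "prime r" by auto
            then have "r \<in> prime_factors n" using m n1 by (auto simp: prime_factors_dvd)
            then show "r \<in> P" using n m(2) \<open>r dvd m\<close> by (auto simp: S_def)
          qed
          then show ?thesis using pk n1 m0 by (auto simp: S_def)
        qed
        ultimately show "\<exists>y\<in>{..N} \<times> S P. (case y of (k, m) \<Rightarrow> p ^ k * m) = n \<and> g n \<le> (case y of (k, m) \<Rightarrow> g (p ^ k) * g m)"
          using m mult[OF pp m(2), of k] by (intro bexI[of _ "(k, m)"]) auto
      qed
    qed (auto simp: S_def nonneg)
    moreover have "(\<Sum>(k, m)\<in>{..N} \<times> S P. g (p ^ k) * g m) = (\<Sum>k\<in>{..N}. g (p ^ k)) * (\<Sum>m\<in>S P. g m)"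
      by (simp add: sum_product sum.cartesian_product)
    moreover have "(\<Sum>m\<in>S P. g m) \<le> (\<Prod>p\<in>P. \<Sum>k\<in>{..N}. g (p ^ k))"
      by (rule insert.IH) (rule insert.prems, rule insertI2)
    moreover have "0 \<le> (\<Sum>k\<in>{..N}. g (p ^ k))" by (rule sum_nonneg) (rule nonneg)
    moreover have "(\<Prod>p\<in>insert p P. \<Sum>k\<in>{..N}. g (p ^ k)) = (\<Sum>k\<in>{..N}. g (p ^ k)) * (\<Prod>p\<in>P. \<Sum>k\<in>{..N}. g (p ^ k))"
      by (rule prod.insert[OF insert.hyps])
    ultimately show ?case by (smt (verit) mult_left_mono)
  qed
  have "(\<Sum>n\<in>S (primes_upto N). g n) \<le> (\<Prod>p\<in>primes_upto N. \<Sum>k\<in>{..N}. g (p ^ k))"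
    by (rule main) (auto simp: primes_upto_def)
  moreover have "S (primes_upto N) = {1..N}"
    unfolding S_def primes_upto_def by (auto simp: prime_factors_dvd intro: order.trans[OF dvd_imp_le])
  ultimately show ?thesis by simp
qed

text \<open>Euler's argument: the harmonic number is dominated by the product of geometric series
  over primes, which is at most exp(sum of 1/p + 2).\<close>

lemma prime_reciprocal_sum_lower:
  assumes "N \<ge> 2"
  shows "(\<Sum>p\<in>primes_upto N. 1 / real p) \<ge> ln (ln (real N)) - 2"
proof -
  have "(\<Sum>n\<in>{1..N}. 1 / real n) \<le> (\<Prod>p\<in>primes_upto N. \<Sum>k\<in>{..N}. 1 / real (p ^ k))"
    by (rule finite_euler_product_bound) (auto simp: field_simps)
  also have "\<dots> \<le> (\<Prod>p\<in>primes_upto N. exp (1 / real p + 2 / real p ^ 2))"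
  proof (rule prod_mono, intro conjI)
    fix p assume "p \<in> primes_upto N"
    then have p2: "p \<ge> 2" by (simp add: primes_upto_def prime_ge_2_nat)
    define w where "w = 1 / real p"
    have w: "0 \<le> w" "w \<le> 1 / 2" using p2 by (auto simp: w_def)
    have "(\<Sum>k\<in>{..N}. 1 / real (p ^ k)) = (\<Sum>k<Suc N. w ^ k)" unfolding lessThan_Suc_atMost by (simp add: w_def power_divide)
    also have "\<dots> = (1 - w ^ Suc N) / (1 - w)" using w by (subst sum_gp_strict) auto
    also have "\<dots> \<le> 1 / (1 - w)" using w by (intro divide_right_mono) auto
    also have "\<dots> \<le> exp (w + 2 * w ^ 2)"
    proof -
      have "- w - 2 * w ^ 2 \<le> ln (1 - w)" using ln_one_minus_pos_lower_bound[of w] w by simp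
      then have "exp (- (w + 2 * w ^ 2)) \<le> 1 - w" using w by (subst (asm) ln_ge_iff) auto
      then have "1 / (1 - w) \<le> 1 / exp (- (w + 2 * w ^ 2))" using w by (intro divide_left_mono) auto
      also have "\<dots> = exp (w + 2 * w ^ 2)" unfolding exp_minus by (simp add: inverse_eq_divide)
      finally show ?thesis .
    qed
    finally show "(\<Sum>k\<in>{..N}. 1 / real (p ^ k)) \<le> exp (1 / real p + 2 / real p ^ 2)" by (simp add: w_def power_divide)
  qed (auto intro!: sum_nonneg)
  also have "\<dots> = exp ((\<Sum>p\<in>primes_upto N. 1 / real p) + 2 * (\<Sum>p\<in>primes_upto N. 1 / real p ^ 2))"
    by (simp add: exp_sum[symmetric] sum.distrib sum_distrib_left)
  also have "\<dots> \<le> exp ((\<Sum>p\<in>primes_upto N. 1 / real p) + 2)" using sum_primes_inverse_squares_le[of N] by simp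
  finally have "harm N \<le> exp ((\<Sum>p\<in>primes_upto N. 1 / real p) + 2)" by (simp add: harm_def inverse_eq_divide)
  moreover have "ln (real N) \<le> harm N" using ln_le_harm[of N] assms by (smt (verit) ln_le_cancel_iff of_nat_0_less_iff zero_less_numeral order_less_le_trans)
  ultimately have "ln (real N) \<le> exp ((\<Sum>p\<in>primes_upto N. 1 / real p) + 2)" by simp
  then have "ln (ln (real N)) \<le> ln (exp ((\<Sum>p\<in>primes_upto N. 1 / real p) + 2))" using assms by (subst ln_le_cancel_iff) auto
  then show ?thesis by simp
qed

section \<open>Logarithmic means of multiplicative functions\<close>

definition completely_mult :: "(nat \<Rightarrow> complex) \<Rightarrow> bool" where
  "completely_mult f \<longleftrightarrow> f 1 = 1 \<and> (\<forall>m n. f (m * n) = f m * f n) \<and> (\<forall>n. norm (f n) \<le> 1)"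

lemma completely_mult_power: "completely_mult f \<Longrightarrow> f (p ^ k) = f p ^ k"
  by (induction k) (auto simp: completely_mult_def)

text \<open>The Dirichlet convolution of f with 1. At a prime its norm is |1 + f(p)|, which falls
  below 2 exactly where f(p) moves away from 1.\<close>

definition divisor_sum :: "(nat \<Rightarrow> complex) \<Rightarrow> nat \<Rightarrow> complex" where
  "divisor_sum f n = (\<Sum>d | d dvd n. f d)"

lemma divisor_sum_mult:
  assumes f: "completely_mult f" and cop: "coprime m n" and pos: "m > 0" "n > 0"
  shows "divisor_sum f (m * n) = divisor_sum f m * divisor_sum f n"
proof -
  have gcds: "gcd (a * b) m = a" "gcd (a * b) n = b" if ab: "a dvd m" "b dvd n" for a b
  proof -
    have "coprime b m" "coprime a n" using ab cop by (metis coprime_commute coprime_divisors dvd_refl)+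
    then have "coprime m b" "coprime n a" by (simp_all only: coprime_commute)
    then show "gcd (a * b) m = a" "gcd (a * b) n = b"
      using gcd_mult_left_right_cancel[of m b a] gcd_mult_left_left_cancel[of n a b] ab
      by (simp_all add: gcd_nat.absorb1)
  qed
  have inv: "gcd d m * gcd d n = d" if d: "d dvd m * n" for d
    using division_decomp[OF d] gcds by auto
  have "divisor_sum f m * divisor_sum f n = (\<Sum>(a, b)\<in>{d. d dvd m} \<times> {d. d dvd n}. f (a * b))"
    using f unfolding divisor_sum_def completely_mult_def by (simp add: sum_product sum.cartesian_product)
  also have "\<dots> = (\<Sum>d | d dvd m * n. f d)"
    by (rule sum.reindex_bij_witness[where i = "\<lambda>d. (gcd d m, gcd d n)" and j = "\<lambda>(a, b). a * b"])
       (auto simp: gcds inv intro: mult_dvd_mono)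
  finally show ?thesis by (simp add: divisor_sum_def)
qed

lemma divisor_sum_prime_power:
  assumes "completely_mult f" "prime p"
  shows "divisor_sum f (p ^ k) = (\<Sum>j\<le>k. f p ^ j)"
proof -
  have "{d. d dvd p ^ k} = (\<lambda>j. p ^ j) ` {..k}" using assms(2) by (auto simp: divides_primepow_nat)
  moreover have "inj_on (\<lambda>j. p ^ j) {..k}" using assms(2) by (auto simp: inj_on_def prime_gt_Suc_0_nat)
  ultimately show ?thesis unfolding divisor_sum_def by (simp add: sum.reindex completely_mult_power[OF assms(1)])
qed

lemma real_div_bounds:
  "real (y div d) \<le> real y / real d" "real y / real d - real (y div d) \<le> 1"
  using floor_correct[of "real y / real d"] unfolding floor_divide_of_nat_eq by simp_all

text \<open>Exchanging summations, the sum of the convolution is the sum of f(d) times the integer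
  part of y/d, and each rounding costs at most 1. A logarithmic mean of f thereby becomes an
  ordinary mean, whose absolute values can be treated as a nonnegative multiplicative
  function.\<close>

lemma sum_divisor_sum:
  assumes f: "completely_mult f"
  shows "norm (of_nat y * (\<Sum>m\<in>{1..y}. f m / of_nat m) - (\<Sum>n\<in>{1..y}. divisor_sum f n)) \<le> real y"
proof -
  have "(\<Sum>n\<in>{1..y}. divisor_sum f n) = (\<Sum>n\<in>{1..y}. \<Sum>d\<in>{1..y}. if d dvd n then f d else 0)"
  proof (rule sum.cong[OF refl])
    fix n assume n: "n \<in> {1..y}"
    have "divisor_sum f n = (\<Sum>d\<in>{d\<in>{1..y}. d dvd n}. f d)"
      unfolding divisor_sum_def using n by (intro sum.cong) (auto dest: dvd_imp_le intro!: Suc_leI Nat.gr0I)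
    then show "divisor_sum f n = (\<Sum>d\<in>{1..y}. if d dvd n then f d else 0)" by (simp only: sum.inter_filter finite_atLeastAtMost)
  qed
  also have "\<dots> = (\<Sum>d\<in>{1..y}. \<Sum>n\<in>{1..y}. if d dvd n then f d else 0)" by (rule sum.swap)
  also have "\<dots> = (\<Sum>d\<in>{1..y}. of_nat (y div d) * f d)"
  proof (rule sum.cong[OF refl])
    fix d assume d: "d \<in> {1..y}"
    have "{n\<in>{1..y}. d dvd n} = (\<lambda>k. d * k) ` {1..y div d}"
    proof (intro equalityI subsetI)
      fix n assume "n \<in> {n\<in>{1..y}. d dvd n}"
      then obtain k where k: "n = d * k" "1 \<le> n" "n \<le> y" by (auto elim: dvdE)
      then have "k \<in> {1..y div d}" using d by (auto simp: less_eq_div_iff_mult_less_eq mult.commute intro!: Suc_leI Nat.gr0I)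
      then show "n \<in> (\<lambda>k. d * k) ` {1..y div d}" using k by blast
    next
      fix n assume "n \<in> (\<lambda>k. d * k) ` {1..y div d}"
      then obtain k where "n = d * k" "k \<in> {1..y div d}" by (rule imageE)
      then have k: "n = d * k" "1 \<le> k" "k \<le> y div d" by auto
      then have "d * k \<le> y" using d by (auto simp: less_eq_div_iff_mult_less_eq mult.commute)
      then show "n \<in> {n\<in>{1..y}. d dvd n}" using k d by auto
    qed
    then have "card {n\<in>{1..y}. d dvd n} = y div d" using d by (simp add: card_image inj_on_def)
    then show "(\<Sum>n\<in>{1..y}. if d dvd n then f d else 0) = of_nat (y div d) * f d"
      by (simp add: sum.inter_filter[symmetric])
  qed
  finally have "of_nat y * (\<Sum>m\<in>{1..y}. f m / of_nat m) - (\<Sum>n\<in>{1..y}. divisor_sum f n) =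
    (\<Sum>d\<in>{1..y}. (of_nat y / of_nat d - of_nat (y div d)) * f d)"
    by (simp add: sum_distrib_left sum_subtractf[symmetric] algebra_simps)
  also have "norm \<dots> \<le> (\<Sum>d\<in>{1..y}. 1)"
  proof (rule sum_norm_le)
    fix d assume d: "d \<in> {1..y}"
    have "norm (of_nat y / of_nat d - of_nat (y div d) :: complex) = \<bar>real y / real d - real (y div d)\<bar>"
    proof -
      have "of_nat y / of_nat d - of_nat (y div d) = complex_of_real (real y / real d - real (y div d))" by simp
      then show ?thesis by (metis norm_of_real)
    qed
    also have "\<dots> \<le> 1" using real_div_bounds[of y d] by linarith
    finally have "norm (of_nat y / of_nat d - of_nat (y div d) :: complex) \<le> 1" .
    moreover have "norm (f d) \<le> 1" using f by (simp add: completely_mult_def)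
    ultimately show "norm ((of_nat y / of_nat d - of_nat (y div d)) * f d) \<le> 1"
      unfolding norm_mult by (intro mult_le_one) auto
  qed
  finally show ?thesis by simp
qed

lemma ln_eq_sum_prime_factors:
  assumes "n \<ge> 1"
  shows "ln (real n) = (\<Sum>p\<in>prime_factors n. real (multiplicity p n) * ln (real p))"
proof -
  have "real n = (\<Prod>p\<in>prime_factors n. real p ^ multiplicity p n)"
    using prime_factorization_nat[of n] assms by (metis (no_types, lifting) less_le_trans of_nat_prod of_nat_power prod.cong zero_less_one)
  then have "ln (real n) = ln (\<Prod>p\<in>prime_factors n. real p ^ multiplicity p n)" by simp
  also have "\<dots> = (\<Sum>p\<in>prime_factors n. ln (real p ^ multiplicity p n))"
    by (intro ln_prod) (auto intro: prime_gt_0_nat in_prime_factors_imp_prime)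
  also have "\<dots> = (\<Sum>p\<in>prime_factors n. real (multiplicity p n) * ln (real p))"
    by (intro sum.cong) (auto simp: ln_realpow prime_gt_0_nat)
  finally show ?thesis .
qed

text \<open>Expanding ln n over prime powers saves the factor ln y that a trivial estimate would lose.\<close>
lemma hall_bound:
  assumes f: "completely_mult f" and y: "y \<ge> 1"
  shows "(\<Sum>n\<in>{1..y}. norm (divisor_sum f n)) * ln (real y) \<le> 201 * real y * (\<Sum>m\<in>{1..y}. norm (divisor_sum f m) / real m)"
proof -
  define G where "G n = norm (divisor_sum f n)" for n
  have Gpk: "G (p ^ k) \<le> real k + 1" if "prime p" for p k
  proof -
    have "norm (\<Sum>j\<le>k. f p ^ j) \<le> (\<Sum>j\<le>k. 1)"
      using f by (intro sum_norm_le) (auto simp: norm_power completely_mult_def intro: power_le_one)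
    then show ?thesis unfolding G_def divisor_sum_prime_power[OF f that] by simp
  qed
  have lnn: "ln (real p) \<ge> 0" if "(p, k) \<in> prime_powers_upto Y" for p k Y
    using that prime_ge_1_nat[of p] by (auto simp: prime_powers_upto_def)
  have "(\<Sum>n\<in>{1..y}. G n * ln (real n)) = (\<Sum>(n, p)\<in>(SIGMA n:{1..y}. prime_factors n). G n * (real (multiplicity p n) * ln (real p)))"
    by (subst sum.Sigma[symmetric]) (auto simp: ln_eq_sum_prime_factors sum_distrib_left)
  also have "\<dots> \<le> (\<Sum>(m, (p, k))\<in>(SIGMA m:{1..y}. prime_powers_upto (y div m)). G m * (real k * (real k + 1) * ln (real p)))"
  \<comment> \<open>A pair (n, p) is reached from (m, (p, k)) with k the exact multiplicity of p in
    n, so m is prime to p and the convolution splits. Triples with p dividing m only add nonnegative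
    terms.\<close>
  proof (rule sum_le_included[where i = "\<lambda>(m, (p, k)). (p ^ k * m, p)"])
    show "\<forall>x\<in>(SIGMA n:{1..y}. prime_factors n). \<exists>z\<in>(SIGMA m:{1..y}. prime_powers_upto (y div m)).
       (case z of (m, (p, k)) \<Rightarrow> (p ^ k * m, p)) = x \<and>
       (case x of (n, p) \<Rightarrow> G n * (real (multiplicity p n) * ln (real p))) \<le> (case z of (m, (p, k)) \<Rightarrow> G m * (real k * (real k + 1) * ln (real p)))"
    proof (safe)
      fix n p assume n: "n \<in> {1..y}" and p: "p \<in> prime_factors n"
      have pp: "prime p" "p dvd n" using p by auto
      define k where "k = multiplicity p n"
      obtain m where m: "n = p ^ k * m" "\<not> p dvd m"
        using multiplicity_decompose'[of n p] n pp unfolding k_def by (metis not_prime_unit atLeastAtMost_iff not_one_le_zero)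
      have k1: "k \<ge> 1" using pp n unfolding k_def by (simp add: Suc_le_eq prime_multiplicity_gt_zero_iff)
      have m0: "m \<ge> 1" using m n by (cases m) auto
      have "m \<le> n" using m n pp(1) by (simp add: prime_gt_0_nat)
      then have "m \<in> {1..y}" using m0 n by auto
      moreover have "p ^ k * m \<le> y" using m n by auto
      then have "p ^ k \<le> y div m" using m0 by (simp add: less_eq_div_iff_mult_less_eq)
      ultimately have z: "(m, (p, k)) \<in> (SIGMA m:{1..y}. prime_powers_upto (y div m))"
        using pp(1) k1 by (simp add: prime_powers_upto_def)
      have "coprime (p ^ k) m" using pp(1) m(2) by (simp add: prime_imp_coprime)
      then have "G n = G (p ^ k) * G m" unfolding G_def m(1) using m0 pp(1)
        by (subst divisor_sum_mult[OF f]) (auto simp: norm_mult prime_gt_0_nat)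
      also have "\<dots> \<le> (real k + 1) * G m" using Gpk[OF pp(1)] by (intro mult_right_mono) (auto simp: G_def)
      finally have "G n * (real k * ln (real p)) \<le> (real k + 1) * G m * (real k * ln (real p))"
        using prime_ge_1_nat[OF pp(1)] by (intro mult_right_mono) auto
      then have "G n * (real (multiplicity p n) * ln (real p)) \<le> G m * (real k * (real k + 1) * ln (real p))"
        unfolding k_def[symmetric] by (simp add: mult_ac)
      then show "\<exists>z\<in>(SIGMA m:{1..y}. prime_powers_upto (y div m)).
       (case z of (m, (p, k)) \<Rightarrow> (p ^ k * m, p)) = (n, p) \<and>
       G n * (real (multiplicity p n) * ln (real p)) \<le> (case z of (m, (p, k)) \<Rightarrow> G m * (real k * (real k + 1) * ln (real p)))"
        using z m(1) by (intro bexI[of _ "(m, (p, k))"]) auto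
    qed
  qed (auto simp: finite_prime_powers_upto G_def intro!: mult_nonneg_nonneg lnn)
  also have "\<dots> = (\<Sum>m\<in>{1..y}. G m * (\<Sum>(p, k)\<in>prime_powers_upto (y div m). real k * (real k + 1) * ln (real p)))"
    by (subst sum.Sigma[symmetric]) (auto simp: finite_prime_powers_upto sum_distrib_left case_prod_unfold)
  also have "\<dots> \<le> (\<Sum>m\<in>{1..y}. G m * (200 * (real y / real m)))"
  proof (intro sum_mono mult_left_mono)
    fix m
    have "(\<Sum>(p, k)\<in>prime_powers_upto (y div m). real k * (real k + 1) * ln (real p)) \<le> 200 * real (y div m)"
      by (rule chebyshev_prime_powers)
    also have "\<dots> \<le> 200 * (real y / real m)" using real_div_bounds[of y m] by linarith
    finally show "(\<Sum>(p, k)\<in>prime_powers_upto (y div m). real k * (real k + 1) * ln (real p)) \<le> 200 * (real y / real m)" .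
  qed (auto simp: G_def)
  finally have 1: "(\<Sum>n\<in>{1..y}. G n * ln (real n)) \<le> (\<Sum>m\<in>{1..y}. G m * (200 * (real y / real m)))" .
  have 2: "(\<Sum>n\<in>{1..y}. G n * (ln (real y) - ln (real n))) \<le> (\<Sum>n\<in>{1..y}. G n * (real y / real n))"
  proof (intro sum_mono mult_left_mono)
    fix n assume n: "n \<in> {1..y}"
    have "ln (real y / real n) \<le> real y / real n" using n by (intro ln_bound) auto
    then show "ln (real y) - ln (real n) \<le> real y / real n" using n y by (simp add: ln_div)
  qed (auto simp: G_def)
  have "(\<Sum>n\<in>{1..y}. G n) * ln (real y) = (\<Sum>n\<in>{1..y}. G n * ln (real n)) + (\<Sum>n\<in>{1..y}. G n * (ln (real y) - ln (real n)))"
    unfolding sum_distrib_right sum.distrib[symmetric] by (intro sum.cong refl) (simp add: algebra_simps)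
  also have "\<dots> \<le> (\<Sum>m\<in>{1..y}. G m * (200 * (real y / real m))) + (\<Sum>n\<in>{1..y}. G n * (real y / real n))"
    using 1 2 by simp
  also have "\<dots> = 201 * real y * (\<Sum>m\<in>{1..y}. G m / real m)"
    unfolding sum_distrib_left sum.distrib[symmetric] by (intro sum.cong) auto
  finally show ?thesis by (simp add: G_def)
qed

text \<open>With t = 1 - Re z one has |1 + z|^2 \<le> 4 - 2 t \<le> (2 - t/2)^2. So half of the
  distance from 1 is saved at every prime.\<close>

lemma norm_one_plus_le: "norm (1 + z) \<le> 2 - (1 - Re z) / 2" if "norm z \<le> 1" for z :: complex
proof -
  have "norm (1 + z) ^ 2 = 1 + 2 * Re z + norm z ^ 2"
    by (simp only: cmod_power2) (simp add: power2_eq_square algebra_simps)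
  also have "\<dots> \<le> 2 + 2 * Re z" using that by (simp add: power_le_one)
  also have "\<dots> \<le> (2 - (1 - Re z) / 2) ^ 2" using zero_le_power2[of "1 - Re z"] by (simp add: power2_eq_square field_simps)
  finally have "norm (1 + z) ^ 2 \<le> (2 - (1 - Re z) / 2) ^ 2" .
  moreover have "2 - (1 - Re z) / 2 \<ge> 0" using abs_Re_le_cmod[of z] that by simp
  ultimately show ?thesis by (rule power2_le_imp_le)
qed

text \<open>The squared pretentious distance between f and 1, weighted by p^{-s} instead of a cutoff. As it increases
  with N, a bound for the full sum is expressed by quantifying over N.\<close>
definition pdist :: "real \<Rightarrow> (nat \<Rightarrow> complex) \<Rightarrow> nat \<Rightarrow> real" where
  "pdist s f N = (\<Sum>p\<in>primes_upto N. (1 - Re (f p)) * real p powr - s)"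

lemma pdist_mono:
  assumes "\<And>n. norm (f n) \<le> 1" "M \<le> N"
  shows "pdist s f M \<le> pdist s f N"
proof -
  have "Re (f p) \<le> 1" for p using assms(1)[of p] abs_Re_le_cmod[of "f p"] by linarith
  then show ?thesis unfolding pdist_def using primes_upto_mono[OF assms(2)] by (intro sum_mono2) auto
qed

text \<open>Euler product bound for the absolute values of the convolution: the primes contribute |1
  + f(p)| p^(-s), higher powers at most 28/p^2. Raising the prime range from y to N is harmless
  since these contributions are nonnegative, and the distance is taken at N.\<close>

lemma divisor_sum_log_mean:
  assumes f: "completely_mult f" and s: "s > 1" and N: "N \<ge> y"
  shows "(\<Sum>m\<in>{1..y}. norm (divisor_sum f m) * real m powr - s) \<le> exp (2 * (ln (1 + 1 / (s - 1)) + 2) + 28 - pdist s f N / 2)"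
proof -
  define g where "g m = norm (divisor_sum f m) * real m powr - s" for m
  have fn: "norm (f n) \<le> 1" for n using f by (simp add: completely_mult_def)
  have "(\<Sum>m\<in>{1..y}. g m) \<le> (\<Prod>p\<in>primes_upto y. \<Sum>k\<in>{..y}. g (p ^ k))"
  proof (rule finite_euler_product_bound)
    show "g 1 = 1" using f by (simp add: g_def divisor_sum_def completely_mult_def)
    show "g (p ^ k * m) = g (p ^ k) * g m" if p: "prime p" "\<not> p dvd m" for p k m
    proof -
      have "m > 0" using p(2) by (cases m) auto
      moreover have "coprime (p ^ k) m" using p by (simp add: prime_imp_coprime)
      ultimately show ?thesis using p(1) unfolding g_def
        by (subst divisor_sum_mult[OF f]) (auto simp: norm_mult prime_gt_0_nat powr_mult)
    qed
  qed (auto simp: g_def)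
  also have "\<dots> \<le> (\<Prod>p\<in>primes_upto y. exp (norm (1 + f p) * real p powr - s + 28 / real p ^ 2))"
  proof (rule prod_mono, intro conjI)
    fix p assume "p \<in> primes_upto y"
    then have p: "prime p" "p \<le> y" by (auto simp: primes_upto_def)
    have p2: "p \<ge> 2" using p(1) by (rule prime_ge_2_nat)
    have "{..y} = insert 0 (insert 1 {2..y})" using p2 p(2) by auto
    then have "(\<Sum>k\<in>{..y}. g (p ^ k)) = g 1 + g p + (\<Sum>k\<in>{2..y}. g (p ^ k))" by simp
    also have "g 1 = 1" using f by (simp add: g_def divisor_sum_def completely_mult_def)
    also have "g p = norm (1 + f p) * real p powr - s"
      using divisor_sum_prime_power[OF f p(1), of 1] by (simp add: g_def)
    also have "(\<Sum>k\<in>{2..y}. g (p ^ k)) \<le> (\<Sum>k\<in>{2..y}. real k * (real k + 1) * (1 / real p) ^ k)"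
    proof (rule sum_mono)
      fix k assume k: "k \<in> {2..y}"
      have "norm (divisor_sum f (p ^ k)) \<le> (\<Sum>j\<le>k. 1)"
        unfolding divisor_sum_prime_power[OF f p(1)] using fn
        by (intro sum_norm_le) (auto simp: norm_power intro: power_le_one)
      also have "\<dots> = 1 * (real k + 1)" by simp
      also have "\<dots> \<le> real k * (real k + 1)" using k by (intro mult_right_mono) auto
      finally have "norm (divisor_sum f (p ^ k)) \<le> real k * (real k + 1)" .
      moreover have "real (p ^ k) powr - s \<le> (1 / real p) ^ k"
        using powr_minus_le_inverse[of s "p ^ k"] s p2 by (simp add: power_divide)
      ultimately show "g (p ^ k) \<le> real k * (real k + 1) * (1 / real p) ^ k"
        unfolding g_def by (intro mult_mono) auto
    qed
    also have "\<dots> \<le> 28 * (1 / real p) ^ 2" using p2 by (intro geometric_quadratic_sum) auto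
    also have "1 + norm (1 + f p) * real p powr - s + 28 * (1 / real p) ^ 2 \<le> exp (norm (1 + f p) * real p powr - s + 28 / real p ^ 2)"
    proof -
      have "28 * (1 / real p) ^ 2 = 28 / real p ^ 2" by (simp add: power_divide)
      then show ?thesis using exp_ge_add_one_self[of "norm (1 + f p) * real p powr - s + 28 / real p ^ 2"] by linarith
    qed
    finally show "(\<Sum>k\<in>{..y}. g (p ^ k)) \<le> exp (norm (1 + f p) * real p powr - s + 28 / real p ^ 2)" by simp
  qed (auto intro!: sum_nonneg simp: g_def)
  also have "\<dots> = exp ((\<Sum>p\<in>primes_upto y. norm (1 + f p) * real p powr - s) + 28 * (\<Sum>p\<in>primes_upto y. 1 / real p ^ 2))"
    by (simp add: exp_sum[symmetric] sum.distrib sum_distrib_left)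
  also have "\<dots> \<le> exp (2 * (ln (1 + 1 / (s - 1)) + 2) - pdist s f N / 2 + 28)"
  proof (subst exp_le_cancel_iff, rule add_mono)
    have "(\<Sum>p\<in>primes_upto y. norm (1 + f p) * real p powr - s) \<le> (\<Sum>p\<in>primes_upto N. norm (1 + f p) * real p powr - s)"
      using primes_upto_mono[OF N] by (intro sum_mono2) auto
    also have "\<dots> \<le> (\<Sum>p\<in>primes_upto N. (2 - (1 - Re (f p)) / 2) * real p powr - s)"
      using norm_one_plus_le[OF fn] by (intro sum_mono mult_right_mono) auto
    also have "\<dots> = 2 * (\<Sum>p\<in>primes_upto N. real p powr - s) - pdist s f N / 2"
      unfolding pdist_def sum_distrib_left sum_divide_distrib sum_subtractf[symmetric]
      by (intro sum.cong refl) (simp add: field_simps)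
    also have "\<dots> \<le> 2 * (ln (1 + 1 / (s - 1)) + 2) - pdist s f N / 2"
      using prime_powr_sum_upper[OF s, of N] by simp
    finally show "(\<Sum>p\<in>primes_upto y. norm (1 + f p) * real p powr - s) \<le> 2 * (ln (1 + 1 / (s - 1)) + 2) - pdist s f N / 2" .
    show "28 * (\<Sum>p\<in>primes_upto y. 1 / real p ^ 2) \<le> 28" using sum_primes_inverse_squares_le[of y] by simp
  qed
  finally show ?thesis unfolding g_def by (simp add: algebra_simps)
qed

text \<open>For s = 1 + 1/ln q the weight 1/m is at most e m^(-s) when m \<le> q, so the Euler
  product bound applies; Hall's bound then passes to the ordinary mean of the convolution, and from
  there to f.\<close>

lemma log_mean_bound:
  obtains C :: real where "C > 0" "\<And>f q y N \<Delta>. completely_mult f \<Longrightarrow> q \<ge> 3 \<Longrightarrow> y \<le> q \<Longrightarrow> \<Delta> \<le> pdist (1 + 1 / ln (real q)) f N \<Longrightarrow>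
     norm (\<Sum>m\<in>{1..y}. f m / of_nat m) \<le> 1 + C * ln (real q) * exp (- \<Delta> / 4)"
proof -
  \<comment> \<open>201 is the constant of \<open>hall_bound\<close>, 4 comes from 1 + X \<le> 2 X
    squared, and 33 = 1 + 4 + 28 collects the exponents.\<close>
  define C :: real where "C = 4 * 201 * exp 33"
  have "norm (\<Sum>m\<in>{1..y}. f m / of_nat m) \<le> 1 + C * ln (real q) * exp (- \<Delta> / 4)"
    if f: "completely_mult f" and q: "q \<ge> 3" and y: "y \<le> q" and D: "\<Delta> \<le> pdist (1 + 1 / ln (real q)) f N" for f q y N \<Delta>
  proof -
    define X where "X = ln (real q)"
    have "exp 1 \<le> real q" using exp_le q by linarith
    then have X1: "X \<ge> 1" unfolding X_def using q by (subst ln_ge_iff) auto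
    have fn: "norm (f n) \<le> 1" for n using f by (simp add: completely_mult_def)
    \<comment> \<open>Hall's bound gives about X^2 exp(-\<Delta>/2) / ln y. For ln y above X
      exp(-\<Delta>/4) this is at most X exp(-\<Delta>/4); below that threshold the harmonic sum
      itself is small enough. Hence \<Delta>/4 instead of \<Delta>/2.\<close>
    consider "y = 0" | "y \<ge> 1" "ln (real y) \<le> X * exp (- \<Delta> / 4)" | "y \<ge> 1" "ln (real y) > X * exp (- \<Delta> / 4)" by linarith
    then show ?thesis
    proof cases
      case 1
      then show ?thesis using X1 by (simp add: C_def X_def[symmetric])
    next
      case 2
      have "norm (\<Sum>m\<in>{1..y}. f m / of_nat m) \<le> harm y" unfolding harm_def
        using fn by (intro sum_norm_le) (auto simp: norm_divide inverse_eq_divide divide_right_mono)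
      also have "\<dots> \<le> ln (real y) + 1" by (rule harm_le_ln[OF 2(1)])
      also have "\<dots> \<le> 1 + 1 * (X * exp (- \<Delta> / 4))" using 2(2) by simp
      also have "\<dots> \<le> 1 + C * (X * exp (- \<Delta> / 4))"
      proof (intro add_left_mono mult_right_mono)
        show "1 \<le> C" unfolding C_def using one_le_exp_iff[of "33::real"] by linarith
      qed (use X1 in auto)
      finally show ?thesis by (simp add: X_def mult.assoc)
    next
      case 3
      define s where "s = 1 + 1 / X"
      have s: "s > 1" "1 / (s - 1) = X" using X1 by (auto simp: s_def)
      define G where "G n = norm (divisor_sum f n)" for n
      define M where "M = max N y"
      have D': "\<Delta> \<le> pdist s f M"
        using D pdist_mono[of f N M s, OF fn] unfolding s_def X_def M_def by (meson max.cobounded1 order.trans)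
      have ypos: "real y > 0" using 3 by simp
      have lny: "ln (real y) > 0" using 3(2) X1 by (smt (verit) exp_gt_zero mult_pos_pos)
      have "(\<Sum>m\<in>{1..y}. G m / real m) \<le> (\<Sum>m\<in>{1..y}. exp 1 * (G m * real m powr - s))"
      proof (rule sum_mono)
        fix m assume m: "m \<in> {1..y}"
        have "1 / real m = real m powr - s * real m powr (1 / X)"
          using m by (simp add: powr_add[symmetric] s_def powr_minus_divide)
        also have "\<dots> \<le> real m powr - s * exp 1"
        proof (intro mult_left_mono)
          have "real m powr (1 / X) \<le> real q powr (1 / X)" using m y X1 by (intro powr_mono2) auto
          also have "real q powr (1 / X) = exp 1" using q X1 by (simp add: powr_def X_def)
          finally show "real m powr (1 / X) \<le> exp 1" .
        qed auto
        finally have "1 / real m \<le> real m powr - s * exp 1" .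
        then have "G m * (1 / real m) \<le> G m * (real m powr - s * exp 1)" by (intro mult_left_mono) (auto simp: G_def)
        then show "G m / real m \<le> exp 1 * (G m * real m powr - s)" by (simp add: mult_ac)
      qed
      also have "\<dots> = exp 1 * (\<Sum>m\<in>{1..y}. G m * real m powr - s)" by (simp add: sum_distrib_left)
      also have "\<dots> \<le> exp 1 * exp (2 * (ln (1 + X) + 2) + 28 - pdist s f M / 2)"
        using divisor_sum_log_mean[OF f s(1), of y M] unfolding G_def s(2) M_def by (intro mult_left_mono) auto
      also have "\<dots> \<le> exp 1 * exp (2 * (ln (1 + X) + 2) + 28 - \<Delta> / 2)" using D' by simp
      also have "\<dots> = exp 33 * exp (2 * ln (1 + X)) * exp (- \<Delta> / 4) * exp (- \<Delta> / 4)"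
        by (simp add: exp_add[symmetric])
      also have "exp (2 * ln (1 + X)) = (1 + X) ^ 2" using X1 by (simp add: exp_double)
      also have "exp 33 * (1 + X) ^ 2 * exp (- \<Delta> / 4) * exp (- \<Delta> / 4) \<le> exp 33 * (2 * X) ^ 2 * exp (- \<Delta> / 4) * exp (- \<Delta> / 4)"
        using X1 by (intro mult_right_mono mult_left_mono power_mono) auto
      finally have "(\<Sum>m\<in>{1..y}. G m / real m) \<le> exp 33 * (2 * X) ^ 2 * exp (- \<Delta> / 4) * exp (- \<Delta> / 4)" .
      then have "201 * real y * (\<Sum>m\<in>{1..y}. G m / real m) \<le> 201 * real y * (exp 33 * (2 * X) ^ 2 * exp (- \<Delta> / 4) * exp (- \<Delta> / 4))"
        by (intro mult_left_mono) auto
      then have "(\<Sum>n\<in>{1..y}. G n) * ln (real y) \<le> (C * real y * X * exp (- \<Delta> / 4)) * (X * exp (- \<Delta> / 4))"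
        using hall_bound[OF f 3(1)] by (simp add: G_def C_def power2_eq_square mult_ac)
      also have "\<dots> \<le> (C * real y * X * exp (- \<Delta> / 4)) * ln (real y)"
        using 3(2) X1 by (intro mult_left_mono) (auto simp: C_def)
      finally have S: "(\<Sum>n\<in>{1..y}. G n) \<le> C * real y * X * exp (- \<Delta> / 4)" using lny by simp
      have "real y * norm (\<Sum>m\<in>{1..y}. f m / of_nat m) = norm (of_nat y * (\<Sum>m\<in>{1..y}. f m / of_nat m))" by (simp add: norm_mult)
      also have "\<dots> \<le> norm (\<Sum>n\<in>{1..y}. divisor_sum f n) + norm (of_nat y * (\<Sum>m\<in>{1..y}. f m / of_nat m) - (\<Sum>n\<in>{1..y}. divisor_sum f n))"
        by (metis norm_triangle_sub)
      also have "\<dots> \<le> (\<Sum>n\<in>{1..y}. G n) + real y"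
        unfolding G_def by (intro add_mono norm_sum sum_divisor_sum[OF f])
      also have "\<dots> \<le> real y * (1 + C * X * exp (- \<Delta> / 4))" using S by (simp add: algebra_simps)
      finally show ?thesis using ypos by (simp add: X_def)
    qed
  qed
  moreover have "C > 0" by (simp add: C_def)
  ultimately show ?thesis using that by blast
qed

section \<open>The Turan--Kubilius inequality and Katai's bilinear argument\<close>

lemma weighted_cauchy_schwarz:
  fixes w a :: "'a \<Rightarrow> real"
  assumes "\<And>i. i \<in> A \<Longrightarrow> w i \<ge> 0"
  shows "(\<Sum>i\<in>A. w i * a i) ^ 2 \<le> (\<Sum>i\<in>A. w i) * (\<Sum>i\<in>A. w i * a i ^ 2)"
proof -
  have "(\<Sum>i\<in>A. sqrt (w i) * (sqrt (w i) * a i)) ^ 2 \<le> (\<Sum>i\<in>A. sqrt (w i) ^ 2) * (\<Sum>i\<in>A. (sqrt (w i) * a i) ^ 2)"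
    by (rule Cauchy_Schwarz_ineq_sum)
  moreover have "(\<Sum>i\<in>A. sqrt (w i) * (sqrt (w i) * a i)) = (\<Sum>i\<in>A. w i * a i)"
    using assms by (intro sum.cong) (auto simp: mult.assoc[symmetric])
  moreover have "(\<Sum>i\<in>A. sqrt (w i) ^ 2) = (\<Sum>i\<in>A. w i)" using assms by (intro sum.cong) auto
  moreover have "(\<Sum>i\<in>A. (sqrt (w i) * a i) ^ 2) = (\<Sum>i\<in>A. w i * a i ^ 2)"
    using assms by (intro sum.cong) (auto simp: power_mult_distrib)
  ultimately show ?thesis by simp
qed

lemma multiples_image:
  assumes "d \<ge> (1::nat)"
  shows "{n\<in>{N<..x}. d dvd n} = (\<lambda>k. d * k) ` {N div d<..x div d}"
proof (intro equalityI subsetI)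
  fix n assume "n \<in> {n\<in>{N<..x}. d dvd n}"
  then obtain k where k: "n = d * k" "N < n" "n \<le> x" by (auto elim: dvdE)
  then have "k \<in> {N div d<..x div d}" using assms
    by (auto simp: less_eq_div_iff_mult_less_eq div_less_iff_less_mult mult.commute)
  then show "n \<in> (\<lambda>k. d * k) ` {N div d<..x div d}" using k by blast
next
  fix n assume "n \<in> (\<lambda>k. d * k) ` {N div d<..x div d}"
  then obtain k where "n = d * k" "k \<in> {N div d<..x div d}" by (rule imageE)
  then have k: "n = d * k" "N div d < k" "k \<le> x div d" by auto
  then have "N < d * k" "d * k \<le> x" using assms
    by (auto simp: less_eq_div_iff_mult_less_eq div_less_iff_less_mult mult.commute)
  then show "n \<in> {n\<in>{N<..x}. d dvd n}" using k by auto
qed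

lemma sum_multiples:
  fixes g :: "nat \<Rightarrow> 'a :: comm_monoid_add"
  assumes "d \<ge> 1"
  shows "(\<Sum>n\<in>{n\<in>{N<..x}. d dvd n}. g n) = (\<Sum>k\<in>{N div d<..x div d}. g (d * k))"
  unfolding multiples_image[OF assms] using assms by (subst sum.reindex) (auto simp: inj_on_def)

lemma harm_greaterThan: "(\<Sum>n\<in>{0<..x}. 1 / real n) = harm x"
  unfolding harm_def by (intro sum.cong) (auto simp: inverse_eq_divide)

lemma sum_inverse_multiples:
  assumes "d \<ge> 1"
  shows "(\<Sum>n\<in>{n\<in>{0<..x}. d dvd n}. 1 / real n) = harm (x div d) / real d"
  unfolding sum_multiples[OF assms] using assms
  by (simp add: harm_greaterThan[symmetric] sum_divide_distrib mult.commute)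

lemma harm_diff_div_le:
  assumes "d \<ge> 1"
  shows "harm x - harm (x div d) \<le> ln (real d) + 1"
proof (cases "x \<ge> 1")
  case True
  have "real x / real d \<le> real (x div d) + 1" using real_div_bounds(2)[of x d] by simp
  then have "ln (real x / real d) \<le> ln (real (x div d) + 1)" using True assms by (subst ln_le_cancel_iff) auto
  also have "\<dots> \<le> harm (x div d)" by (rule ln_le_harm)
  finally have "ln (real x) - ln (real d) \<le> harm (x div d)" using True assms by (simp add: ln_div)
  then show ?thesis using harm_le_ln[OF True] by simp
qed (use assms in \<open>simp add: harm_def\<close>)

lemma sum_inverse_interval_div_le:
  assumes "d \<ge> 1"
  shows "(\<Sum>n\<in>{x div d<..x}. 1 / real n) \<le> ln (real d) + 1"
proof -
  have "{0<..x} = {0<..x div d} \<union> {x div d<..x}" using div_le_dividend[of x d] by (auto intro: order.trans[OF _ div_le_dividend])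
  then have "harm x = harm (x div d) + (\<Sum>n\<in>{x div d<..x}. 1 / real n)"
    unfolding harm_greaterThan[symmetric] by (simp add: sum.union_disjoint)
  then show ?thesis using harm_diff_div_le[OF assms, of x] by simp
qed

text \<open>A second moment computation with weights 1/n. The upper bound (L^2 + L) h for the second
  moment and the lower bound L (h - lz) for the first make the main terms L^2 h cancel; L h is the
  diagonal, and lz measures how much the harmonic sum shrinks when x is divided by a prime.\<close>

lemma turan_kubilius:
  fixes z x :: nat
  defines "L \<equiv> \<Sum>p\<in>primes_upto z. 1 / real p"
  assumes H: "harm x \<le> H" and lz: "ln (real z) + 1 \<le> lz"
  shows "(\<Sum>n\<in>{0<..x}. 1 / real n * (real (card {p\<in>primes_upto z. p dvd n}) - L) ^ 2) \<le> L * H + 2 * L ^ 2 * lz"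
proof -
  define w where "w n = real (card {p\<in>primes_upto z. p dvd n})" for n
  have weq: "w n = (\<Sum>p\<in>primes_upto z. if p dvd n then 1 else 0)" for n
    unfolding w_def by (simp flip: sum.inter_filter)
  have p1: "p \<ge> 1" "real p > 0" "p \<le> z" if "p \<in> primes_upto z" for p using that by (auto simp: primes_upto_def prime_gt_0_nat Suc_le_eq)
  have L0: "L \<ge> 0" unfolding L_def by (intro sum_nonneg) auto
  define h where "h = (harm x :: real)"
  have h0: "h \<ge> 0" unfolding h_def by (rule harm_nonneg)
  have A: "(\<Sum>n\<in>{0<..x}. 1 / real n * w n) \<ge> L * (h - lz)"
  proof -
    have "(\<Sum>n\<in>{0<..x}. 1 / real n * w n) = (\<Sum>p\<in>primes_upto z. \<Sum>n\<in>{0<..x}. if p dvd n then 1 / real n else 0)"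
      unfolding weq sum_distrib_left by (subst sum.swap) (intro sum.cong refl, simp)
    also have "\<dots> = (\<Sum>p\<in>primes_upto z. harm (x div p) / real p)"
    proof (rule sum.cong[OF refl])
      fix p assume "p \<in> primes_upto z"
      show "(\<Sum>n\<in>{0<..x}. if p dvd n then 1 / real n else 0) = harm (x div p) / real p"
        unfolding sum_inverse_multiples[OF p1(1)[OF \<open>p \<in> primes_upto z\<close>], symmetric] by (simp only: sum.inter_filter finite_greaterThanAtMost)
    qed
    also have "\<dots> \<ge> (\<Sum>p\<in>primes_upto z. 1 / real p * (h - lz))"
    proof (rule sum_mono)
      fix p assume p: "p \<in> primes_upto z"
      have "ln (real p) \<le> ln (real z)" using p1[OF p] by (subst ln_le_cancel_iff) auto
      then have "h - lz \<le> harm (x div p)" using harm_diff_div_le[OF p1(1)[OF p], of x] lz by (simp add: h_def)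
      then show "1 / real p * (h - lz) \<le> harm (x div p) / real p" using p1(2)[OF p] by (simp add: divide_right_mono)
    qed
    finally show ?thesis unfolding L_def sum_distrib_right .
  qed
  have B: "(\<Sum>n\<in>{0<..x}. 1 / real n * w n ^ 2) \<le> (L ^ 2 + L) * h"
  proof -
    have "(\<Sum>n\<in>{0<..x}. 1 / real n * w n ^ 2) = (\<Sum>n\<in>{0<..x}. \<Sum>p\<in>primes_upto z. \<Sum>p'\<in>primes_upto z. if p dvd n \<and> p' dvd n then 1 / real n else 0)"
    proof (rule sum.cong[OF refl])
      fix n
      have "w n ^ 2 = (\<Sum>p\<in>primes_upto z. \<Sum>p'\<in>primes_upto z. (if p dvd n then 1 else 0) * (if p' dvd n then 1 else 0))"
        unfolding power2_eq_square weq sum_product ..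
      then have "1 / real n * w n ^ 2 = (\<Sum>p\<in>primes_upto z. \<Sum>p'\<in>primes_upto z. 1 / real n * ((if p dvd n then 1 else 0) * (if p' dvd n then 1 else 0)))"
        by (simp only: sum_distrib_left)
      also have "\<dots> = (\<Sum>p\<in>primes_upto z. \<Sum>p'\<in>primes_upto z. if p dvd n \<and> p' dvd n then 1 / real n else 0)"
        by (intro sum.cong refl) simp
      finally show "1 / real n * w n ^ 2 = \<dots>" .
    qed
    also have "\<dots> = (\<Sum>p\<in>primes_upto z. \<Sum>p'\<in>primes_upto z. \<Sum>n\<in>{0<..x}. if p dvd n \<and> p' dvd n then 1 / real n else 0)"
      by (rule trans[OF sum.swap]) (rule sum.cong[OF refl], rule sum.swap)
    also have "\<dots> \<le> (\<Sum>p\<in>primes_upto z. \<Sum>p'\<in>primes_upto z. h * (1 / real p * (1 / real p')) + (if p' = p then h * (1 / real p) else 0))"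
    proof (intro sum_mono)
      fix p p' assume p: "p \<in> primes_upto z" and p': "p' \<in> primes_upto z"
      show "(\<Sum>n\<in>{0<..x}. if p dvd n \<and> p' dvd n then 1 / real n else 0) \<le> h * (1 / real p * (1 / real p')) + (if p' = p then h * (1 / real p) else 0)"
      proof (cases "p' = p")
        case True
        have "(\<Sum>n\<in>{0<..x}. if p dvd n \<and> p' dvd n then 1 / real n else 0) = harm (x div p) / real p"
          unfolding sum_inverse_multiples[OF p1(1)[OF p], symmetric] True by (simp only: sum.inter_filter finite_greaterThanAtMost simp_thms)
        also have "\<dots> \<le> h * (1 / real p)" unfolding h_def by (simp add: divide_right_mono harm_mono)
        finally show ?thesis using True h0 by (simp add: add_increasing)
      next
        case False
        have "coprime p p'" using p p' False by (intro primes_coprime) (auto simp: primes_upto_def)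
        then have dv: "p dvd n \<and> p' dvd n \<longleftrightarrow> p * p' dvd n" for n
          by (meson divides_mult dvd_mult_left dvd_mult_right)
        have pp: "p * p' \<ge> 1" using p1(1)[OF p] p1(1)[OF p'] by simp
        have "(\<Sum>n\<in>{0<..x}. if p dvd n \<and> p' dvd n then 1 / real n else 0) = harm (x div (p * p')) / real (p * p')"
          unfolding sum_inverse_multiples[OF pp, symmetric] dv by (simp only: sum.inter_filter finite_greaterThanAtMost)
        also have "\<dots> \<le> h / real (p * p')" unfolding h_def by (intro divide_right_mono harm_mono) auto
        finally show ?thesis using False by simp
      qed
    qed
    also have "\<dots> = (L ^ 2 + L) * h"
    proof -
      have "(\<Sum>p\<in>primes_upto z. \<Sum>p'\<in>primes_upto z. h * (1 / real p * (1 / real p'))) = h * (L * L)"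
        unfolding L_def sum_product by (simp only: sum_distrib_left)
      moreover have "(\<Sum>p\<in>primes_upto z. \<Sum>p'\<in>primes_upto z. if p' = p then h * (1 / real p) else 0) = h * L"
        unfolding L_def sum_distrib_left by (intro sum.cong refl) (simp add: sum.delta)
      ultimately show ?thesis by (simp only: sum.distrib) (simp add: algebra_simps power2_eq_square)
    qed
    finally show ?thesis .
  qed
  have "(\<Sum>n\<in>{0<..x}. 1 / real n * (w n - L) ^ 2) = (\<Sum>n\<in>{0<..x}. 1 / real n * w n ^ 2) - 2 * L * (\<Sum>n\<in>{0<..x}. 1 / real n * w n) + L ^ 2 * (\<Sum>n\<in>{0<..x}. 1 / real n)"
    unfolding sum_distrib_left sum_subtractf[symmetric] sum.distrib[symmetric]
    by (intro sum.cong refl) (simp add: power2_eq_square algebra_simps add_divide_distrib diff_divide_distrib)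
  also have "\<dots> \<le> (L ^ 2 + L) * h - 2 * L * (L * (h - lz)) + L ^ 2 * h"
    unfolding harm_greaterThan h_def[symmetric] using A B L0 by (intro add_mono diff_mono mult_left_mono) auto
  also have "\<dots> = L * h + 2 * L ^ 2 * lz" by (simp add: power2_eq_square algebra_simps)
  also have "\<dots> \<le> L * H + 2 * L ^ 2 * lz" using L0 H unfolding h_def by (intro add_right_mono mult_left_mono)
  finally show ?thesis unfolding w_def .
qed

lemma norm_sum_squared_expand:
  fixes a :: "'a \<Rightarrow> complex"
  shows "of_real (norm (\<Sum>i\<in>A. a i) ^ 2) = (\<Sum>i\<in>A. \<Sum>j\<in>A. a i * cnj (a j))"
  by (simp only: complex_norm_square cnj_sum sum_product)

text \<open>Most n have about L prime factors up to z, so a sum over n can be replaced by one over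
  products p m. Multiplicativity separates f(p) f(m), and Cauchy-Schwarz over m removes f(m)
  altogether. What remains are correlations of the sines at frequencies p \<alpha> and p' \<alpha>,
  for which nothing about f is needed beyond its size; \<open>bad\<close> marks the pairs that are
  bounded trivially.\<close>

lemma katai_bound:
  fixes f :: "nat \<Rightarrow> complex" and \<alpha> H lz K :: real and x N z :: nat
  defines "L \<equiv> \<Sum>p\<in>primes_upto z. 1 / real p"
  defines "C \<equiv> \<lambda>h::real. \<Sum>m\<in>{N<..x}. cos (2 * pi * real m * (h * \<alpha>)) / real m"
  defines "V bad \<equiv> \<Sum>p\<in>primes_upto z. \<Sum>p'\<in>primes_upto z. if bad p p' then 1 / real p * (1 / real p') else 0"
  assumes f: "completely_mult f" and H: "harm x \<le> H" and lz: "ln (real z) + 1 \<le> lz" and K0: "K \<ge> 0"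
    and corr: "\<And>p p'. p \<in> primes_upto z \<Longrightarrow> p' \<in> primes_upto z \<Longrightarrow> \<not> bad p p' \<Longrightarrow>
       \<bar>C (real p - real p')\<bar> \<le> K \<and> \<bar>C (real p + real p')\<bar> \<le> K"
  shows "L * norm (\<Sum>n\<in>{N<..x}. f n * of_real (sin (2 * pi * real n * \<alpha>) / real n))
     \<le> sqrt (H * (L * H + 2 * L ^ 2 * lz)) + 2 * L * lz + sqrt (H * (K * L ^ 2 + H * V bad))"
proof -
  define I where "I = {N<..x}"
  define F where "F n = sin (2 * pi * real n * \<alpha>)" for n :: nat
  define w where "w n = real (card {p\<in>primes_upto z. p dvd n})" for n
  have weq: "w n = (\<Sum>p\<in>primes_upto z. if p dvd n then 1 else 0)" for n
    unfolding w_def by (simp flip: sum.inter_filter)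
  have p1: "p \<ge> 1" "real p > 0" "p \<le> z" if "p \<in> primes_upto z" for p using that by (auto simp: primes_upto_def prime_gt_0_nat Suc_le_eq)
  have fn: "norm (f n) \<le> 1" and fm: "f (m * n) = f m * f n" for m n using f by (auto simp: completely_mult_def)
  have Fn: "\<bar>F n\<bar> \<le> 1" for n unfolding F_def by (rule abs_sin_le_one)
  have L0: "L \<ge> 0" unfolding L_def by (intro sum_nonneg) auto
  have fin: "finite I" by (simp add: I_def)
  have sumI: "(\<Sum>n\<in>I. 1 / real n) \<le> H"
  proof -
    have "(\<Sum>n\<in>I. 1 / real n) \<le> (\<Sum>n\<in>{0<..x}. 1 / real n)" unfolding I_def by (intro sum_mono2) auto
    then show ?thesis using H by (simp add: harm_greaterThan)
  qed
  have H0: "H \<ge> 0" using H harm_nonneg[of x, where 'a = real] by linarith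
  have lz0: "ln (real p) + 1 \<le> lz" if "p \<in> primes_upto z" for p
  proof -
    have "ln (real p) \<le> ln (real z)" using p1[OF that] by (subst ln_le_cancel_iff) auto
    then show ?thesis using lz by simp
  qed
  define S where "S = (\<Sum>n\<in>I. f n * of_real (F n / real n))"
  \<comment> \<open>S1 is the error of replacing the number of prime factors by its mean L. S2 runs
    over n = p m with m in a range depending on p, and S3 gives all primes the same range I, so that
    the order of summation can be exchanged.\<close>
  define S1 where "S1 = (\<Sum>n\<in>I. f n * of_real (F n / real n) * of_real (L - w n))"
  define S2 where "S2 = (\<Sum>n\<in>I. f n * of_real (F n / real n) * of_real (w n))"
  define S3 where "S3 = (\<Sum>p\<in>primes_upto z. f p * of_real (1 / real p) * (\<Sum>m\<in>I. f m * of_real (F (p * m) / real m)))"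
  have e: "l * t = t * (l - v) + t * v" for l t v :: complex by (simp add: algebra_simps)
  have "of_real L * S = S1 + S2" unfolding S_def S1_def S2_def sum.distrib[symmetric] sum_distrib_left
    by (intro sum.cong refl) (simp only: of_real_diff e)
  then have LS: "L * norm S \<le> norm S1 + norm S2"
    using norm_triangle_ineq[of S1 S2] L0 by (metis abs_of_nonneg norm_mult norm_of_real)
  have B1: "norm S1 \<le> sqrt (H * (L * H + 2 * L ^ 2 * lz))"
  proof (rule real_le_rsqrt)
    have "norm S1 \<le> (\<Sum>n\<in>I. 1 / real n * \<bar>w n - L\<bar>)" unfolding S1_def
    proof (rule sum_norm_le)
      fix n
      have "norm (f n * of_real (F n / real n) * of_real (L - w n)) = norm (f n) * \<bar>F n\<bar> * (1 / real n * \<bar>w n - L\<bar>)"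
        unfolding norm_mult norm_of_real by (simp add: abs_minus_commute)
      also have "\<dots> \<le> 1 * (1 / real n * \<bar>w n - L\<bar>)" using fn Fn by (intro mult_right_mono mult_le_one) auto
      finally show "norm (f n * of_real (F n / real n) * of_real (L - w n)) \<le> 1 / real n * \<bar>w n - L\<bar>" by simp
    qed
    then have "norm S1 ^ 2 \<le> (\<Sum>n\<in>I. 1 / real n * \<bar>w n - L\<bar>) ^ 2" by (intro power_mono) auto
    also have "\<dots> \<le> (\<Sum>n\<in>I. 1 / real n) * (\<Sum>n\<in>I. 1 / real n * \<bar>w n - L\<bar> ^ 2)"
      by (rule weighted_cauchy_schwarz) auto
    also have "\<dots> \<le> H * (L * H + 2 * L ^ 2 * lz)"
    proof (intro mult_mono sumI H0)
      have "(\<Sum>n\<in>I. 1 / real n * \<bar>w n - L\<bar> ^ 2) \<le> (\<Sum>n\<in>{0<..x}. 1 / real n * \<bar>w n - L\<bar> ^ 2)"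
        unfolding I_def by (intro sum_mono2) auto
      also have "\<dots> \<le> L * H + 2 * L ^ 2 * lz"
        unfolding power2_abs w_def L_def by (rule turan_kubilius[OF H lz])
      finally show "(\<Sum>n\<in>I. 1 / real n * \<bar>w n - L\<bar> ^ 2) \<le> L * H + 2 * L ^ 2 * lz" .
    qed (auto intro!: sum_nonneg)
    finally show "norm S1 ^ 2 \<le> H * (L * H + 2 * L ^ 2 * lz)" .
  qed
  have S2eq: "S2 = (\<Sum>p\<in>primes_upto z. f p * of_real (1 / real p) * (\<Sum>m\<in>{N div p<..x div p}. f m * of_real (F (p * m) / real m)))"
  proof -
    have "S2 = (\<Sum>p\<in>primes_upto z. \<Sum>n\<in>I. if p dvd n then f n * of_real (F n / real n) else 0)"
      unfolding S2_def weq of_real_sum sum_distrib_left by (subst sum.swap) (intro sum.cong refl, simp)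
    also have "\<dots> = (\<Sum>p\<in>primes_upto z. f p * of_real (1 / real p) * (\<Sum>m\<in>{N div p<..x div p}. f m * of_real (F (p * m) / real m)))"
    proof (rule sum.cong[OF refl])
      fix p assume p: "p \<in> primes_upto z"
      have "(\<Sum>n\<in>I. if p dvd n then f n * of_real (F n / real n) else 0) = (\<Sum>n\<in>{n\<in>I. p dvd n}. f n * of_real (F n / real n))"
        using fin by (simp only: sum.inter_filter)
      also have "\<dots> = (\<Sum>m\<in>{N div p<..x div p}. f (p * m) * of_real (F (p * m) / real (p * m)))"
        unfolding I_def by (rule sum_multiples[OF p1(1)[OF p]])
      also have "\<dots> = f p * of_real (1 / real p) * (\<Sum>m\<in>{N div p<..x div p}. f m * of_real (F (p * m) / real m))"
        unfolding sum_distrib_left fm by (intro sum.cong refl) (simp add: mult_ac)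
      finally show "(\<Sum>n\<in>I. if p dvd n then f n * of_real (F n / real n) else 0) = \<dots>" .
    qed
    finally show ?thesis .
  qed
  \<comment> \<open>The ranges differ only in (N/p, N] and (x/p, x], whose reciprocal sums are at
    most ln p + 1 each.\<close>
  have B2: "norm (S2 - S3) \<le> 2 * L * lz"
  proof -
    have "norm (S2 - S3) \<le> (\<Sum>p\<in>primes_upto z. 1 / real p * (2 * lz))"
      unfolding S2eq S3_def sum_subtractf[symmetric]
    proof (rule sum_norm_le)
      fix p assume p: "p \<in> primes_upto z"
      define g where "g m = f m * of_real (F (p * m) / real m)" for m
      have gn: "norm (g m) \<le> 1 / real m" for m
        using mult_mono[OF fn[of m] Fn[of "p * m"]] by (simp add: g_def norm_mult norm_divide divide_right_mono)
      define A where "A = {N div p<..x div p}"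
      have "sum g A - sum g I = sum g (A - I) - sum g (I - A)"
      proof -
        have "sum g A = sum g (A \<inter> I) + sum g (A - I)" using sum.Int_Diff[of A g I] by (simp add: A_def)
        moreover have "sum g I = sum g (I \<inter> A) + sum g (I - A)" using sum.Int_Diff[of I g A] fin by simp
        ultimately show ?thesis by (simp add: Int_commute)
      qed
      also have "norm \<dots> \<le> norm (sum g (A - I)) + norm (sum g (I - A))" by (rule norm_triangle_ineq4)
      also have "\<dots> \<le> lz + lz"
      proof (rule add_mono)
        have "norm (sum g (A - I)) \<le> (\<Sum>m\<in>A - I. 1 / real m)" by (rule sum_norm_le) (rule gn)
        also have "\<dots> \<le> (\<Sum>m\<in>{N div p<..N}. 1 / real m)"
          unfolding A_def I_def by (intro sum_mono2) (auto dest: order.trans[OF _ div_le_dividend])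
        also have "\<dots> \<le> lz" using sum_inverse_interval_div_le[OF p1(1)[OF p], of N] lz0[OF p] by simp
        finally show "norm (sum g (A - I)) \<le> lz" .
        have "norm (sum g (I - A)) \<le> (\<Sum>m\<in>I - A. 1 / real m)" by (rule sum_norm_le) (rule gn)
        also have "\<dots> \<le> (\<Sum>m\<in>{x div p<..x}. 1 / real m)"
          unfolding A_def I_def by (intro sum_mono2) (auto, meson div_le_dividend leD order.trans not_le)
        also have "\<dots> \<le> lz" using sum_inverse_interval_div_le[OF p1(1)[OF p], of x] lz0[OF p] by simp
        finally show "norm (sum g (I - A)) \<le> lz" .
      qed
      finally have d: "norm (sum g A - sum g I) \<le> 2 * lz" by simp
      have "norm (f p * of_real (1 / real p) * sum g A - f p * of_real (1 / real p) * sum g I) = norm (f p) * (1 / real p * norm (sum g A - sum g I))"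
        unfolding right_diff_distrib[symmetric] by (simp add: norm_mult norm_divide)
      also have "\<dots> \<le> 1 * (1 / real p * (2 * lz))" using fn d by (intro mult_mono) auto
      finally show "norm (f p * of_real (1 / real p) * (\<Sum>m\<in>{N div p<..x div p}. f m * of_real (F (p * m) / real m)) -
         f p * of_real (1 / real p) * (\<Sum>m\<in>I. f m * of_real (F (p * m) / real m))) \<le> 1 / real p * (2 * lz)"
        unfolding A_def g_def by simp
    qed
    also have "\<dots> = 2 * L * lz" unfolding L_def sum_distrib_right[symmetric] by simp
    finally show ?thesis .
  qed
  define a where "a p m = f p * of_real (1 / real p) * of_real (F (p * m))" for p m
  have B3: "norm S3 \<le> sqrt (H * (K * L ^ 2 + H * V bad))"
  proof (rule real_le_rsqrt)
    have "S3 = (\<Sum>m\<in>I. f m * of_real (1 / real m) * (\<Sum>p\<in>primes_upto z. a p m))"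
      unfolding S3_def sum_distrib_left a_def by (subst sum.swap) (intro sum.cong refl, simp add: mult_ac)
    then have "norm S3 \<le> (\<Sum>m\<in>I. 1 / real m * norm (\<Sum>p\<in>primes_upto z. a p m))"
    proof (simp only:, intro sum_norm_le)
      fix m
      have "norm (f m * of_real (1 / real m) * (\<Sum>p\<in>primes_upto z. a p m)) = norm (f m) * (1 / real m * norm (\<Sum>p\<in>primes_upto z. a p m))"
        by (simp add: norm_mult norm_divide)
      also have "\<dots> \<le> 1 * (1 / real m * norm (\<Sum>p\<in>primes_upto z. a p m))" using fn by (intro mult_right_mono) auto
      finally show "norm (f m * of_real (1 / real m) * (\<Sum>p\<in>primes_upto z. a p m)) \<le> 1 / real m * norm (\<Sum>p\<in>primes_upto z. a p m)" by simp
    qed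
    then have "norm S3 ^ 2 \<le> (\<Sum>m\<in>I. 1 / real m * norm (\<Sum>p\<in>primes_upto z. a p m)) ^ 2" by (intro power_mono) auto
    also have "\<dots> \<le> (\<Sum>m\<in>I. 1 / real m) * (\<Sum>m\<in>I. 1 / real m * norm (\<Sum>p\<in>primes_upto z. a p m) ^ 2)"
      by (rule weighted_cauchy_schwarz) auto
    also have "\<dots> \<le> H * (K * L ^ 2 + H * V bad)"
    proof (intro mult_mono sumI H0)
      define Q where "Q = (\<Sum>m\<in>I. 1 / real m * norm (\<Sum>p\<in>primes_upto z. a p m) ^ 2)"
      define E where "E p p' = (\<Sum>m\<in>I. F (p * m) * F (p' * m) / real m)" for p p'
      have "complex_of_real Q = (\<Sum>m\<in>I. of_real (1 / real m) * (\<Sum>p\<in>primes_upto z. \<Sum>p'\<in>primes_upto z. a p m * cnj (a p' m)))"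
        unfolding Q_def of_real_sum of_real_mult norm_sum_squared_expand ..
      also have "\<dots> = (\<Sum>m\<in>I. \<Sum>p\<in>primes_upto z. \<Sum>p'\<in>primes_upto z. f p * cnj (f p') * of_real (1 / real p * (1 / real p')) * of_real (F (p * m) * F (p' * m) / real m))"
        unfolding sum_distrib_left a_def by (intro sum.cong refl) (simp add: mult_ac)
      also have "\<dots> = (\<Sum>p\<in>primes_upto z. \<Sum>p'\<in>primes_upto z. \<Sum>m\<in>I. f p * cnj (f p') * of_real (1 / real p * (1 / real p')) * of_real (F (p * m) * F (p' * m) / real m))"
        by (rule trans[OF sum.swap]) (rule sum.cong[OF refl], rule sum.swap)
      also have "\<dots> = (\<Sum>p\<in>primes_upto z. \<Sum>p'\<in>primes_upto z. f p * cnj (f p') * of_real (1 / real p * (1 / real p')) * of_real (E p p'))"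
        unfolding E_def of_real_sum sum_distrib_left ..
      finally have Qeq: "complex_of_real Q = (\<Sum>p\<in>primes_upto z. \<Sum>p'\<in>primes_upto z. f p * cnj (f p') * of_real (1 / real p * (1 / real p')) * of_real (E p p'))" .
      \<comment> \<open>A product of two sines is half the difference of the cosines at p - p' and p
        + p'.\<close>
      have EC: "E p p' = (C (real p - real p') - C (real p + real p')) / 2" for p p'
      proof -
        have "F (p * m) * F (p' * m) / real m = (cos (2 * pi * real m * ((real p - real p') * \<alpha>)) / real m - cos (2 * pi * real m * ((real p + real p') * \<alpha>)) / real m) / 2" for m
        proof -
          have e: "2 * pi * real m * ((real p - real p') * \<alpha>) = 2 * pi * real (p * m) * \<alpha> - 2 * pi * real (p' * m) * \<alpha>"
            "2 * pi * real m * ((real p + real p') * \<alpha>) = 2 * pi * real (p * m) * \<alpha> + 2 * pi * real (p' * m) * \<alpha>"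
            by (simp_all add: algebra_simps)
          show ?thesis unfolding F_def e cos_diff cos_add diff_divide_distrib add_divide_distrib by simp
        qed
        then show ?thesis unfolding E_def C_def I_def sum_subtractf[symmetric] sum_divide_distrib
          by (intro sum.cong refl)
      qed
      have Ebd: "\<bar>E p p'\<bar> \<le> K + (if bad p p' then H else 0)" if p: "p \<in> primes_upto z" "p' \<in> primes_upto z" for p p'
      proof (cases "bad p p'")
        case True
        have "\<bar>E p p'\<bar> \<le> (\<Sum>m\<in>I. \<bar>F (p * m) * F (p' * m) / real m\<bar>)" unfolding E_def by (rule sum_abs)
        also have "\<dots> \<le> (\<Sum>m\<in>I. 1 / real m)"
          using mult_le_one[OF Fn _ Fn] by (intro sum_mono) (simp add: abs_mult divide_right_mono)
        also have "\<dots> \<le> H" by (rule sumI)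
        finally show ?thesis using True K0 by simp
      next
        case False
        then show ?thesis using corr[OF p False] unfolding EC by auto
      qed
      have "Q = norm (complex_of_real Q)" unfolding norm_of_real Q_def by (intro abs_of_nonneg[symmetric] sum_nonneg) auto
      also have "\<dots> \<le> (\<Sum>p\<in>primes_upto z. \<Sum>p'\<in>primes_upto z. 1 / real p * (1 / real p') * (K + (if bad p p' then H else 0)))"
        unfolding Qeq
      proof (intro sum_norm_le)
        fix p p' assume p: "p \<in> primes_upto z" "p' \<in> primes_upto z"
        have "norm (f p * cnj (f p') * of_real (1 / real p * (1 / real p')) * of_real (E p p')) = (norm (f p) * norm (f p')) * (1 / real p * (1 / real p') * \<bar>E p p'\<bar>)"
          by (simp add: norm_mult norm_divide)
        also have "\<dots> \<le> 1 * (1 / real p * (1 / real p') * (K + (if bad p p' then H else 0)))"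
          using fn Ebd[OF p] by (intro mult_mono mult_le_one) auto
        finally show "norm (f p * cnj (f p') * of_real (1 / real p * (1 / real p')) * of_real (E p p')) \<le> 1 / real p * (1 / real p') * (K + (if bad p p' then H else 0))" by simp
      qed
      also have "\<dots> = K * (L * L) + H * V bad"
        unfolding L_def V_def sum_product unfolding sum_distrib_left sum.distrib[symmetric] by (intro sum.cong refl) (simp add: algebra_simps)
      finally show "(\<Sum>m\<in>I. 1 / real m * norm (\<Sum>p\<in>primes_upto z. a p m) ^ 2) \<le> K * L ^ 2 + H * V bad"
        unfolding Q_def by (simp add: power2_eq_square)
    qed (auto intro!: sum_nonneg)
    finally show "norm S3 ^ 2 \<le> H * (K * L ^ 2 + H * V bad)" .
  qed
  have "norm S2 \<le> norm (S2 - S3) + norm S3" by (metis add.commute norm_triangle_sub)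
  then have "L * norm S \<le> sqrt (H * (L * H + 2 * L ^ 2 * lz)) + 2 * L * lz + sqrt (H * (K * L ^ 2 + H * V bad))"
    using LS B1 B2 B3 by linarith
  then show ?thesis by (simp only: S_def I_def F_def)
qed

section \<open>Distances to integers, residue classes and rational frequencies\<close>

lemma abs_sin_pi_ge:
  fixes t :: real
  assumes "\<bar>t\<bar> \<le> 1 / 2"
  shows "\<bar>sin (pi * t)\<bar> \<ge> \<bar>t\<bar>"
proof -
  have main: "sin (pi * t) \<ge> t" if t: "0 \<le> t" "t \<le> 1 / 2" for t :: real
  \<comment> \<open>Up to 1/3 the function sin(\<pi> x) - x has derivative at least \<pi>/2 - 1;
    beyond 1/3, monotonicity of the sine and sin(\<pi>/3) \<ge> 1/2 suffice.\<close>
  proof (cases "t \<le> 1 / 3")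
    case True
    have "sin (pi * 0) - 0 \<le> sin (pi * t) - t"
    proof (rule DERIV_nonneg_imp_nondecreasing[OF t(1)])
      fix x assume x: "0 \<le> x" "x \<le> t"
      have "cos (pi / 3) \<le> cos (pi * x)" using x True by (intro cos_monotone_0_pi_le) auto
      then have "pi * (1 / 2) \<le> pi * cos (pi * x)" by (intro mult_left_mono) (auto simp: cos_60)
      then have "cos (pi * x) * pi - 1 \<ge> 0" using pi_gt3 by (subst mult.commute) linarith
      moreover have "((\<lambda>x. sin (pi * x) - x) has_real_derivative cos (pi * x) * pi - 1) (at x)"
        by (auto intro!: derivative_eq_intros)
      ultimately show "\<exists>y. ((\<lambda>x. sin (pi * x) - x) has_real_derivative y) (at x) \<and> 0 \<le> y" by blast
    qed
    then show ?thesis by simp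
  next
    case False
    have "- (pi / 2) \<le> pi / 3" using pi_gt_zero by linarith
    moreover have "pi / 3 \<le> pi * t" "pi * t \<le> pi / 2" using False t by simp_all
    ultimately have "sin (pi / 3) \<le> sin (pi * t)" by (rule sin_monotone_2pi_le)
    moreover have "sin (pi / 3) \<ge> 1 / 2" by (simp add: sin_60)
    ultimately show ?thesis using t by simp
  qed
  show ?thesis
  proof (cases "t \<ge> 0")
    case True
    then show ?thesis using main[of t] assms by simp
  next
    case False
    then show ?thesis using main[of "- t"] assms by simp
  qed
qed

lemma abs_sin_pi_periodic: "\<bar>sin (pi * (t - of_int k))\<bar> = \<bar>sin (pi * t)\<bar>"
proof -
  have "sin (pi * (t - of_int k)) = sin (pi * t) * cos (pi * of_int k) - cos (pi * t) * sin (pi * of_int k)"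
    by (simp add: right_diff_distrib sin_diff)
  moreover have "sin (pi * of_int k) = 0" by (simp add: sin_zero_iff_int2 mult.commute)
  moreover from this have "\<bar>cos (pi * of_int k)\<bar> = 1" using sin_cos_squared_add[of "pi * of_int k"]
    by (metis add_0 power2_eq_1_iff abs_1 abs_minus_cancel zero_power2)
  ultimately show ?thesis by (simp add: abs_mult)
qed

lemma abs_sin_pi_ge_round: "\<bar>sin (pi * t)\<bar> \<ge> \<bar>t - of_int (round t)\<bar>"
  using abs_sin_pi_ge[of "t - of_int (round t)"] of_int_round_abs_le[of t] abs_sin_pi_periodic[of t "round t"]
  by (simp add: abs_minus_commute)

text \<open>Prime by prime, p^k is at most the square of its totient, except for the prime power 2,
  which costs a factor 2. Making the constant depend on the parity of n lets the induction spend
  this factor only once.\<close>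

lemma totient_square_ge:
  assumes "n > 0"
  shows "n \<le> (if even n then 2 else 1) * totient n ^ 2"
  using assms
proof (induction n rule: less_induct)
  case (less n)
  show ?case
  proof (cases "n = 1")
    case False
    then obtain p where p: "prime p" "p dvd n" using prime_factor_nat by blast
    define k where "k = multiplicity p n"
    obtain m where m: "n = p ^ k * m" "\<not> p dvd m"
      using multiplicity_decompose'[of n p] less.prems p unfolding k_def by (metis not_prime_unit less_numeral_extra(3))
    have k: "k > 0" using p less.prems unfolding k_def by (simp add: prime_multiplicity_gt_zero_iff)
    have m0: "m > 0" using m less.prems by (cases m) auto
    have pk: "p ^ k > 1" using one_less_power[of p k] p k prime_gt_1_nat by blast
    then have "m < n" using m m0 by simp
    then have IH: "m \<le> (if even m then 2 else 1) * totient m ^ 2" using less.IH m0 by blast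
    have "coprime (p ^ k) m" using p(1) m(2) by (simp add: prime_imp_coprime)
    then have t: "totient n = p ^ (k - 1) * (p - 1) * totient m"
      unfolding m(1) by (simp add: totient_mult_coprime totient_prime_power[OF p(1) k])
    have p2: "p \<ge> 2" using p(1) by (rule prime_ge_2_nat)
    have pp: "p ^ k = p ^ (k - 1) * p" using k by (metis Suc_pred' power_Suc2)
    have sq: "p ^ (k - 1) \<le> (p ^ (k - 1)) ^ 2" using p2 by (simp add: self_le_power)
    have bd: "p ^ k \<le> (if p = 2 then 2 else 1) * (p ^ (k - 1) * (p - 1)) ^ 2"
    proof (cases "p = 2")
      case True
      then show ?thesis using sq pp by simp
    next
      case False
      then have p3: "p \<ge> 3" using p2 by simp
      then obtain e where e: "p = e + 3" by (metis le_add_diff_inverse2)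
      have "p \<le> (p - 1) ^ 2" unfolding e by (simp add: power2_eq_square)
      then have "p ^ k \<le> (p ^ (k - 1)) ^ 2 * (p - 1) ^ 2" unfolding pp using sq by (intro mult_mono) auto
      then show ?thesis using False by (simp add: power_mult_distrib)
    qed
    have "n \<le> ((if p = 2 then 2 else 1) * (p ^ (k - 1) * (p - 1)) ^ 2) * ((if even m then 2 else 1) * totient m ^ 2)"
      unfolding m(1) by (intro mult_mono bd IH) auto
    also have "\<dots> = ((if p = 2 then 2 else 1) * (if even m then 2 else 1)) * totient n ^ 2"
      unfolding t by (simp add: power_mult_distrib)
    also have "(if p = 2 then 2 else 1) * (if even m then 2 else 1) \<le> (if even n then 2 else (1::nat))"
    proof (cases "p = 2")
      case True
      then have "odd m" "even n" using m p by auto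
      then show ?thesis using True by simp
    next
      case False
      then have "odd (p ^ k)" using p(1) primes_dvd_imp_eq two_is_prime_nat prime_dvd_power by blast
      then show ?thesis using False m(1) by simp
    qed
    finally show ?thesis by simp
  qed simp
qed

lemma totient_lower: "n > 0 \<Longrightarrow> sqrt (real n / 2) \<le> real (totient n)"
proof -
  assume n: "n > 0"
  have "n \<le> 2 * totient n ^ 2" using totient_square_ge[OF n] by (auto split: if_splits)
  then have "real n \<le> real (2 * totient n ^ 2)" using of_nat_le_iff by blast
  then have "real n / 2 \<le> real (totient n) ^ 2" by simp
  then show ?thesis by (rule real_le_lsqrt[rotated]) auto
qed

text \<open>Members of the class are distinguished by n div r. Quotient 0 occurs at most once and
  contributes at most 1; otherwise n is at least r times its quotient. It serves moduli too large
  for the bound through characters.\<close>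

lemma sum_inverse_residue_class:
  assumes r: "r \<ge> 1"
  shows "(\<Sum>n\<in>{n\<in>{1..z}. [int n = c] (mod int r)}. 1 / real n) \<le> 1 + harm z / real r"
proof -
  define A where "A = {n\<in>{1..z}. [int n = c] (mod int r)}"
  have eq: "n = m" if "n \<in> A" "m \<in> A" "n div r = m div r" for n m
  proof -
    have "[int n = int m] (mod int r)" using that cong_trans cong_sym unfolding A_def by blast
    then have "[n = m] (mod r)" using cong_int_iff by blast
    then have "n mod r = m mod r" unfolding cong_def .
    then show ?thesis using that(3) by (metis div_mult_mod_eq)
  qed
  have fin: "finite A" unfolding A_def by simp
  define A0 where "A0 = {n\<in>A. n div r = 0}"
  define A1 where "A1 = {n\<in>A. n div r \<noteq> 0}"
  have "A = A0 \<union> A1" "A0 \<inter> A1 = {}" unfolding A0_def A1_def by auto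
  then have "(\<Sum>n\<in>A. 1 / real n) = (\<Sum>n\<in>A0. 1 / real n) + (\<Sum>n\<in>A1. 1 / real n)"
    using fin by (metis finite_Un sum.union_disjoint)
  moreover have "(\<Sum>n\<in>A0. 1 / real n) \<le> 1"
  proof (cases "A0 = {}")
    case False
    then obtain n where n: "n \<in> A0" by blast
    have "A0 \<subseteq> {n}"
    proof
      fix m assume "m \<in> A0"
      then have "m = n" using n eq[of m n] unfolding A0_def by simp
      then show "m \<in> {n}" by simp
    qed
    then have "(\<Sum>n\<in>A0. 1 / real n) \<le> (\<Sum>n\<in>{n}. 1 / real n)" by (intro sum_mono2) auto
    also have "\<dots> \<le> 1" using n by (simp add: A0_def A_def)
    finally show ?thesis .
  qed simp
  moreover have "(\<Sum>n\<in>A1. 1 / real n) \<le> harm z / real r"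
  proof -
    have "(\<Sum>n\<in>A1. 1 / real n) \<le> (\<Sum>j\<in>{1..z}. 1 / (real j * real r))"
    \<comment> \<open>The index map is the inverse of n div r on A, well defined by the uniqueness
      shown in \<open>eq\<close>.\<close>
    proof (rule sum_le_included[where i = "\<lambda>j. THE n. n \<in> A \<and> n div r = j"])
      show "\<forall>n\<in>A1. \<exists>j\<in>{1..z}. (THE n. n \<in> A \<and> n div r = j) = n \<and> 1 / real n \<le> 1 / (real j * real r)"
      proof
        fix n assume n: "n \<in> A1"
        have "(THE m. m \<in> A \<and> m div r = n div r) = n" using n eq[of _ n] by (intro the_equality) (auto simp: A1_def)
        moreover have "n div r \<in> {1..z}" using n by (auto simp: A1_def A_def Suc_le_eq intro: order.trans[OF div_le_dividend])
        moreover have "1 / real n \<le> 1 / (real (n div r) * real r)"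
        proof (rule divide_left_mono)
          have "n div r * r \<le> n" by (rule div_times_less_eq_dividend)
          then show "real (n div r) * real r \<le> real n" by (metis of_nat_le_iff of_nat_mult)
          show "0 < real n * (real (n div r) * real r)" using n r by (auto simp: A1_def A_def div_greater_zero_iff)
        qed simp
        ultimately show "\<exists>j\<in>{1..z}. (THE n. n \<in> A \<and> n div r = j) = n \<and> 1 / real n \<le> 1 / (real j * real r)" by blast
      qed
    qed (use fin in \<open>auto simp: A1_def\<close>)
    also have "\<dots> = harm z / real r" unfolding harm_def by (simp add: sum_divide_distrib inverse_eq_divide)
    finally show ?thesis .
  qed
  ultimately show ?thesis unfolding A_def by linarith
qed

text \<open>On integers prime to r the sine is an odd function of the residue, hence a combination
  of odd characters with coefficients bounded by 1; at most r characters exist.\<close>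

lemma norm_character_combination_le:
  assumes r: "r \<ge> 1"
    and E: "\<And>\<xi>. dirichlet_char r \<xi> \<Longrightarrow> \<xi> (-1) = -1 \<Longrightarrow> norm (\<Sum>m\<in>{1..y}. f m * \<xi> (int m) / of_nat m) \<le> E" and E0: "E \<ge> 0"
  shows "norm (\<Sum>m\<in>{m\<in>{1..y}. coprime m r}. f m * of_real (sin (2 * pi * real m * (of_int b / real r)) / real m)) \<le> real r * E"
proof -
  define G where "G n = (if coprime n (int r) then complex_of_real (sin (2 * pi * of_int n * (of_int b / real r))) else 0)" for n
  have per: "G x = G y" if xy: "[x = y] (mod int r)" for x y
  proof -
    obtain k where k: "y = x + int r * k" using xy by (auto simp: cong_iff_lin)
    have "coprime x (int r) = coprime y (int r)" using xy by (metis cong_imp_coprime cong_sym)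
    moreover have "sin (2 * pi * of_int y * (of_int b / real r)) = sin (2 * pi * of_int x * (of_int b / real r))"
    proof -
      have "2 * pi * of_int y * (of_int b / real r) = 2 * pi * of_int x * (of_int b / real r) + 2 * pi * of_int (k * b)"
        unfolding k using r by (simp add: field_simps)
      moreover have "sin (a + 2 * pi * of_int j) = sin a" for a j by (simp add: sin_add cos_int_2pin sin_int_2pin)
      ultimately show ?thesis by (simp only:)
    qed
    ultimately show ?thesis unfolding G_def by simp
  qed
  obtain c where c: "\<And>\<psi>. norm (c \<psi> :: complex) \<le> 1" "\<And>m. G m = (\<Sum>\<psi>\<in>{\<psi>\<in>dchars r. \<psi> (-1) = -1}. c \<psi> * \<psi> m)"
  proof (rule odd_function_expansion[OF r, of G])
    show "G x = G y" if "[x = y] (mod int r)" for x y by (rule per[OF that])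
  qed (auto simp: G_def)
  have "(\<Sum>m\<in>{m\<in>{1..y}. coprime m r}. f m * of_real (sin (2 * pi * real m * (of_int b / real r)) / real m)) = (\<Sum>m\<in>{1..y}. f m * G (int m) / of_nat m)"
    by (rule sum.mono_neutral_cong_left) (auto simp: G_def simp flip: coprime_int_iff)
  also have "\<dots> = (\<Sum>m\<in>{1..y}. \<Sum>\<psi>\<in>{\<psi>\<in>dchars r. \<psi> (-1) = -1}. c \<psi> * (f m * \<psi> (int m) / of_nat m))"
    unfolding c(2) sum_distrib_left sum_divide_distrib by (intro sum.cong refl) simp
  also have "\<dots> = (\<Sum>\<psi>\<in>{\<psi>\<in>dchars r. \<psi> (-1) = -1}. c \<psi> * (\<Sum>m\<in>{1..y}. f m * \<psi> (int m) / of_nat m))"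
    unfolding sum_distrib_left by (rule sum.swap)
  also have "norm \<dots> \<le> (\<Sum>\<psi>\<in>{\<psi>\<in>dchars r. \<psi> (-1) = -1}. 1 * E)"
  proof (rule sum_norm_le)
    fix \<psi> assume "\<psi> \<in> {\<psi>\<in>dchars r. \<psi> (-1) = -1}"
    then have "norm (\<Sum>m\<in>{1..y}. f m * \<psi> (int m) / of_nat m) \<le> E" using E by (simp add: dchars_def)
    then show "norm (c \<psi> * (\<Sum>m\<in>{1..y}. f m * \<psi> (int m) / of_nat m)) \<le> 1 * E"
      unfolding norm_mult by (intro mult_mono c(1)) auto
  qed
  also have "\<dots> = real (card {\<psi>\<in>dchars r. \<psi> (-1) = -1}) * E" by simp
  also have "\<dots> \<le> real r * E"
  proof (intro mult_right_mono E0)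
    have "card {\<psi>\<in>dchars r. \<psi> (-1) = -1} \<le> card (dchars r)" using finite_dchars by (intro card_mono) auto
    also have "\<dots> \<le> r" using card_dchars[OF r] totient_le[of r] by simp
    finally show "real (card {\<psi>\<in>dchars r. \<psi> (-1) = -1}) \<le> real r" by simp
  qed
  finally show ?thesis .
qed

text \<open>Grouping n by g = gcd(n, r) and writing n = g k makes k prime to r / g and turns the
  frequency into b / (r / g). Characters modulo all divisors of r arise; each of the at most r
  divisors costs at most r E.\<close>

lemma rational_sine_sum_bound:
  assumes f: "completely_mult f" and r: "r \<ge> 1"
    and E: "\<And>r' \<xi> y'. r' dvd r \<Longrightarrow> y' \<le> y \<Longrightarrow> dirichlet_char r' \<xi> \<Longrightarrow> \<xi> (-1) = -1 \<Longrightarrow> norm (\<Sum>m\<in>{1..y'}. f m * \<xi> (int m) / of_nat m) \<le> E"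
    and E0: "E \<ge> 0"
  shows "norm (\<Sum>n\<in>{0<..y}. f n * of_real (sin (2 * pi * real n * (of_int b / real r)) / real n)) \<le> real r ^ 2 * E"
proof -
  define t where "t n = f n * of_real (sin (2 * pi * real n * (of_int b / real r)) / real n)" for n
  have fm: "f (m * n) = f m * f n" and fn: "norm (f n) \<le> 1" for m n using f by (auto simp: completely_mult_def)
  have part: "norm (\<Sum>n\<in>{n\<in>{0<..y}. gcd n r = g}. t n) \<le> real r * E" if g: "g dvd r" for g
  proof -
    obtain r' where r': "r = g * r'" using g by blast
    have g1: "g \<ge> 1" and r1: "r' \<ge> 1" using r r' by (auto simp: Suc_le_eq intro!: Nat.gr0I)
    have eqset: "{n\<in>{0<..y}. gcd n r = g} = {n\<in>{n\<in>{0<..y}. g dvd n}. coprime (n div g) r'}"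
    proof -
      have "gcd n r = g \<longleftrightarrow> g dvd n \<and> coprime (n div g) r'" for n
      proof
        assume a: "gcd n r = g"
        then have "g dvd n" by auto
        moreover have "coprime (n div g) (r div g)" using a r by (metis div_gcd_coprime not_one_le_zero)
        ultimately show "g dvd n \<and> coprime (n div g) r'" using r' g1 by simp
      next
        assume a: "g dvd n \<and> coprime (n div g) r'"
        then obtain m where m: "n = g * m" by blast
        then have "coprime m r'" using a g1 by simp
        then show "gcd n r = g" unfolding m r' by (simp add: gcd_mult_distrib_nat[symmetric])
      qed
      then show ?thesis by auto
    qed
    have "(\<Sum>n\<in>{n\<in>{0<..y}. gcd n r = g}. t n) = (\<Sum>n\<in>{n\<in>{0<..y}. g dvd n}. if coprime (n div g) r' then t n else 0)"
      unfolding eqset by (rule sum.inter_filter) simp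
    also have "\<dots> = (\<Sum>k\<in>{0 div g<..y div g}. if coprime (g * k div g) r' then t (g * k) else 0)"
      by (rule sum_multiples[OF g1])
    also have "\<dots> = (\<Sum>k\<in>{1..y div g}. if coprime k r' then t (g * k) else 0)"
      using g1 by (intro sum.cong) auto
    also have "\<dots> = (\<Sum>k\<in>{k\<in>{1..y div g}. coprime k r'}. t (g * k))"
      by (simp only: sum.inter_filter finite_atLeastAtMost)
    also have "\<dots> = (\<Sum>k\<in>{k\<in>{1..y div g}. coprime k r'}. f g / of_nat g * (f k * of_real (sin (2 * pi * real k * (of_int b / real r')) / real k)))"
    proof (rule sum.cong[OF refl])
      fix k
      have "2 * pi * real (g * k) * (of_int b / real r) = 2 * pi * real k * (of_int b / real r')"
        unfolding r' using g1 by simp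
      then show "t (g * k) = f g / of_nat g * (f k * of_real (sin (2 * pi * real k * (of_int b / real r')) / real k))"
        unfolding t_def fm by simp
    qed
    also have "\<dots> = f g / of_nat g * (\<Sum>k\<in>{k\<in>{1..y div g}. coprime k r'}. f k * of_real (sin (2 * pi * real k * (of_int b / real r')) / real k))"
      by (simp only: sum_distrib_left)
    also have "norm \<dots> \<le> 1 * (real r' * E)"
      unfolding norm_mult
    proof (rule mult_mono)
      have "norm (f g) / real g \<le> 1" using fn[of g] g1 by (simp add: divide_le_eq_1)
      then show "norm (f g / of_nat g) \<le> 1" by (simp add: norm_divide)
      show "norm (\<Sum>k\<in>{k\<in>{1..y div g}. coprime k r'}. f k * of_real (sin (2 * pi * real k * (of_int b / real r')) / real k)) \<le> real r' * E"
        by (rule norm_character_combination_le[OF r1 E E0]) (auto simp: r')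
    qed auto
    also have "\<dots> \<le> real r * E"
    proof -
      have "r' \<le> r" unfolding r' using g1 by (cases g) auto
      then have "real r' \<le> real r" by simp
      then show ?thesis using E0 by (simp add: mult_right_mono)
    qed
    finally show ?thesis .
  qed
  define D where "D = {g. g dvd r}"
  have fin: "finite D" unfolding D_def using r by (intro finite_divisors_nat) auto
  have "(\<Sum>n\<in>{0<..y}. t n) = (\<Sum>g\<in>D. \<Sum>n\<in>{n\<in>{0<..y}. gcd n r = g}. t n)"
    by (rule sum.group[symmetric]) (use fin in \<open>auto simp: D_def\<close>)
  also have "norm \<dots> \<le> (\<Sum>g\<in>D. real r * E)" using part by (intro sum_norm_le) (auto simp: D_def)
  also have "\<dots> = real (card D) * (real r * E)" by simp
  also have "\<dots> \<le> real r * (real r * E)"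
  proof (intro mult_right_mono)
    have "D \<subseteq> {1..r}" unfolding D_def using r by (auto dest: dvd_imp_le intro!: Suc_leI Nat.gr0I)
    then have "card D \<le> r" using card_mono[of "{1..r}" D] by simp
    then show "real (card D) \<le> real r" by simp
  qed (use E0 in auto)
  finally show ?thesis unfolding t_def by (simp add: power2_eq_square mult.assoc)
qed

section \<open>Sine sums with multiplicative coefficients\<close>

text \<open>X stands for log q, and z bounds the primes of the bilinear argument.\<close>
definition scales :: "real \<Rightarrow> real \<Rightarrow> real \<Rightarrow> nat \<Rightarrow> bool" where
  "scales X Y Z z \<longleftrightarrow> X \<ge> 1 \<and> Y = ln X \<and> Z = ln Y \<and> Y \<ge> 2 \<and> Z \<ge> 1 \<and> Y \<le> sqrt X \<and>
     ln (1 + sqrt X) + 2 \<le> Y \<and> Y ^ 5 \<le> X \<and> z \<ge> 2 \<and> real z \<le> exp (sqrt X) \<and> Y / 4 \<le> (\<Sum>p\<in>primes_upto z. 1 / real p)"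

text \<open>Each of the three error terms is at most a constant times L X sqrt(Z/Y). The term linear
  in L gains a factor 4/Y from L \<ge> Y/4, and the terms with lz and K gain from Y \<le> sqrt X.
  Here w is the bound for the reciprocal mass of bad partners of one prime.\<close>

lemma katai_numeric:
  fixes X Y Z L S K H lz W w :: real
  assumes X: "X \<ge> 1" and Y: "Y \<ge> 1" "Y \<le> sqrt X" and Z: "Z \<ge> 1" and L: "Y / 4 \<le> L"
    and H: "H = X + 1" and lz: "0 \<le> lz" "lz \<le> 3 * sqrt X" and K: "0 \<le> K" "K \<le> 12 * sqrt X"
    and w: "0 \<le> w" "w \<le> W * (1 + Z)" and W: "W \<ge> 0"
    and LS: "L * S \<le> sqrt (H * (L * H + 2 * L ^ 2 * lz)) + 2 * L * lz + sqrt (H * (K * L ^ 2 + H * (L * w)))"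
  shows "S \<le> (12 + sqrt (24 + 32 * W)) * X * sqrt (Z / Y)"
proof -
  have Lpos: "L > 0" using L Y by linarith
  define D where "D = L * X * sqrt (Z / Y)"
  have Dpos: "D \<ge> 0" unfolding D_def using Lpos X Y Z by simp
  have D2: "D ^ 2 = L ^ 2 * X ^ 2 * (Z / Y)" unfolding D_def using X Y Z by (simp add: power_mult_distrib)
  have H2: "0 \<le> H" "H \<le> 2 * X" using H X by auto
  have XsY: "X * sqrt X \<le> X ^ 2 * (1 / Y)"
  proof -
    have "sqrt X * Y \<le> sqrt X * sqrt X" using X Y by (intro mult_left_mono) auto
    then have "sqrt X * Y \<le> X" using X by simp
    then have "X * (sqrt X * Y) \<le> X * X" using X by (intro mult_left_mono) auto
    then show ?thesis using Y by (simp add: field_simps power2_eq_square)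
  qed
  have YZ: "1 / Y \<le> Z / Y" using Y Z by (intro divide_right_mono) auto
  have LY: "L \<le> L ^ 2 * (4 / Y)"
  proof -
    have "L * (Y / 4) \<le> L * L" using L Lpos by (intro mult_left_mono) auto
    then show ?thesis using Y by (simp add: field_simps power2_eq_square)
  qed
  have HH: "H * H \<le> 4 * X ^ 2" using mult_mono[OF H2(2) H2(2)] H2 X by (simp add: power2_eq_square)
  have t1: "H * (L * H) \<le> 16 * (L ^ 2 * X ^ 2 * (Z / Y))"
  proof -
    have "H * (L * H) = (H * H) * L" by simp
    also have "\<dots> \<le> (4 * X ^ 2) * (L ^ 2 * (4 / Y))" using mult_mono[OF HH LY] Lpos by simp
    also have "\<dots> = 16 * (L ^ 2 * X ^ 2 * (1 / Y))" by simp
    also have "\<dots> \<le> 16 * (L ^ 2 * X ^ 2 * (Z / Y))" using YZ by (intro mult_left_mono) auto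
    finally show ?thesis .
  qed
  have sub: "H * (L ^ 2 * k) \<le> 2 * c * (L ^ 2 * X ^ 2 * (Z / Y))" if "0 \<le> k" "k \<le> c * sqrt X" "0 \<le> c" for k c
  proof -
    have "H * (L ^ 2 * k) \<le> (2 * X) * (L ^ 2 * (c * sqrt X))" using H2 that by (intro mult_mono) auto
    also have "\<dots> = 2 * c * L ^ 2 * (X * sqrt X)" by simp
    also have "\<dots> \<le> 2 * c * L ^ 2 * (X ^ 2 * (1 / Y))" using XsY that by (intro mult_left_mono) auto
    also have "\<dots> \<le> 2 * c * L ^ 2 * (X ^ 2 * (Z / Y))" using YZ that by (intro mult_left_mono) auto
    finally show ?thesis by (simp add: mult_ac)
  qed
  have r1: "H * (L * H + 2 * L ^ 2 * lz) \<le> 28 * D ^ 2"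
  proof -
    have "H * (L * H + 2 * L ^ 2 * lz) = H * (L * H) + 2 * (H * (L ^ 2 * lz))" by (simp add: algebra_simps)
    also have "\<dots> \<le> 16 * (L ^ 2 * X ^ 2 * (Z / Y)) + 2 * (2 * 3 * (L ^ 2 * X ^ 2 * (Z / Y)))"
      using lz by (intro add_mono t1 mult_left_mono[OF sub]) auto
    also have "\<dots> = 28 * D ^ 2" unfolding D2 by simp
    finally show ?thesis .
  qed
  have "sqrt (H * (L * H + 2 * L ^ 2 * lz)) \<le> sqrt (36 * D ^ 2)" using r1 by (intro real_sqrt_le_mono) (smt (verit) zero_le_power2)
  then have s1: "sqrt (H * (L * H + 2 * L ^ 2 * lz)) \<le> 6 * D" using Dpos by (simp add: real_sqrt_mult)
  have s2: "2 * L * lz \<le> 6 * D"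
  proof -
    have "sqrt X * 1 \<le> X * sqrt (Z / Y)"
    proof -
      have "sqrt X \<le> X * (1 / Y)"
      proof -
        have "sqrt X * Y \<le> sqrt X * sqrt X" using X Y by (intro mult_left_mono) auto
        then have "sqrt X * Y \<le> X" using X by simp
        then show ?thesis using Y by (simp add: field_simps)
      qed
      also have "1 / Y \<le> sqrt (Z / Y)"
      proof (rule real_le_rsqrt)
        have "(1 / Y) ^ 2 \<le> 1 / Y" using Y by (simp add: power2_eq_square field_simps)
        then show "(1 / Y) ^ 2 \<le> Z / Y" using YZ by linarith
      qed
      finally show ?thesis using X by (simp add: mult_left_mono)
    qed
    then have "L * (3 * sqrt X) \<le> L * (3 * (X * sqrt (Z / Y)))" using Lpos by (intro mult_left_mono) auto
    moreover have "L * lz \<le> L * (3 * sqrt X)" using Lpos lz by (intro mult_left_mono) auto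
    ultimately show ?thesis unfolding D_def by (simp add: mult_ac)
  qed
  have t3: "H * (H * (L * w)) \<le> 32 * W * (L ^ 2 * X ^ 2 * (Z / Y))"
  proof -
    have "w \<le> W * (2 * Z)" using w Z W by (smt (verit) mult_left_mono)
    then have "(H * H) * (L * w) \<le> (4 * X ^ 2) * ((L ^ 2 * (4 / Y)) * (W * (2 * Z)))"
      by (intro mult_mono[OF HH mult_mono[OF LY]]) (use Lpos w Y in auto)
    then show ?thesis by (simp add: mult_ac)
  qed
  have r3: "H * (K * L ^ 2 + H * (L * w)) \<le> (24 + 32 * W) * D ^ 2"
  proof -
    have "H * (K * L ^ 2 + H * (L * w)) = H * (L ^ 2 * K) + H * (H * (L * w))" by (simp add: algebra_simps)
    also have "\<dots> \<le> 2 * 12 * (L ^ 2 * X ^ 2 * (Z / Y)) + 32 * W * (L ^ 2 * X ^ 2 * (Z / Y))"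
      using K by (intro add_mono t3 sub) auto
    also have "\<dots> = (24 + 32 * W) * D ^ 2" unfolding D2 distrib_right by simp
    finally show ?thesis .
  qed
  have "sqrt (H * (K * L ^ 2 + H * (L * w))) \<le> sqrt ((24 + 32 * W) * D ^ 2)" using r3 by (rule real_sqrt_le_mono)
  then have s3: "sqrt (H * (K * L ^ 2 + H * (L * w))) \<le> sqrt (24 + 32 * W) * D" using Dpos by (simp add: real_sqrt_mult)
  have "L * S \<le> (12 + sqrt (24 + 32 * W)) * D" using LS s1 s2 s3 by (simp add: algebra_simps)
  also have "\<dots> = L * ((12 + sqrt (24 + 32 * W)) * X * sqrt (Z / Y))" unfolding D_def by simp
  finally show ?thesis using Lpos by simp
qed

text \<open>144 is what the count of resonant primes yields: two classes p and -p, each with at most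
  3 (8 + 4 (Z + 4)) = 72 + 12 Z. The final 200 exceeds 12 + sqrt(24 + 32 * 144).\<close>

lemma katai_scaled:
  assumes sc: "scales X Y Z z" and f: "completely_mult f" and hx: "harm x \<le> X + 1"
    and corr: "\<And>p p'. p \<in> primes_upto z \<Longrightarrow> p' \<in> primes_upto z \<Longrightarrow> \<not> bad p p' \<Longrightarrow>
       \<bar>\<Sum>m\<in>{N<..x}. cos (2 * pi * real m * ((real p - real p') * \<alpha>)) / real m\<bar> \<le> sqrt X + 6 \<and>
       \<bar>\<Sum>m\<in>{N<..x}. cos (2 * pi * real m * ((real p + real p') * \<alpha>)) / real m\<bar> \<le> sqrt X + 6"
    and bad: "\<And>p. p \<in> primes_upto z \<Longrightarrow> (\<Sum>p'\<in>primes_upto z. if bad p p' then 1 / real p' else 0) \<le> 144 * (1 + Z)"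
  shows "norm (\<Sum>n\<in>{N<..x}. f n * of_real (sin (2 * pi * real n * \<alpha>) / real n)) \<le> 200 * X * sqrt (Z / Y)"
proof -
  have X: "X \<ge> 1" and Z: "Z \<ge> 1" and Y: "Y \<ge> 2" "Y \<le> sqrt X" and z: "z \<ge> 2" "real z \<le> exp (sqrt X)"
    and L: "Y / 4 \<le> (\<Sum>p\<in>primes_upto z. 1 / real p)"
    using sc by (auto simp: scales_def)
  define L where "L = (\<Sum>p\<in>primes_upto z. 1 / real p)"
  have sX: "sqrt X \<ge> 1" using X by simp
  have "ln (real z) \<le> ln (exp (sqrt X))" using z by (subst ln_le_cancel_iff) auto
  then have lnz: "ln (real z) + 1 \<le> sqrt X + 1" by simp
  define V where "V = (\<Sum>p\<in>primes_upto z. \<Sum>p'\<in>primes_upto z. if bad p p' then 1 / real p * (1 / real p') else 0)"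
  have "V = (\<Sum>p\<in>primes_upto z. 1 / real p * (\<Sum>p'\<in>primes_upto z. if bad p p' then 1 / real p' else 0))"
    unfolding V_def sum_distrib_left by (intro sum.cong refl) simp
  also have "\<dots> \<le> (\<Sum>p\<in>primes_upto z. 1 / real p * (144 * (1 + Z)))"
    using bad by (intro sum_mono mult_left_mono) auto
  also have "\<dots> = L * (144 * (1 + Z))" unfolding L_def sum_distrib_right ..
  finally have V: "V \<le> L * (144 * (1 + Z))" .
  have "L * norm (\<Sum>n\<in>{N<..x}. f n * of_real (sin (2 * pi * real n * \<alpha>) / real n))
     \<le> sqrt ((X + 1) * (L * (X + 1) + 2 * L ^ 2 * (sqrt X + 1))) + 2 * L * (sqrt X + 1) + sqrt ((X + 1) * ((sqrt X + 6) * L ^ 2 + (X + 1) * V))"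
    unfolding L_def V_def using sX by (intro katai_bound[OF f hx lnz] corr) auto
  also have "\<dots> \<le> sqrt ((X + 1) * (L * (X + 1) + 2 * L ^ 2 * (sqrt X + 1))) + 2 * L * (sqrt X + 1) + sqrt ((X + 1) * ((sqrt X + 6) * L ^ 2 + (X + 1) * (L * (144 * (1 + Z)))))"
    using V X by (intro add_left_mono real_sqrt_le_mono mult_left_mono) auto
  finally have "norm (\<Sum>n\<in>{N<..x}. f n * of_real (sin (2 * pi * real n * \<alpha>) / real n)) \<le> (12 + sqrt (24 + 32 * 144)) * X * sqrt (Z / Y)"
    using X Y Z L sX unfolding L_def[symmetric]
    by (intro katai_numeric[where w = "144 * (1 + Z)" and lz = "sqrt X + 1" and K = "sqrt X + 6" and H = "X + 1"]) auto
  also have "\<dots> \<le> 200 * X * sqrt (Z / Y)"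
  proof (intro mult_right_mono)
    have "sqrt (24 + 32 * 144) \<le> sqrt (100 ^ 2)" by (intro real_sqrt_le_mono) simp
    then show "12 + sqrt (24 + 32 * 144) \<le> (200::real)" by simp
  qed (use X Y Z in auto)
  finally show ?thesis .
qed

section \<open>Resonant frequencies\<close>

lemma cos_sum_far:
  fixes h \<alpha> :: real
  assumes sc: "scales X Y Z z" and far: "\<bar>h * \<alpha> - of_int (round (h * \<alpha>))\<bar> \<ge> 1 / (8 * real z)"
  shows "\<bar>\<Sum>m\<in>{N<..x}. cos (2 * pi * real m * (h * \<alpha>)) / real m\<bar> \<le> sqrt X + 6"
proof -
  have z: "z \<ge> 2" "real z \<le> exp (sqrt X)" using sc by (auto simp: scales_def)
  have "\<bar>\<Sum>m\<in>{N<..x}. cos (2 * pi * real m * (h * \<alpha>)) / real m\<bar> \<le> ln (1 / (1 / (8 * real z))) + 3"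
    using far abs_sin_pi_ge_round[of "h * \<alpha>"] z by (intro cos_over_n_bound_log) auto
  also have "ln (1 / (1 / (8 * real z))) = ln 8 + ln (real z)" using z by (simp add: ln_mult)
  also have "ln (real z) \<le> ln (exp (sqrt X))" using z by (subst ln_le_cancel_iff) auto
  also have "ln (8::real) = 3 * ln 2" using ln_realpow[of "2::real" 3] by simp
  also have "\<dots> \<le> 3" using ln_le_minus_one[of "2::real"] by simp
  finally show ?thesis by simp
qed

text \<open>For resonant h and r with nearest integers c and b, the integer h b - r c has absolute
  value at most 4 z / (8 z) = 1/2, so it vanishes. If r and b had a common factor, dividing by it
  would produce a smaller resonant frequency; hence r is prime to b and divides h.\<close>

lemma resonance_divides:
  fixes \<alpha> :: real and z :: nat
  defines "A \<equiv> {h::nat. 1 \<le> h \<and> h \<le> 2 * z \<and> \<bar>real h * \<alpha> - of_int (round (real h * \<alpha>))\<bar> < 1 / (8 * real z)}"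
  assumes r: "r \<in> A" and min: "\<And>h. h \<in> A \<Longrightarrow> r \<le> h" and h: "h \<in> A"
  shows "r dvd h"
proof -
  define b where "b = round (real r * \<alpha>)"
  define c where "c = round (real h * \<alpha>)"
  have r1: "1 \<le> r" "r \<le> 2 * z" "\<bar>real r * \<alpha> - of_int b\<bar> < 1 / (8 * real z)" using r by (auto simp: A_def b_def)
  have h1: "1 \<le> h" "h \<le> 2 * z" "\<bar>real h * \<alpha> - of_int c\<bar> < 1 / (8 * real z)" using h by (auto simp: A_def c_def)
  have z: "real z > 0" using r1 by (cases z) auto
  have "\<bar>of_int (int h * b - int r * c)\<bar> = \<bar>real r * (real h * \<alpha> - of_int c) - real h * (real r * \<alpha> - of_int b)\<bar>"
    by (simp add: algebra_simps)
  also have "\<dots> \<le> real r * \<bar>real h * \<alpha> - of_int c\<bar> + real h * \<bar>real r * \<alpha> - of_int b\<bar>"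
    using abs_triangle_ineq4[of "real r * (real h * \<alpha> - of_int c)" "real h * (real r * \<alpha> - of_int b)"] by (simp add: abs_mult)
  also have "\<dots> \<le> (2 * real z) * (1 / (8 * real z)) + (2 * real z) * (1 / (8 * real z))"
    using r1 h1 by (intro add_mono mult_mono) auto
  also have "\<dots> < 1" using z by simp
  finally have "\<bar>int h * b - int r * c\<bar> < 1" by linarith
  then have eq: "int h * b = int r * c" by simp
  define g where "g = gcd (int r) b"
  have g0: "g > 0" using r1 unfolding g_def by auto
  obtain r' where r': "int r = g * r'" unfolding g_def by (meson dvdE gcd_dvd1)
  obtain b' where b': "b = g * b'" unfolding g_def by (meson dvdE gcd_dvd2)
  have r'pos: "r' > 0" using r' r1 g0 by (metis int_one_le_iff_zero_less of_nat_1 of_nat_le_iff zero_less_mult_pos less_le_trans zero_less_one)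
  have "real_of_int g * \<bar>of_int r' * \<alpha> - of_int b'\<bar> = \<bar>real r * \<alpha> - of_int b\<bar>"
  proof -
    have "real r = of_int g * of_int r'" using r' by (metis of_int_mult of_int_of_nat_eq)
    then have "real r * \<alpha> - of_int b = of_int g * (of_int r' * \<alpha> - of_int b')" unfolding b' by (simp add: algebra_simps)
    then show ?thesis using g0 by (simp add: abs_mult)
  qed
  moreover have "1 * \<bar>of_int r' * \<alpha> - of_int b'\<bar> \<le> real_of_int g * \<bar>of_int r' * \<alpha> - of_int b'\<bar>"
    using g0 by (intro mult_right_mono) auto
  ultimately have "\<bar>of_int r' * \<alpha> - of_int b'\<bar> \<le> \<bar>real r * \<alpha> - of_int b\<bar>" by (simp only: mult_1)
  then have "\<bar>of_int r' * \<alpha> - of_int b'\<bar> < 1 / (8 * real z)" using r1(3) by (rule le_less_trans)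
  moreover have "\<bar>of_int r' * \<alpha> - of_int (round (of_int r' * \<alpha>))\<bar> \<le> \<bar>of_int r' * \<alpha> - of_int b'\<bar>"
    by (rule round_diff_minimal)
  ultimately have close: "\<bar>of_int r' * \<alpha> - of_int (round (of_int r' * \<alpha>))\<bar> < 1 / (8 * real z)"
    by (metis le_less_trans)
  have r'le: "r' \<le> int r" using r' g0 r'pos by (simp add: mult_le_cancel_right1 int_one_le_iff_zero_less)
  have "nat r' \<in> A" using close r'pos r'le r1 unfolding A_def by auto
  then have "r \<le> nat r'" by (rule min)
  then have "int r = r'" using r'le r'pos by linarith
  then have "g = 1" using r' r'pos by simp
  then have "coprime (int r) b" unfolding g_def by (simp add: coprime_iff_gcd_eq_1)
  moreover have "int r dvd int h * b" using eq by simp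
  ultimately have "int r dvd int h" by (simp add: coprime_dvd_mult_left_iff)
  then show ?thesis by simp
qed

text \<open>A partner p' lies in the class of p or -p modulo r. For r > X the trivial count of
  integers suffices; for r up to X and p prime to r, the bound for primes in a class is used, with
  the saving \<open>totient r\<close> \<ge> Y/2 due to r > Y^2; and if p divides r, it divides p',
  so p' = p.\<close>

lemma resonant_primes_sum:
  assumes sc: "scales X Y Z z" and r: "real r > Y ^ 2" and p: "p \<in> primes_upto z"
  shows "(\<Sum>p'\<in>primes_upto z. if int r dvd int p - int p' \<or> int r dvd int p + int p' then 1 / real p' else 0) \<le> 144 * (1 + Z)"
proof -
  have X: "X \<ge> 1" and Z: "Z \<ge> 1" and Y: "Y \<ge> 2" "Y \<le> sqrt X" "Y = ln X" "Z = ln Y" and z: "z \<ge> 2" "real z \<le> exp (sqrt X)"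
    and T: "ln (1 + sqrt X) + 2 \<le> Y"
    using sc by (auto simp: scales_def)
  have sX: "sqrt X \<ge> 1" using X by simp
  have r1: "r \<ge> 1" using r by (cases r) auto
  define B where "B c = (\<Sum>p'\<in>{p'\<in>primes_upto z. [int p' = c] (mod int r)}. 1 / real p')" for c
  have "(\<Sum>p'\<in>primes_upto z. if int r dvd int p - int p' \<or> int r dvd int p + int p' then 1 / real p' else 0)
     \<le> (\<Sum>p'\<in>primes_upto z. (if [int p' = int p] (mod int r) then 1 / real p' else 0) + (if [int p' = - int p] (mod int r) then 1 / real p' else 0))"
  proof (rule sum_mono)
    fix p'
    have "int r dvd int p - int p' \<longleftrightarrow> [int p' = int p] (mod int r)" by (metis cong_iff_dvd_diff cong_sym)
    moreover have "int r dvd int p + int p' \<longleftrightarrow> [int p' = - int p] (mod int r)" by (simp add: cong_iff_dvd_diff add.commute)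
    ultimately show "(if int r dvd int p - int p' \<or> int r dvd int p + int p' then 1 / real p' else 0) \<le>
      (if [int p' = int p] (mod int r) then 1 / real p' else 0) + (if [int p' = - int p] (mod int r) then 1 / real p' else 0)" by auto
  qed
  also have "\<dots> = B (int p) + B (- int p)" unfolding B_def sum.distrib by (simp only: sum.inter_filter finite_primes_upto)
  finally have le: "(\<Sum>p'\<in>primes_upto z. if int r dvd int p - int p' \<or> int r dvd int p + int p' then 1 / real p' else 0) \<le> B (int p) + B (- int p)" .
  consider "real r > X" | "real r \<le> X" "coprime p r" | "\<not> coprime p r" by linarith
  then show ?thesis
  proof cases
    case 1
    have Bc: "B c \<le> 3" for c
    proof -
      have "B c \<le> (\<Sum>n\<in>{n\<in>{1..z}. [int n = c] (mod int r)}. 1 / real n)"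
        unfolding B_def by (intro sum_mono2) (auto simp: primes_upto_def Suc_le_eq prime_gt_0_nat)
      also have "\<dots> \<le> 1 + harm z / real r" by (rule sum_inverse_residue_class[OF r1])
      also have "\<dots> \<le> 1 + 2"
      proof -
        have "ln (real z) \<le> ln (exp (sqrt X))" using z by (subst ln_le_cancel_iff) auto
        then have "harm z \<le> sqrt X + 1" using harm_le_ln[of z] z by simp
        also have "\<dots> \<le> 2 * X" using X sX by (smt (verit) real_sqrt_le_iff real_le_lsqrt self_le_power power2_eq_square mult_le_cancel_left1 real_sqrt_ge_one real_sqrt_mult_self)
        also have "\<dots> \<le> 2 * real r" using 1 by simp
        finally show ?thesis using r1 by (simp add: divide_le_eq)
      qed
      finally show ?thesis by simp
    qed
    have "B (int p) + B (- int p) \<le> 144 * (1 + Z)" using add_mono[OF Bc[of "int p"] Bc[of "- int p"]] Z by simp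
    with le show ?thesis by (rule order.trans)
  next
    case 2
    \<comment> \<open>Since p' is at most exp(sqrt X), the factor p'^(1/sqrt X) is at most e, so
      1/p' \<le> 3 p'^(-s), while 1/(s - 1) is only sqrt X.\<close>
    define s where "s = 1 + 1 / sqrt X"
    have s: "s > 1" "1 / (s - 1) = sqrt X" using sX by (auto simp: s_def)
    have Bc: "B c \<le> 3 * (8 + 4 * (Z + 4))" if c: "coprime c (int r)" for c
    proof -
      have "B c \<le> (\<Sum>p'\<in>{p'\<in>primes_upto z. [int p' = c] (mod int r)}. 3 * real p' powr - s)"
        unfolding B_def
      proof (rule sum_mono)
        fix p' assume "p' \<in> {p'\<in>primes_upto z. [int p' = c] (mod int r)}"
        then have p': "real p' \<ge> 1" "p' \<le> z" by (auto simp: primes_upto_def Suc_le_eq prime_gt_0_nat)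
        have "1 / real p' = real p' powr - s * real p' powr (1 / sqrt X)"
          using p' by (simp add: powr_add[symmetric] s_def powr_minus_divide)
        also have "\<dots> \<le> real p' powr - s * 3"
        proof (intro mult_left_mono)
          have "real p' powr (1 / sqrt X) \<le> exp (sqrt X) powr (1 / sqrt X)"
            using p' z sX by (intro powr_mono2) auto
          also have "\<dots> = exp 1" using sX by (simp add: powr_def)
          also have "\<dots> \<le> 3" by (rule exp_le)
          finally show "real p' powr (1 / sqrt X) \<le> 3" .
        qed auto
        finally show "1 / real p' \<le> 3 * real p' powr - s" by simp
      qed
      also have "\<dots> = 3 * (\<Sum>p'\<in>{p'\<in>primes_upto z. [int p' = c] (mod int r)}. real p' powr - s)" by (simp add: sum_distrib_left)
      also have "\<dots> \<le> 3 * (4 * (ln (1 + sqrt X) + 2) / real (totient r) + 4 * (ln (ln (real r) + 2) + 2))"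
        unfolding s(2)[symmetric] by (intro mult_left_mono prime_sum_residue_class[OF r1 c s(1)]) simp
      also have "\<dots> \<le> 3 * (8 + 4 * (Z + 4))"
      proof (rule mult_left_mono, rule add_mono)
        have "sqrt (real r / 2) \<le> real (totient r)" using totient_lower[of r] r1 by simp
        moreover have "Y / 2 \<le> sqrt (real r / 2)"
        proof (rule real_le_rsqrt)
          show "(Y / 2) ^ 2 \<le> real r / 2" using r by (simp add: power_divide)
        qed
        ultimately have t: "Y / 2 \<le> real (totient r)" by linarith
        have "4 * (ln (1 + sqrt X) + 2) / real (totient r) \<le> 4 * Y / (Y / 2)"
          using T t Y by (intro frac_le) auto
        also have "\<dots> = 8" using Y by simp
        finally show "4 * (ln (1 + sqrt X) + 2) / real (totient r) \<le> 8" .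
        have "ln (real r) \<le> Y" using 2(1) r1 X unfolding Y(3) by simp
        then have "ln (real r) + 2 \<le> 4 * Y" using Y by linarith
        moreover have "ln (real r) \<ge> 0" using r1 by simp
        ultimately have "ln (ln (real r) + 2) \<le> ln (4 * Y)" using Y by (subst ln_le_cancel_iff) auto
        also have "\<dots> = ln 4 + Z" using Y by (simp add: ln_mult)
        also have "ln (4::real) \<le> 2" using ln_realpow[of "2::real" 2] ln_le_minus_one[of "2::real"] by simp
        finally show "4 * (ln (ln (real r) + 2) + 2) \<le> 4 * (Z + 4)" by simp
      qed auto
      finally show ?thesis .
    qed
    have "coprime (int p) (int r)" "coprime (- int p) (int r)" using 2(2) by auto
    then have "B (int p) + B (- int p) \<le> 144 * (1 + Z)" using Bc[of "int p"] Bc[of "- int p"] Z by simp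
    with le show ?thesis by (rule order.trans)
  next
    case 3
    have pp: "prime p" using p by (simp add: primes_upto_def)
    then have pdvd: "p dvd r" using 3 prime_imp_coprime by blast
    have "(\<Sum>p'\<in>primes_upto z. if int r dvd int p - int p' \<or> int r dvd int p + int p' then 1 / real p' else 0) \<le> (\<Sum>p'\<in>primes_upto z. if p' = p then 1 / real p' else 0)"
    proof (rule sum_mono)
      fix p' assume "p' \<in> primes_upto z"
      then have pp': "prime p'" by (simp add: primes_upto_def)
      have "p' = p" if "int r dvd int p - int p' \<or> int r dvd int p + int p'"
      proof -
        have "int p dvd int p - int p' \<or> int p dvd int p + int p'" using that pdvd by (meson dvd_trans int_dvd_int_iff)
        then have "int p dvd int p'" by (metis dvd_add_right_iff dvd_diff_right_iff dvd_refl dvd_minus_iff diff_conv_add_uminus)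
        then show ?thesis using pp pp' primes_dvd_imp_eq by auto
      qed
      then show "(if int r dvd int p - int p' \<or> int r dvd int p + int p' then 1 / real p' else 0) \<le> (if p' = p then 1 / real p' else 0)" by auto
    qed
    also have "\<dots> \<le> 1" using p pp by (simp add: sum.delta prime_gt_0_nat Suc_le_eq)
    also have "\<dots> \<le> 144 * (1 + Z)" using Z by simp
    finally show ?thesis .
  qed
qed

lemma completely_mult_times_dirichlet_char:
  assumes "completely_mult f" "dirichlet_char r \<xi>"
  shows "completely_mult (\<lambda>n. f n * \<xi> (int n))"
  unfolding completely_mult_def
proof (intro conjI allI)
  fix n
  show "norm (f n * \<xi> (int n)) \<le> 1" unfolding norm_mult
    using assms(1) dirichlet_char_norm_le[OF assms(2)] by (intro mult_le_one) (auto simp: completely_mult_def)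
qed (use assms in \<open>auto simp: completely_mult_def dirichlet_char_def\<close>)

lemma abs_sin_diff_le: "\<bar>sin u - sin v\<bar> \<le> \<bar>u - v\<bar>" for u v :: real
proof -
  have "\<bar>sin u - sin v\<bar> = 2 * (\<bar>sin ((u - v) / 2)\<bar> * \<bar>cos ((u + v) / 2)\<bar>)"
    by (simp add: sin_diff_sin abs_mult)
  also have "\<dots> \<le> 2 * (\<bar>(u - v) / 2\<bar> * 1)"
    by (intro mult_left_mono mult_mono abs_sin_x_le_abs_x abs_cos_le_one) auto
  finally show ?thesis by simp
qed

text \<open>These absorb every lower order term into the target X sqrt(Z/Y), which is at least X/Y
  and hence at least Y^4.\<close>

lemma scales_saving:
  assumes sc: "scales X Y Z z"
  shows "1 / Y \<le> sqrt (Z / Y)" "1 \<le> X * sqrt (Z / Y)" "Y ^ 4 \<le> X * sqrt (Z / Y)"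
proof -
  have X: "X \<ge> 1" and Z: "Z \<ge> 1" and Y: "Y \<ge> 2" "Y ^ 5 \<le> X" using sc by (auto simp: scales_def)
  show *: "1 / Y \<le> sqrt (Z / Y)"
  proof (rule real_le_rsqrt)
    have "(1 / Y) ^ 2 \<le> 1 / Y" using Y by (simp add: power2_eq_square field_simps)
    also have "\<dots> \<le> Z / Y" using Y Z by (intro divide_right_mono) auto
    finally show "(1 / Y) ^ 2 \<le> Z / Y" .
  qed
  have "Y ^ 4 \<le> X * (1 / Y)" using Y by (simp add: field_simps eval_nat_numeral)
  also have "\<dots> \<le> X * sqrt (Z / Y)" using * X by (intro mult_left_mono) auto
  finally show Y4: "Y ^ 4 \<le> X * sqrt (Z / Y)" .
  have "1 \<le> Y ^ 4" using Y by (intro one_le_power) auto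
  then show "1 \<le> X * sqrt (Z / Y)" using Y4 by linarith
qed

text \<open>The distance 24 Z yields a gain of exp(-6 Z) = Y^{-6} for logarithmic means, which outweighs the
  trivial loss r^2 \<le> Y^4 from the expansion into characters.\<close>
lemma sine_sum_bound:
  obtains C :: real where "C > 0"
    "\<And>f q x \<alpha> z X Y Z. scales X Y Z z \<Longrightarrow> X = ln (real q) \<Longrightarrow> q \<ge> 3 \<Longrightarrow> x \<le> q \<Longrightarrow> completely_mult f \<Longrightarrow>
      (\<And>r \<xi>. r \<ge> 1 \<Longrightarrow> real r \<le> Y ^ 2 \<Longrightarrow> dirichlet_char r \<xi> \<Longrightarrow> \<xi> (-1) = -1 \<Longrightarrow>
         \<exists>N. 24 * Z \<le> pdist (1 + 1 / X) (\<lambda>n. f n * \<xi> (int n)) N) \<Longrightarrow>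
      norm (\<Sum>n\<in>{0<..x}. f n * of_real (sin (2 * pi * real n * \<alpha>) / real n)) \<le> C * X * sqrt (Z / Y)"
proof -
  obtain C0 where C0: "C0 > 0" and lm: "\<And>f q y N \<Delta>. completely_mult f \<Longrightarrow> q \<ge> 3 \<Longrightarrow> y \<le> q \<Longrightarrow> \<Delta> \<le> pdist (1 + 1 / ln (real q)) f N \<Longrightarrow>
     norm (\<Sum>m\<in>{1..y}. f m / of_nat m) \<le> 1 + C0 * ln (real q) * exp (- \<Delta> / 4)"
    using log_mean_bound by blast
  \<comment> \<open>A sum of 8 (replacing \<alpha> by a fraction), 200 (the bilinear bound) and 1 +
    C0 (the sum at the fraction), rounded up.\<close>
  define C where "C = 210 + C0"
  have "norm (\<Sum>n\<in>{0<..x}. f n * of_real (sin (2 * pi * real n * \<alpha>) / real n)) \<le> C * X * sqrt (Z / Y)"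
    if sc: "scales X Y Z z" and Xq: "X = ln (real q)" and q: "q \<ge> 3" and xq: "x \<le> q" and f: "completely_mult f"
      and np: "\<And>r \<xi>. r \<ge> 1 \<Longrightarrow> real r \<le> Y ^ 2 \<Longrightarrow> dirichlet_char r \<xi> \<Longrightarrow> \<xi> (-1) = -1 \<Longrightarrow>
         \<exists>N. 24 * Z \<le> pdist (1 + 1 / X) (\<lambda>n. f n * \<xi> (int n)) N" for f q x \<alpha> z X Y Z
  proof -
    have X: "X \<ge> 1" and Z: "Z \<ge> 1" "Z = ln Y" and Y: "Y \<ge> 2" and z: "z \<ge> 2"
      using sc by (auto simp: scales_def)
    have sX: "sqrt X \<ge> 1" using X by simp
    define R where "R = X * sqrt (Z / Y)"
    have R0: "R \<ge> 0" using X Y Z by (simp add: R_def)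
    have hx: "harm x \<le> X + 1"
    proof (cases "x \<ge> 1")
      case True
      have "ln (real x) \<le> X" unfolding Xq using True xq by (subst ln_le_cancel_iff) auto
      then show ?thesis using harm_le_ln[OF True] by simp
    qed (use X in \<open>simp add: harm_def\<close>)
    \<comment> \<open>The resonant frequencies among the values |p - p'| and p + p', all at most 2
      z. Outside A the cosine sums are small.\<close>
    define A where "A = {h::nat. 1 \<le> h \<and> h \<le> 2 * z \<and> \<bar>real h * \<alpha> - of_int (round (real h * \<alpha>))\<bar> < 1 / (8 * real z)}"
    define Cs where "Cs N h = (\<Sum>m\<in>{N<..x}. cos (2 * pi * real m * (h * \<alpha>)) / real m)" for N :: nat and h :: real
    have far: "\<bar>Cs N (real h)\<bar> \<le> sqrt X + 6" if "1 \<le> h" "h \<le> 2 * z" "h \<notin> A" for h :: nat and N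
      unfolding Cs_def by (rule cos_sum_far[OF sc]) (use that in \<open>auto simp: A_def\<close>)
    have Csm: "Cs N (- h) = Cs N h" for N h
    proof -
      have "2 * pi * real m * (- h * \<alpha>) = - (2 * pi * real m * (h * \<alpha>))" for m by simp
      then show ?thesis unfolding Cs_def by (simp only: cos_minus)
    qed
    have pairs: "\<bar>Cs N (real p - real p')\<bar> \<le> sqrt X + 6 \<and> \<bar>Cs N (real p + real p')\<bar> \<le> sqrt X + 6"
      if p: "p \<in> primes_upto z" "p' \<in> primes_upto z" "p \<noteq> p'"
        and H: "\<And>h. 1 \<le> h \<Longrightarrow> h \<le> 2 * z \<Longrightarrow>
             int h = int p - int p' \<or> int h = int p' - int p \<or> int h = int p + int p' \<Longrightarrow> \<bar>Cs N (real h)\<bar> \<le> sqrt X + 6" for p p' N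
    proof
      have pz: "1 \<le> p" "p \<le> z" "1 \<le> p'" "p' \<le> z" using p by (auto simp: primes_upto_def Suc_le_eq prime_gt_0_nat)
      have "\<bar>Cs N (real (p + p'))\<bar> \<le> sqrt X + 6" using pz by (intro H) auto
      then show "\<bar>Cs N (real p + real p')\<bar> \<le> sqrt X + 6" by simp
      show "\<bar>Cs N (real p - real p')\<bar> \<le> sqrt X + 6"
      proof (cases "p > p'")
        case True
        have "\<bar>Cs N (real (p - p'))\<bar> \<le> sqrt X + 6" using pz True by (intro H) (auto simp: of_nat_diff)
        then show ?thesis using True by (simp add: of_nat_diff)
      next
        case False
        then have lt: "p < p'" using p(3) by simp
        have "\<bar>Cs N (real (p' - p))\<bar> \<le> sqrt X + 6"
          using pz lt by (intro H) (auto simp: of_nat_diff)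
        then show ?thesis using lt Csm[of N "real p' - real p"] by (simp add: of_nat_diff)
      qed
    qed
    have diag: "(\<Sum>p'\<in>primes_upto z. if p = p' then 1 / real p' else 0) \<le> 144 * (1 + Z)" if p: "p \<in> primes_upto z" for p
    proof -
      have "(\<Sum>p'\<in>primes_upto z. if p = p' then 1 / real p' else 0) = 1 / real p" using p by (simp add: sum.delta')
      also have "\<dots> \<le> 1" using p by (simp add: primes_upto_def Suc_le_eq prime_gt_0_nat)
      finally show ?thesis using Z by simp
    qed
    show ?thesis
    proof (cases "A = {}")
      case True
      have "norm (\<Sum>n\<in>{0<..x}. f n * of_real (sin (2 * pi * real n * \<alpha>) / real n)) \<le> 200 * X * sqrt (Z / Y)"
      proof (rule katai_scaled[OF sc f hx, where bad = "(=)"])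
        fix p p' assume "p \<in> primes_upto z" "p' \<in> primes_upto z" "p \<noteq> p'"
        then show "\<bar>\<Sum>m\<in>{0<..x}. cos (2 * pi * real m * ((real p - real p') * \<alpha>)) / real m\<bar> \<le> sqrt X + 6 \<and>
          \<bar>\<Sum>m\<in>{0<..x}. cos (2 * pi * real m * ((real p + real p') * \<alpha>)) / real m\<bar> \<le> sqrt X + 6"
          using pairs[of p p' 0] far True unfolding Cs_def[symmetric] by blast
      qed (rule diag)
      also have "\<dots> \<le> C * X * sqrt (Z / Y)" unfolding C_def using C0 R0 unfolding R_def mult.assoc by (intro mult_right_mono) auto
      finally show ?thesis .
    next
      case False
      define r where "r = (LEAST h. h \<in> A)"
      have rA: "r \<in> A" unfolding r_def using False by (metis LeastI ex_in_conv)
      have rmin: "r \<le> h" if "h \<in> A" for h unfolding r_def using that by (rule Least_le)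
      have rdvd: "r dvd h" if "h \<in> A" for h
        using resonance_divides[of r z \<alpha> h] rA rmin that unfolding A_def by blast
      have r1: "1 \<le> r" "r \<le> 2 * z" using rA by (auto simp: A_def)
      show ?thesis
      proof (cases "real r > Y ^ 2")
        case True
        have "norm (\<Sum>n\<in>{0<..x}. f n * of_real (sin (2 * pi * real n * \<alpha>) / real n)) \<le> 200 * X * sqrt (Z / Y)"
        \<comment> \<open>By divisibility, a pair can only produce a resonant frequency if r divides
          p - p' or p + p'; since r is large such pairs are rare.\<close>
        proof (rule katai_scaled[OF sc f hx, where bad = "\<lambda>p p'. int r dvd int p - int p' \<or> int r dvd int p + int p'"])
          fix p p' assume p: "p \<in> primes_upto z" "p' \<in> primes_upto z" "\<not> (int r dvd int p - int p' \<or> int r dvd int p + int p')"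
          have "\<bar>Cs 0 (real p - real p')\<bar> \<le> sqrt X + 6 \<and> \<bar>Cs 0 (real p + real p')\<bar> \<le> sqrt X + 6"
          proof (rule pairs)
            show "p \<noteq> p'" using p(3) by auto
            fix h :: nat assume h: "1 \<le> h" "h \<le> 2 * z" "int h = int p - int p' \<or> int h = int p' - int p \<or> int h = int p + int p'"
            have "h \<notin> A"
            proof
              assume "h \<in> A"
              then have "int r dvd int h" using rdvd by simp
              then have "int r dvd int p - int p' \<or> int r dvd int p + int p'" using h(3) by (metis dvd_minus_iff minus_diff_eq)
              then show False using p(3) by blast
            qed
            then show "\<bar>Cs 0 (real h)\<bar> \<le> sqrt X + 6" using far h by blast
          qed (use p in auto)
          then show "\<bar>\<Sum>m\<in>{0<..x}. cos (2 * pi * real m * ((real p - real p') * \<alpha>)) / real m\<bar> \<le> sqrt X + 6 \<and>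
            \<bar>\<Sum>m\<in>{0<..x}. cos (2 * pi * real m * ((real p + real p') * \<alpha>)) / real m\<bar> \<le> sqrt X + 6"
            unfolding Cs_def .
        qed (rule resonant_primes_sum[OF sc True])
        also have "\<dots> \<le> C * X * sqrt (Z / Y)" unfolding C_def using C0 R0 unfolding R_def mult.assoc by (intro mult_right_mono) auto
        finally show ?thesis .
      next
        case rsmall: False
        define b where "b = round (real r * \<alpha>)"
        define \<beta> where "\<beta> = \<alpha> - of_int b / real r"
        have rb: "real r * \<beta> = real r * \<alpha> - of_int b" using r1 unfolding \<beta>_def by (simp add: field_simps)
        have rbs: "\<bar>real r * \<beta>\<bar> < 1 / (8 * real z)" unfolding rb using rA by (simp add: A_def b_def)
        \<comment> \<open>Up to N, about 1/|\<beta>|, the frequency \<alpha> can be replaced by b/r;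
          beyond N even the resonant cosine sums oscillate. For \<beta> = 0 the replacement is exact
          and the second range is made empty by N = x.\<close>
        define N where "N = (if \<beta> = 0 then x else nat \<lfloor>1 / \<bar>\<beta>\<bar>\<rfloor>)"
        have N1: "real N * \<bar>\<beta>\<bar> \<le> 1"
        proof (cases "\<beta> = 0")
          case False
          then have "real N \<le> 1 / \<bar>\<beta>\<bar>" unfolding N_def by simp
          then show ?thesis using False by (simp add: field_simps)
        qed simp
        have N2: "1 \<le> \<bar>\<beta>\<bar> * (real N + 1)" if "\<beta> \<noteq> 0"
        proof -
          have "1 / \<bar>\<beta>\<bar> \<le> real N + 1" unfolding N_def using that by simp
          then show ?thesis using that by (simp add: field_simps)
        qed
        have upper: "norm (\<Sum>n\<in>{N<..x}. f n * of_real (sin (2 * pi * real n * \<alpha>) / real n)) \<le> 200 * X * sqrt (Z / Y)"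
        proof (rule katai_scaled[OF sc f hx, where bad = "(=)"])
          fix p p' assume p: "p \<in> primes_upto z" "p' \<in> primes_upto z" "p \<noteq> p'"
          have "\<bar>Cs N (real p - real p')\<bar> \<le> sqrt X + 6 \<and> \<bar>Cs N (real p + real p')\<bar> \<le> sqrt X + 6"
          proof (rule pairs[OF p])
            fix h :: nat assume h: "1 \<le> h" "h \<le> 2 * z"
            show "\<bar>Cs N (real h)\<bar> \<le> sqrt X + 6"
            proof (cases "h \<in> A")
              case hA: True
              show ?thesis
              proof (cases "\<beta> = 0")
                case True
                then have "N = x" by (simp add: N_def)
                then show ?thesis using sX by (simp add: Cs_def)
              next
                case \<beta>0: False
                obtain k where k: "h = r * k" using rdvd[OF hA] by blast
                have hb: "real h * \<beta> = real h * \<alpha> - of_int (int k * b)"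
                  unfolding \<beta>_def k using r1 by (simp add: field_simps)
                have "\<bar>real h * \<beta>\<bar> \<le> 1 / 2"
                proof -
                  have "\<bar>\<beta>\<bar> \<le> real r * \<bar>\<beta>\<bar>" using mult_right_mono[of 1 "real r" "\<bar>\<beta>\<bar>"] r1 by simp
                  then have "\<bar>\<beta>\<bar> \<le> 1 / (8 * real z)" using rbs by (simp add: abs_mult)
                  then have "real h * \<bar>\<beta>\<bar> \<le> (2 * real z) * (1 / (8 * real z))" using h by (intro mult_mono) auto
                  also have "\<dots> \<le> 1 / 2" using z by simp
                  finally show ?thesis by (simp add: abs_mult)
                qed
                \<comment> \<open>h \<alpha> differs from h \<beta> by an integer because r divides
                  h. As |h \<beta>| \<le> 1/2, the sine is at least h |\<beta>|, and starting after
                  N makes the cosine sum at most 1.\<close>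
                then have "\<bar>real h * \<beta>\<bar> \<le> \<bar>sin (pi * (real h * \<beta>))\<bar>" by (rule abs_sin_pi_ge)
                also have "\<dots> = \<bar>sin (pi * (real h * \<alpha>))\<bar>" unfolding hb by (rule abs_sin_pi_periodic)
                finally have s1: "\<bar>real h * \<beta>\<bar> \<le> \<bar>sin (pi * (real h * \<alpha>))\<bar>" .
                have "1 * \<bar>\<beta>\<bar> \<le> real h * \<bar>\<beta>\<bar>" using h by (intro mult_right_mono) auto
                then have s2: "\<bar>\<beta>\<bar> \<le> \<bar>sin (pi * (real h * \<alpha>))\<bar>" using s1 by (simp add: abs_mult)
                have "\<bar>Cs N (real h)\<bar> \<le> 1 / (\<bar>sin (pi * (real h * \<alpha>))\<bar> * (real N + 1))"
                  unfolding Cs_def using s2 \<beta>0 by (intro cos_over_n_bound) auto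
                also have "\<dots> \<le> 1 / 1"
                proof (intro divide_left_mono)
                  have "\<bar>\<beta>\<bar> * (real N + 1) \<le> \<bar>sin (pi * (real h * \<alpha>))\<bar> * (real N + 1)" using s2 by (intro mult_right_mono) auto
                  then show "1 \<le> \<bar>sin (pi * (real h * \<alpha>))\<bar> * (real N + 1)" using N2[OF \<beta>0] by linarith
                  then show "0 < \<bar>sin (pi * (real h * \<alpha>))\<bar> * (real N + 1) * 1" by linarith
                qed auto
                finally show ?thesis using sX by linarith
              qed
            qed (use far h in blast)
          qed
          then show "\<bar>\<Sum>m\<in>{N<..x}. cos (2 * pi * real m * ((real p - real p') * \<alpha>)) / real m\<bar> \<le> sqrt X + 6 \<and>
            \<bar>\<Sum>m\<in>{N<..x}. cos (2 * pi * real m * ((real p + real p') * \<alpha>)) / real m\<bar> \<le> sqrt X + 6"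
            unfolding Cs_def .
        qed (rule diag)
        define y where "y = min N x"
        have yq: "y \<le> q" using xq by (simp add: y_def)
        define E where "E = 1 + C0 * X * exp (- 24 * Z / 4)"
        have E0: "E \<ge> 0" unfolding E_def using C0 X by simp
        have rational: "norm (\<Sum>n\<in>{0<..y}. f n * of_real (sin (2 * pi * real n * (of_int b / real r)) / real n)) \<le> real r ^ 2 * E"
        proof (rule rational_sine_sum_bound[OF f r1(1) _ E0])
          fix r' \<xi> y' assume a: "r' dvd r" "y' \<le> y" "dirichlet_char r' \<xi>" "\<xi> (-1) = -1"
          have r': "r' \<ge> 1" using a(3) by (simp add: dirichlet_char_def)
          have "r' \<le> r" using a(1) r1 by (intro dvd_imp_le) auto
          then have "real r' \<le> real r" by simp
          then have "real r' \<le> Y ^ 2" using rsmall by linarith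
          from np[OF r' this a(3,4)] obtain M where M: "24 * Z \<le> pdist (1 + 1 / X) (\<lambda>n. f n * \<xi> (int n)) M" by blast
          have "norm (\<Sum>m\<in>{1..y'}. f m * \<xi> (int m) / of_nat m) \<le> 1 + C0 * ln (real q) * exp (- (24 * Z) / 4)"
            using M a yq unfolding Xq by (intro lm[OF completely_mult_times_dirichlet_char[OF f a(3)] q]) auto
          then show "norm (\<Sum>m\<in>{1..y'}. f m * \<xi> (int m) / of_nat m) \<le> E" by (simp add: E_def Xq)
        qed
        \<comment> \<open>Replacing \<alpha> by b/r changes each sine by at most 2 \<pi> n
          |\<beta>|; dividing by n leaves a constant, and there are at most 1/|\<beta>|
          terms.\<close>
        have lowdiff: "norm ((\<Sum>n\<in>{0<..y}. f n * of_real (sin (2 * pi * real n * \<alpha>) / real n)) -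
           (\<Sum>n\<in>{0<..y}. f n * of_real (sin (2 * pi * real n * (of_int b / real r)) / real n))) \<le> 8"
        proof -
          have "norm (\<Sum>n\<in>{0<..y}. f n * of_real (sin (2 * pi * real n * \<alpha>) / real n) - f n * of_real (sin (2 * pi * real n * (of_int b / real r)) / real n)) \<le> (\<Sum>n\<in>{0<..y}. 2 * pi * \<bar>\<beta>\<bar>)"
          proof (rule sum_norm_le)
            fix n assume n: "n \<in> {0<..y}"
            have "norm (f n * of_real (sin (2 * pi * real n * \<alpha>) / real n) - f n * of_real (sin (2 * pi * real n * (of_int b / real r)) / real n))
               = norm (f n) * (\<bar>sin (2 * pi * real n * \<alpha>) - sin (2 * pi * real n * (of_int b / real r))\<bar> / real n)"
              unfolding right_diff_distrib[symmetric] of_real_diff[symmetric] diff_divide_distrib[symmetric] norm_mult norm_of_real by simp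
            also have "\<dots> \<le> 1 * (\<bar>2 * pi * real n * \<alpha> - 2 * pi * real n * (of_int b / real r)\<bar> / real n)"
              using f by (intro mult_mono divide_right_mono abs_sin_diff_le) (auto simp: completely_mult_def)
            also have "2 * pi * real n * \<alpha> - 2 * pi * real n * (of_int b / real r) = 2 * pi * real n * \<beta>"
              unfolding \<beta>_def by (simp add: algebra_simps)
            also have "1 * (\<bar>2 * pi * real n * \<beta>\<bar> / real n) = 2 * pi * \<bar>\<beta>\<bar>" using n by (simp add: abs_mult)
            finally show "norm (f n * of_real (sin (2 * pi * real n * \<alpha>) / real n) - f n * of_real (sin (2 * pi * real n * (of_int b / real r)) / real n)) \<le> 2 * pi * \<bar>\<beta>\<bar>" .
          qed
          also have "\<dots> = 2 * pi * (real y * \<bar>\<beta>\<bar>)" by simp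
          also have "\<dots> \<le> 2 * pi * 1"
          proof (intro mult_left_mono)
            have "real y * \<bar>\<beta>\<bar> \<le> real N * \<bar>\<beta>\<bar>" unfolding y_def by (intro mult_right_mono) auto
            then show "real y * \<bar>\<beta>\<bar> \<le> 1" using N1 by linarith
          qed auto
          also have "\<dots> \<le> 8" using pi_less_4 by simp
          finally show ?thesis unfolding sum_subtractf .
        qed
        have rE: "real r ^ 2 * E \<le> (1 + C0) * R"
        proof -
          have "exp (- 24 * Z / 4) = 1 / Y ^ 6"
          proof -
            have "exp (- 24 * Z / 4) = inverse (exp Z ^ 6)" by (simp add: exp_of_nat_mult[symmetric] exp_minus[symmetric])
            also have "exp Z = Y" using Z Y by simp
            finally show ?thesis by (simp add: inverse_eq_divide)
          qed
          then have Eeq: "E = 1 + C0 * X / Y ^ 6" by (simp add: E_def)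
          have "real r ^ 2 \<le> (Y ^ 2) ^ 2" using rsmall by (intro power_mono) auto
          then have "real r ^ 2 * E \<le> Y ^ 4 * E" using E0 by (intro mult_right_mono) auto
          also have "\<dots> = Y ^ 4 + C0 * (X * (1 / Y ^ 2))" unfolding Eeq using Y by (simp add: field_simps eval_nat_numeral)
          also have "\<dots> \<le> R + C0 * R"
          proof (intro add_mono mult_left_mono)
            show "Y ^ 4 \<le> R" using scales_saving(3)[OF sc] by (simp add: R_def)
            have "1 / Y ^ 2 \<le> 1 / Y" using Y by (simp add: field_simps power2_eq_square)
            then have "1 / Y ^ 2 \<le> sqrt (Z / Y)" using scales_saving(1)[OF sc] by linarith
            then show "X * (1 / Y ^ 2) \<le> R" unfolding R_def using X by (intro mult_left_mono) auto
          qed (use C0 in auto)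
          finally show ?thesis by (simp add: algebra_simps)
        qed
        have split: "(\<Sum>n\<in>{0<..x}. f n * of_real (sin (2 * pi * real n * \<alpha>) / real n)) =
           (\<Sum>n\<in>{0<..y}. f n * of_real (sin (2 * pi * real n * \<alpha>) / real n)) + (\<Sum>n\<in>{N<..x}. f n * of_real (sin (2 * pi * real n * \<alpha>) / real n))"
        proof -
          have "{0<..x} = {0<..y} \<union> {N<..x}" unfolding y_def by auto
          moreover have "{0<..y} \<inter> {N<..x} = {}" unfolding y_def by auto
          ultimately show ?thesis by (simp only: sum.union_disjoint finite_greaterThanAtMost)
        qed
        have "norm (\<Sum>n\<in>{0<..y}. f n * of_real (sin (2 * pi * real n * \<alpha>) / real n)) \<le> 8 + (1 + C0) * R"
          using norm_triangle_sub[of "\<Sum>n\<in>{0<..y}. f n * of_real (sin (2 * pi * real n * \<alpha>) / real n)"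
             "\<Sum>n\<in>{0<..y}. f n * of_real (sin (2 * pi * real n * (of_int b / real r)) / real n)"] lowdiff rational rE by linarith
        then have "norm (\<Sum>n\<in>{0<..x}. f n * of_real (sin (2 * pi * real n * \<alpha>) / real n)) \<le> (8 + (1 + C0) * R) + 200 * X * sqrt (Z / Y)"
          unfolding split by (intro order.trans[OF norm_triangle_ineq] add_mono upper)
        also have "\<dots> = 8 * 1 + (201 + C0) * R" unfolding R_def by (simp add: algebra_simps)
        also have "\<dots> \<le> 8 * R + (201 + C0) * R" using scales_saving(2)[OF sc] unfolding R_def by simp
        also have "\<dots> \<le> C * R" unfolding C_def using R0 by (simp add: distrib_right)
        finally show ?thesis by (simp add: R_def mult.assoc)
      qed
    qed
  qed
  note main = this
  have "C > 0" using C0 by (simp add: C_def)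
  then show ?thesis by (rule that[OF _ main])
qed

section \<open>Polya's Fourier expansion\<close>

lemma sum_cis_residues:
  assumes q: "q \<ge> 1"
  shows "(\<Sum>n<q. cis (2 * pi * (of_int c / real q)) ^ n) = (if int q dvd c then of_nat q else 0)"
proof -
  define w where "w = cis (2 * pi * (of_int c / real q))"
  have w1: "w = 1 \<longleftrightarrow> int q dvd c"
  proof
    assume "w = 1"
    then have "cos (2 * pi * (of_int c / real q)) = 1" by (simp add: w_def complex_eq_iff)
    then obtain k :: int where "2 * pi * (of_int c / real q) = of_int k * 2 * pi" unfolding cos_one_2pi_int by blast
    then have "(2 * pi) * (of_int c / real q) = (2 * pi) * of_int k" by (simp only: mult.commute mult.left_commute)
    then have "of_int c / real q = of_int k" by (simp only: mult_cancel_left) simp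
    then have "real_of_int c = of_int (int q * k)" using q by (simp add: field_simps)
    then have "c = int q * k" by (simp only: of_int_eq_iff)
    then show "int q dvd c" by simp
  next
    assume "int q dvd c"
    then obtain k where "c = int q * k" by blast
    then have "w = cis (2 * pi * of_int k)" using q by (simp add: w_def)
    then show "w = 1" by (simp add: cis_multiple_2pi)
  qed
  have "real q * (2 * pi * (of_int c / real q)) = 2 * pi * of_int c" using q by simp
  then have "w ^ q = cis (2 * pi * of_int c)" unfolding w_def Complex.DeMoivre by (simp only:)
  then have wq: "w ^ q = 1" by (simp add: cis_multiple_2pi)
  show ?thesis
  proof (cases "int q dvd c")
    case True
    then show ?thesis unfolding w_def[symmetric] using w1 by simp
  next
    case False
    then have "w \<noteq> 1" using w1 by simp
    then show ?thesis unfolding w_def[symmetric] using False wq by (simp add: geometric_sum)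
  qed
qed

lemma cis_residue_cong:
  assumes "q \<ge> 1" "[a = b] (mod int q)"
  shows "cis (2 * pi * (of_int a / real q)) = cis (2 * pi * (of_int b / real q))"
proof -
  obtain k where k: "b = a + int q * k" using assms(2) by (auto simp: cong_iff_lin)
  have "2 * pi * (of_int b / real q) = 2 * pi * (of_int a / real q) + 2 * pi * of_int k"
    unfolding k using assms(1) by (simp add: field_simps)
  then show ?thesis by (simp add: cis_mult[symmetric] cis_multiple_2pi)
qed

section \<open>Gauss sums\<close>

definition gauss_sum :: "nat \<Rightarrow> (int \<Rightarrow> complex) \<Rightarrow> int \<Rightarrow> complex" where
  "gauss_sum q \<psi> n = (\<Sum>a\<in>{0..<int q}. \<psi> a * cis (2 * pi * (of_int (a * n) / real q)))"

text \<open>For n prime to q substitute n a for a. Since q is prime, the only other case is q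
  dividing n, where the exponentials are 1 and the full character sum vanishes.\<close>

lemma gauss_sum_eq:
  assumes \<psi>: "dirichlet_char q \<psi>" and np: "\<psi> \<noteq> dprinc q" and q: "prime q"
  shows "gauss_sum q \<psi> n = cnj (\<psi> n) * gauss_sum q \<psi> 1"
proof (cases "coprime n (int q)")
  case True
  have q1: "q \<ge> 1" using \<psi> by (simp add: dirichlet_char_def)
  have "\<psi> n * gauss_sum q \<psi> n = (\<Sum>a\<in>{0..<int q}. \<psi> (n * a) * cis (2 * pi * (of_int (n * a) / real q)))"
    using \<psi> unfolding gauss_sum_def sum_distrib_left dirichlet_char_def by (intro sum.cong refl) (simp add: mult_ac)
  also have "\<dots> = gauss_sum q \<psi> 1" unfolding gauss_sum_def mult_1_right
  proof (rule sum_residues_dilate[where F = "\<lambda>a. \<psi> a * cis (2 * pi * (of_int a / real q))", OF _ True q1])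
    fix x y assume xy: "[x = y] (mod int q)"
    show "\<psi> x * cis (2 * pi * (of_int x / real q)) = \<psi> y * cis (2 * pi * (of_int y / real q))"
      by (simp only: dirichlet_char_cong[OF \<psi> xy] cis_residue_cong[OF q1 xy])
  qed
  finally have *: "\<psi> n * gauss_sum q \<psi> n = gauss_sum q \<psi> 1" .
  have "cnj (\<psi> n) * \<psi> n = 1" using dirichlet_char_norm[OF \<psi>, of n] True
    by (simp add: complex_norm_square[symmetric] mult.commute)
  then have "cnj (\<psi> n) * (\<psi> n * gauss_sum q \<psi> n) = gauss_sum q \<psi> n" by (simp add: mult.assoc[symmetric])
  then show ?thesis using * by simp
next
  case False
  have q1: "q \<ge> 1" using \<psi> by (simp add: dirichlet_char_def)
  then have "int q dvd n" using False q prime_imp_coprime[of "int q" n] by (auto simp: coprime_commute)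
  then obtain k where k: "n = int q * k" by blast
  have "cis (2 * pi * (of_int (a * n) / real q)) = 1" for a
  proof -
    have "2 * pi * (of_int (a * n) / real q) = 2 * pi * of_int (a * k)" unfolding k using q1 by simp
    then show ?thesis by (simp only: cis_multiple_2pi Ints_of_int)
  qed
  then have "gauss_sum q \<psi> n = (\<Sum>a\<in>{0..<int q}. \<psi> a)" unfolding gauss_sum_def by simp
  also have "\<dots> = 0" using nonprincipal_witness[OF \<psi> np] sum_residues_nonprincipal[OF \<psi>] by blast
  finally show ?thesis using False \<psi> by (simp add: dirichlet_char_def)
qed

text \<open>Parseval: the sum of |G(n)|^2 over residues n is q (q - 1), while separability makes it
  (q - 1) |G(1)|^2.\<close>

lemma norm_gauss_sum:
  assumes \<psi>: "dirichlet_char q \<psi>" and np: "\<psi> \<noteq> dprinc q" and q: "prime q"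
  shows "norm (gauss_sum q \<psi> 1) = sqrt (real q)"
proof -
  define g where "g = gauss_sum q \<psi> 1"
  have q1: "q \<ge> 1" and q2: "q \<ge> 2" using prime_ge_1_nat[OF q] prime_ge_2_nat[OF q] by auto
  have sumsq: "(\<Sum>a\<in>{0..<int q}. norm (\<psi> a) ^ 2) = real q - 1"
  proof -
    have "(\<Sum>a\<in>{0..<int q}. norm (\<psi> a) ^ 2) = (\<Sum>a\<in>{0..<int q}. if coprime a (int q) then 1 else 0)"
      by (intro sum.cong refl) (simp add: dirichlet_char_norm[OF \<psi>])
    also have "\<dots> = real (card {a\<in>{0..<int q}. coprime a (int q)})" by (subst sum.inter_filter[symmetric]) auto
    also have "\<dots> = real q - 1" using card_coprime_residues[OF q1] totient_prime[OF q] q1 by (simp add: of_nat_diff)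
    finally show ?thesis .
  qed
  have gterm: "gauss_sum q \<psi> (int n) = (\<Sum>a\<in>{0..<int q}. \<psi> a * cis (2 * pi * (of_int a / real q)) ^ n)" for n
    unfolding gauss_sum_def Complex.DeMoivre by (intro sum.cong refl) (simp add: mult_ac)
  have "complex_of_real (\<Sum>n<q. norm (gauss_sum q \<psi> (int n)) ^ 2) =
     (\<Sum>n<q. \<Sum>a\<in>{0..<int q}. \<Sum>b\<in>{0..<int q}. \<psi> a * cnj (\<psi> b) * cis (2 * pi * (of_int (a - b) / real q)) ^ n)"
    unfolding of_real_sum
  proof (rule sum.cong[OF refl])
    fix n
    have "cis (2 * pi * (of_int a / real q)) ^ n * cnj (cis (2 * pi * (of_int b / real q)) ^ n) = cis (2 * pi * (of_int (a - b) / real q)) ^ n" for a b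
      unfolding complex_cnj_power cis_cnj power_mult_distrib[symmetric] cis_mult by (simp add: diff_divide_distrib algebra_simps)
    then have "\<psi> a * cis (2 * pi * (of_int a / real q)) ^ n * cnj (\<psi> b * cis (2 * pi * (of_int b / real q)) ^ n) =
       \<psi> a * cnj (\<psi> b) * cis (2 * pi * (of_int (a - b) / real q)) ^ n" for a b
      by (metis (no_types, lifting) complex_cnj_mult mult.assoc mult.left_commute)
    then show "complex_of_real (norm (gauss_sum q \<psi> (int n)) ^ 2) = (\<Sum>a\<in>{0..<int q}. \<Sum>b\<in>{0..<int q}. \<psi> a * cnj (\<psi> b) * cis (2 * pi * (of_int (a - b) / real q)) ^ n)"
      unfolding gterm norm_sum_squared_expand by (simp only:)
  qed
  also have "\<dots> = (\<Sum>a\<in>{0..<int q}. \<Sum>b\<in>{0..<int q}. \<psi> a * cnj (\<psi> b) * (\<Sum>n<q. cis (2 * pi * (of_int (a - b) / real q)) ^ n))"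
    unfolding sum_distrib_left by (rule trans[OF sum.swap]) (rule sum.cong[OF refl], rule sum.swap)
  also have "\<dots> = (\<Sum>a\<in>{0..<int q}. \<Sum>b\<in>{0..<int q}. if b = a then of_nat q * of_real (norm (\<psi> a) ^ 2) else 0)"
  proof (intro sum.cong refl)
    fix a b assume ab: "a \<in> {0..<int q}" "b \<in> {0..<int q}"
    have "int q dvd a - b \<longleftrightarrow> b = a"
    proof
      assume "int q dvd a - b"
      then have "a mod int q = b mod int q" by (simp add: mod_eq_dvd_iff)
      then show "b = a" using ab by simp
    qed simp
    then show "\<psi> a * cnj (\<psi> b) * (\<Sum>n<q. cis (2 * pi * (of_int (a - b) / real q)) ^ n) = (if b = a then of_nat q * of_real (norm (\<psi> a) ^ 2) else 0)"
      unfolding sum_cis_residues[OF q1] complex_norm_square by simp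
  qed
  also have "\<dots> = (\<Sum>a\<in>{0..<int q}. of_nat q * of_real (norm (\<psi> a) ^ 2))" by (intro sum.cong refl) (simp add: sum.delta)
  also have "\<dots> = complex_of_real (real q * (\<Sum>a\<in>{0..<int q}. norm (\<psi> a) ^ 2))"
    by (simp only: of_real_mult of_real_sum sum_distrib_left of_real_of_nat_eq)
  finally have "(\<Sum>n<q. norm (gauss_sum q \<psi> (int n)) ^ 2) = real q * (real q - 1)" unfolding sumsq of_real_eq_iff .
  moreover have "(\<Sum>n<q. norm (gauss_sum q \<psi> (int n)) ^ 2) = (real q - 1) * norm g ^ 2"
  proof -
    have "(\<Sum>n<q. norm (gauss_sum q \<psi> (int n)) ^ 2) = (\<Sum>n<q. norm (\<psi> (int n)) ^ 2 * norm g ^ 2)"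
      unfolding g_def by (subst gauss_sum_eq[OF assms]) (simp add: norm_mult power_mult_distrib)
    also have "\<dots> = (\<Sum>n<q. norm (\<psi> (int n)) ^ 2) * norm g ^ 2" by (rule sum_distrib_right[symmetric])
    also have "(\<Sum>n<q. norm (\<psi> (int n)) ^ 2) = (\<Sum>a\<in>{0..<int q}. norm (\<psi> a) ^ 2)"
      by (rule sum.reindex_bij_witness[where i = nat and j = int]) auto
    finally show ?thesis using sumsq by simp
  qed
  ultimately have "(real q - 1) * norm g ^ 2 = (real q - 1) * real q" by (simp add: mult.commute)
  then have "norm g ^ 2 = real q" using q2 by simp
  then show ?thesis unfolding g_def[symmetric] by (metis norm_ge_zero real_sqrt_unique)
qed

text \<open>Separability for the conjugate character writes \<psi>(n) times a Gauss sum of norm sqrt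
  q as a finite Fourier series in n.\<close>

lemma character_sum_fourier:
  assumes \<psi>: "dirichlet_char q \<psi>" and np: "\<psi> \<noteq> dprinc q" and q: "prime q"
  shows "sqrt (real q) * norm (\<Sum>n\<in>{1..t}. \<psi> (int n)) = norm (\<Sum>a\<in>{1..<int q}. cnj (\<psi> a) * (\<Sum>n\<in>{1..t}. cis (2 * pi * (of_int a * real n / real q))))"
proof -
  define \<psi>' where "\<psi>' n = cnj (\<psi> n)" for n
  have \<psi>': "dirichlet_char q \<psi>'" unfolding \<psi>'_def by (rule dirichlet_char_cnj[OF \<psi>])
  have np': "\<psi>' \<noteq> dprinc q"
  proof
    assume "\<psi>' = dprinc q"
    then have "cnj (\<psi> n) = dprinc q n" for n unfolding \<psi>'_def by metis
    then have "\<psi> n = cnj (dprinc q n)" for n by (metis complex_cnj_cnj)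
    then have "\<psi> = dprinc q" by (auto simp: fun_eq_iff dprinc_def)
    then show False using np by simp
  qed
  have q1: "q \<ge> 1" by (rule prime_ge_1_nat[OF q])
  have p0: "\<psi> 0 = 0" using \<psi> q by (auto simp: dirichlet_char_def)
  have "gauss_sum q \<psi>' 1 * (\<Sum>n\<in>{1..t}. \<psi> (int n)) = (\<Sum>n\<in>{1..t}. gauss_sum q \<psi>' (int n))"
    unfolding sum_distrib_left by (intro sum.cong refl) (subst (2) gauss_sum_eq[OF \<psi>' np' q], simp add: \<psi>'_def)
  also have "\<dots> = (\<Sum>a\<in>{0..<int q}. cnj (\<psi> a) * (\<Sum>n\<in>{1..t}. cis (2 * pi * (of_int a * real n / real q))))"
    unfolding gauss_sum_def sum_distrib_left \<psi>'_def by (rule trans[OF sum.swap]) simp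
  also have "{0..<int q} = insert 0 {1..<int q}" using q1 by auto
  also have "(\<Sum>a\<in>insert 0 {1..<int q}. cnj (\<psi> a) * (\<Sum>n\<in>{1..t}. cis (2 * pi * (of_int a * real n / real q)))) =
    (\<Sum>a\<in>{1..<int q}. cnj (\<psi> a) * (\<Sum>n\<in>{1..t}. cis (2 * pi * (of_int a * real n / real q))))"
    using p0 by (subst sum.insert) auto
  finally have "norm (gauss_sum q \<psi>' 1 * (\<Sum>n\<in>{1..t}. \<psi> (int n))) = norm (\<Sum>a\<in>{1..<int q}. cnj (\<psi> a) * (\<Sum>n\<in>{1..t}. cis (2 * pi * (of_int a * real n / real q))))"
    by simp
  then show ?thesis unfolding norm_mult norm_gauss_sum[OF \<psi>' np' q] .
qed

lemma M_char_le:
  assumes "q \<ge> 1" "\<And>t. norm (\<Sum>n\<in>{1..t}. \<psi> (int n)) \<le> B"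
  shows "M_char q \<psi> \<le> B"
  unfolding M_char_def using assms by (subst Max_le_iff) auto

lemma norm_cis_sum_le:
  assumes "sin (pi * \<theta>) \<noteq> 0"
  shows "norm (\<Sum>n\<in>{1..t}. cis (2 * pi * (real n * \<theta>))) \<le> 1 / \<bar>sin (pi * \<theta>)\<bar>"
proof -
  define w where "w = cis (2 * pi * \<theta>)"
  have wn: "norm (1 - w) = 2 * \<bar>sin (pi * \<theta>)\<bar>"
  proof -
    have "norm (1 - w) ^ 2 = (1 - cos (2 * (pi * \<theta>))) ^ 2 + sin (2 * (pi * \<theta>)) ^ 2"
      by (simp add: w_def cmod_power2 mult_ac)
    also have "\<dots> = 2 - 2 * cos (2 * (pi * \<theta>))"
      using sin_cos_squared_add[of "2 * (pi * \<theta>)"] by (simp add: power2_diff)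
    also have "\<dots> = (2 * \<bar>sin (pi * \<theta>)\<bar>) ^ 2" by (simp add: cos_double_sin power_mult_distrib)
    finally show ?thesis by (rule power2_eq_imp_eq) auto
  qed
  then have w1: "w \<noteq> 1" using assms by auto
  have "(\<Sum>n\<in>{1..t}. cis (2 * pi * (real n * \<theta>))) = (\<Sum>n\<in>{1..t}. w ^ n)"
  proof (rule sum.cong[OF refl])
    fix n
    have "2 * pi * (real n * \<theta>) = real n * (2 * pi * \<theta>)" by simp
    then show "cis (2 * pi * (real n * \<theta>)) = w ^ n" by (simp only: w_def Complex.DeMoivre)
  qed
  also have "\<dots> = (\<Sum>n<t. w * w ^ n)"
    by (rule sum.reindex_bij_witness[where i = Suc and j = "\<lambda>n. n - 1"])
       (auto simp flip: power_Suc)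
  also have "\<dots> = w * (\<Sum>n<t. w ^ n)" by (rule sum_distrib_left[symmetric])
  also have "(\<Sum>n<t. w ^ n) = (1 - w ^ t) / (1 - w)" using w1 by (simp add: sum_gp_strict)
  finally have "norm (\<Sum>n\<in>{1..t}. cis (2 * pi * (real n * \<theta>))) = norm (1 - w ^ t) / norm (1 - w)"
    by (simp add: norm_mult norm_divide w_def)
  also have "\<dots> \<le> 2 / norm (1 - w)"
    using norm_triangle_ineq4[of 1 "w ^ t"] by (intro divide_right_mono) (auto simp: w_def norm_power)
  also have "\<dots> = 1 / \<bar>sin (pi * \<theta>)\<bar>" unfolding wn by simp
  finally show ?thesis .
qed

lemma sum_int_interval_nat: "(\<Sum>a\<in>{1..<int q}. F a) = (\<Sum>a\<in>{1..<q}. F (int a))"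
  by (rule sum.reindex_bij_witness[where i = int and j = nat]) auto

text \<open>1/|sin(\<pi> a/q)| is at most q/a for a up to q/2 and q/(q - a) above. The sum of both
  bounds covers either half and adds up to at most 2 q (ln q + 1).\<close>

lemma polya_vinogradov:
  assumes \<psi>: "dirichlet_char q \<psi>" and np: "\<psi> \<noteq> dprinc q" and q: "prime q"
  shows "M_char q \<psi> \<le> 2 * sqrt (real q) * (ln (real q) + 1)"
proof (rule M_char_le)
  show q1: "q \<ge> 1" by (rule prime_ge_1_nat[OF q])
  fix t
  have inv: "1 / \<bar>sin (pi * (real a / real q))\<bar> \<le> real q / real a + real q / real (q - a)" and nz: "sin (pi * (real a / real q)) \<noteq> 0"
    if a: "a \<in> {1..<q}" for a
  proof -
    have apos: "real a > 0" "real (q - a) > 0" using a by auto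
    have "sin (pi * (real a / real q)) \<noteq> 0 \<and> 1 / \<bar>sin (pi * (real a / real q))\<bar> \<le> real q / real a + real q / real (q - a)"
    proof (cases "real a / real q \<le> 1 / 2")
      case True
      have s: "real a / real q \<le> \<bar>sin (pi * (real a / real q))\<bar>" using abs_sin_pi_ge[of "real a / real q"] True by simp
      have pos: "real a / real q > 0" using a by simp
      have "1 / \<bar>sin (pi * (real a / real q))\<bar> \<le> 1 / (real a / real q)" by (rule frac_le[OF _ _ pos s]) auto
      then have "1 / \<bar>sin (pi * (real a / real q))\<bar> \<le> real q / real a" by simp
      moreover have "real q / real (q - a) \<ge> 0" by simp
      ultimately have "1 / \<bar>sin (pi * (real a / real q))\<bar> \<le> real q / real a + real q / real (q - a)" by (rule add_increasing2[rotated])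
      moreover have "sin (pi * (real a / real q)) \<noteq> 0" by (rule zero_less_abs_iff[THEN iffD1, OF less_le_trans[OF pos s]])
      ultimately show ?thesis by blast
    next
      case False
      have e: "real (q - a) / real q = 1 - real a / real q" using a by (simp add: of_nat_diff field_simps)
      have "\<bar>sin (pi * (real a / real q - of_int 1))\<bar> = \<bar>sin (pi * (real a / real q))\<bar>" by (rule abs_sin_pi_periodic)
      moreover have "\<bar>real a / real q - of_int 1\<bar> = real (q - a) / real q" unfolding e using a by (simp add: field_simps)
      moreover have "real (q - a) / real q \<le> 1 / 2" unfolding e using False by simp
      ultimately have s: "real (q - a) / real q \<le> \<bar>sin (pi * (real a / real q))\<bar>"
        using abs_sin_pi_ge[of "real a / real q - of_int 1"] by simp
      have pos: "real (q - a) / real q > 0" using a by simp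
      have "1 / \<bar>sin (pi * (real a / real q))\<bar> \<le> 1 / (real (q - a) / real q)" by (rule frac_le[OF _ _ pos s]) auto
      then have "1 / \<bar>sin (pi * (real a / real q))\<bar> \<le> real q / real (q - a)" by simp
      moreover have "real q / real a \<ge> 0" by simp
      ultimately have "1 / \<bar>sin (pi * (real a / real q))\<bar> \<le> real q / real a + real q / real (q - a)" by (rule add_increasing[rotated])
      moreover have "sin (pi * (real a / real q)) \<noteq> 0" by (rule zero_less_abs_iff[THEN iffD1, OF less_le_trans[OF pos s]])
      ultimately show ?thesis by blast
    qed
    then show "1 / \<bar>sin (pi * (real a / real q))\<bar> \<le> real q / real a + real q / real (q - a)" "sin (pi * (real a / real q)) \<noteq> 0" by auto
  qed
  have "sqrt (real q) * norm (\<Sum>n\<in>{1..t}. \<psi> (int n)) \<le> (\<Sum>a\<in>{1..<q}. real q / real a + real q / real (q - a))"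
    unfolding character_sum_fourier[OF assms] sum_int_interval_nat
  proof (rule sum_norm_le)
    fix a assume a: "a \<in> {1..<q}"
    have "norm (\<Sum>n\<in>{1..t}. cis (2 * pi * (of_int (int a) * real n / real q))) \<le> 1 / \<bar>sin (pi * (real a / real q))\<bar>"
      using norm_cis_sum_le[OF nz[OF a], of t] by (simp add: mult_ac)
    also note inv[OF a]
    finally have "norm (cnj (\<psi> (int a))) * norm (\<Sum>n\<in>{1..t}. cis (2 * pi * (of_int (int a) * real n / real q))) \<le> 1 * (real q / real a + real q / real (q - a))"
      using dirichlet_char_norm_le[OF \<psi>] by (intro mult_mono) auto
    then show "norm (cnj (\<psi> (int a)) * (\<Sum>n\<in>{1..t}. cis (2 * pi * (of_int (int a) * real n / real q)))) \<le> real q / real a + real q / real (q - a)"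
      unfolding norm_mult by simp
  qed
  also have "\<dots> = (\<Sum>a\<in>{1..<q}. real q / real a) + (\<Sum>a\<in>{1..<q}. real q / real (q - a))" by (rule sum.distrib)
  also have "(\<Sum>a\<in>{1..<q}. real q / real (q - a)) = (\<Sum>a\<in>{1..<q}. real q / real a)"
    by (rule sum.reindex_bij_witness[where i = "\<lambda>a. q - a" and j = "\<lambda>a. q - a"]) auto
  finally have "sqrt (real q) * norm (\<Sum>n\<in>{1..t}. \<psi> (int n)) \<le> (\<Sum>a\<in>{1..<q}. real q / real a) + (\<Sum>a\<in>{1..<q}. real q / real a)" .
  moreover have "(\<Sum>a\<in>{1..<q}. real q / real a) \<le> real q * (ln (real q) + 1)"
  proof -
    have "(\<Sum>a\<in>{1..<q}. real q / real a) \<le> real q * harm q"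
      unfolding harm_def sum_distrib_left by (simp only: inverse_eq_divide times_divide_eq_right mult_1_right) (intro sum_mono2, auto)
    also have "\<dots> \<le> real q * (ln (real q) + 1)" using harm_le_ln[OF q1] by (intro mult_left_mono) auto
    finally show ?thesis .
  qed
  ultimately have fin: "sqrt (real q) * norm (\<Sum>n\<in>{1..t}. \<psi> (int n)) \<le> real q * (ln (real q) + 1) + real q * (ln (real q) + 1)"
    by linarith
  have "sqrt (real q) * (2 * sqrt (real q) * (ln (real q) + 1)) = 2 * (sqrt (real q) * sqrt (real q)) * (ln (real q) + 1)"
    by (simp only: mult_ac)
  also have "\<dots> = real q * (ln (real q) + 1) + real q * (ln (real q) + 1)" by simp
  finally have "sqrt (real q) * norm (\<Sum>n\<in>{1..t}. \<psi> (int n)) \<le> sqrt (real q) * (2 * sqrt (real q) * (ln (real q) + 1))"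
    using fin by (simp only:)
  then show "norm (\<Sum>n\<in>{1..t}. \<psi> (int n)) \<le> 2 * sqrt (real q) * (ln (real q) + 1)" using q1 by simp
qed

text \<open>The error is at most \<pi>^2 u \<le> 8, by x - sin x \<le> x^3 and sin(\<pi> u) \<ge> u.
  It is bounded near 0, which permits replacing the Fourier coefficients by the coefficients 1/n of
  the sine sums.\<close>

lemma inverse_sin_approx:
  fixes u :: real
  assumes u: "0 < u" "u \<le> 1 / 2"
  shows "\<bar>1 / sin (pi * u) - 1 / (pi * u)\<bar> \<le> 8"
proof -
  define x where "x = pi * u"
  have x: "0 < x" "x \<le> pi / 2" unfolding x_def using u by auto
  have s: "sin x \<ge> u" using abs_sin_pi_ge[of u] u sin_ge_zero[of x] x unfolding x_def by auto
  have sx: "sin x \<le> x" using x sin_x_le_x by simp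
  have cx: "x - sin x \<le> x ^ 3"
  proof -
    have "sin 0 - 0 + 0 ^ 3 \<le> sin x - x + x ^ 3"
    proof (rule DERIV_nonneg_imp_nondecreasing[where f = "\<lambda>x. sin x - x + x ^ 3" and a = 0 and b = x])
      show "0 \<le> x" using x by simp
      fix y :: real assume y: "0 \<le> y" "y \<le> x"
      have "1 - cos y = 2 * sin (y / 2) ^ 2" using cos_double_sin[of "y / 2"] by simp
      also have "sin (y / 2) ^ 2 \<le> (y / 2) ^ 2"
        using abs_sin_x_le_abs_x[of "y / 2"] by (simp only: abs_le_square_iff)
      finally have "0 \<le> cos y - 1 + 3 * y ^ 2" by (simp add: power_divide) (smt (verit) zero_le_power2)
      moreover have "((\<lambda>x. sin x - x + x ^ 3) has_real_derivative cos y - 1 + 3 * y ^ 2) (at y)"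
        by (auto intro!: derivative_eq_intros)
      ultimately show "\<exists>d. ((\<lambda>x. sin x - x + x ^ 3) has_real_derivative d) (at y) \<and> 0 \<le> d" by blast
    qed
    then show ?thesis by simp
  qed
  have "1 / sin x - 1 / x = (x - sin x) / (sin x * x)" using s u x by (simp add: field_simps)
  also have "\<dots> \<le> x ^ 3 / (u * x)" using cx s u x sx by (intro frac_le mult_right_mono) auto
  also have "\<dots> = pi * pi * u" unfolding x_def using u by (simp add: power3_eq_cube)
  also have "\<dots> \<le> 4 * 4 * (1 / 2)" using u pi_less_4 pi_gt_zero by (intro mult_mono) auto
  finally have "1 / sin x - 1 / x \<le> 8" by simp
  moreover have "1 / sin x - 1 / x \<ge> 0" using s u x sx by (simp add: frac_le)
  ultimately show ?thesis unfolding x_def by simp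
qed

text \<open>Evenness pairs a with q - a, so the geometric sums combine to twice a cosine sum, that
  is, a Dirichlet kernel sin(2 \<pi> a \<alpha>) / sin(\<pi> a/q) - 1. The constant -1 drops out,
  and replacing 1/sin by its leading term leaves the sine sums bounded by B.\<close>

lemma polya_even:
  assumes \<psi>: "dirichlet_char q \<psi>" and np: "\<psi> \<noteq> dprinc q" and q: "prime q" "q \<ge> 3" and even: "\<psi> (-1) = 1"
    and S: "\<And>\<alpha>. norm (\<Sum>n\<in>{0<..(q - 1) div 2}. cnj (\<psi> (int n)) * of_real (sin (2 * pi * real n * \<alpha>) / real n)) \<le> B"
  shows "M_char q \<psi> \<le> sqrt (real q) * (B + 8)"
proof (rule M_char_le)
  show q1: "q \<ge> 1" using q by simp
  fix t
  define h where "h = (q - 1) div 2"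
  have oddq: "odd q" using q prime_odd_nat by fastforce
  have qh: "q = 2 * h + 1" using oddq unfolding h_def by (auto elim: oddE)
  \<comment> \<open>The frequency for which (2 t + 1) \<pi> a / q, the argument in the Dirichlet
    kernel, equals 2 \<pi> a \<alpha>.\<close>
  define \<alpha> where "\<alpha> = (2 * real t + 1) / (2 * real q)"
  define D where "D a = (\<Sum>n\<in>{1..t}. cis (2 * pi * (real a * real n / real q)))" for a :: nat
  define F where "F a = cnj (\<psi> (int a)) * D a" for a
  have ev: "\<psi> (int (q - a)) = \<psi> (int a)" if "a \<le> q" for a
  proof -
    have "\<psi> (int (q - a)) = \<psi> (- int a)"
      using that by (intro dirichlet_char_cong[OF \<psi>]) (simp add: cong_iff_dvd_diff of_nat_diff)
    also have "\<dots> = \<psi> (int a)" using dirichlet_char_uminus[OF \<psi>, of "int a"] even by simp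
    finally show ?thesis .
  qed
  have Dc: "D a + D (q - a) = of_real (sin (2 * pi * real a * \<alpha>) / sin (pi * (real a / real q)) - 1)" if a: "a \<in> {0<..h}" for a
  proof -
    have aq: "a \<le> q" "real (q - a) = real q - real a" using a qh by (auto simp: of_nat_diff)
    have "D (q - a) = (\<Sum>n\<in>{1..t}. cnj (cis (2 * pi * (real a * real n / real q))))"
      unfolding D_def
    proof (rule sum.cong[OF refl])
      fix n
      have "cis (2 * pi * (of_int (int (q - a) * int n) / real q)) = cis (2 * pi * (of_int (- (int a * int n)) / real q))"
        using aq by (intro cis_residue_cong[OF q1]) (simp add: cong_iff_dvd_diff of_nat_diff algebra_simps)
      then show "cis (2 * pi * (real (q - a) * real n / real q)) = cnj (cis (2 * pi * (real a * real n / real q)))"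
        by (simp add: cis_cnj)
    qed
    then have "D a + D (q - a) = (\<Sum>n\<in>{1..t}. cis (2 * pi * (real a * real n / real q)) + cnj (cis (2 * pi * (real a * real n / real q))))"
      unfolding D_def by (simp add: sum.distrib)
    also have "\<dots> = of_real (2 * (\<Sum>n\<in>{1..t}. cos (2 * pi * real n * (real a / real q))))"
      unfolding complex_add_cnj by (simp add: sum_distrib_left mult_ac)
    also have "2 * (\<Sum>n\<in>{1..t}. cos (2 * pi * real n * (real a / real q))) = sin (2 * pi * real a * \<alpha>) / sin (pi * (real a / real q)) - 1"
    proof -
      define \<theta> where "\<theta> = real a / real q"
      have nz: "sin (pi * \<theta>) \<noteq> 0"
      proof -
        have "\<theta> > 0" "\<theta> \<le> 1 / 2" unfolding \<theta>_def using a qh by (auto simp: field_simps)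
        then show ?thesis using abs_sin_pi_ge[of \<theta>] by auto
      qed
      have "2 * sin (pi * \<theta>) * (\<Sum>n\<in>{1..m}. cos (2 * pi * real n * \<theta>)) = sin ((2 * real m + 1) * pi * \<theta>) - sin (pi * \<theta>)" for m
      proof (induction m)
        case (Suc m)
        have "(2 * real (Suc m) + 1) * pi * \<theta> = 2 * pi * real (Suc m) * \<theta> + pi * \<theta>"
          "(2 * real m + 1) * pi * \<theta> = 2 * pi * real (Suc m) * \<theta> - pi * \<theta>" by (simp_all add: algebra_simps)
        then have "2 * sin (pi * \<theta>) * cos (2 * pi * real (Suc m) * \<theta>) = sin ((2 * real (Suc m) + 1) * pi * \<theta>) - sin ((2 * real m + 1) * pi * \<theta>)"
          by (simp only: sin_add sin_diff) (simp add: algebra_simps)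
        moreover have "(\<Sum>n\<in>{1..Suc m}. cos (2 * pi * real n * \<theta>)) = (\<Sum>n\<in>{1..m}. cos (2 * pi * real n * \<theta>)) + cos (2 * pi * real (Suc m) * \<theta>)" by simp
        ultimately show ?case using Suc by (simp only: distrib_left)
      qed simp
      from this[of t] have "2 * (\<Sum>n\<in>{1..t}. cos (2 * pi * real n * \<theta>)) = (sin ((2 * real t + 1) * pi * \<theta>) - sin (pi * \<theta>)) / sin (pi * \<theta>)"
        using nz by (simp add: field_simps)
      moreover have "(2 * real t + 1) * pi * \<theta> = 2 * pi * real a * \<alpha>" unfolding \<theta>_def \<alpha>_def using q1 by (simp add: field_simps)
      ultimately show ?thesis unfolding \<theta>_def[symmetric] using nz by (simp add: diff_divide_distrib)
    qed
    finally show ?thesis .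
  qed
  have half: "(\<Sum>a\<in>{1..<q}. G a) = (\<Sum>a\<in>{0<..h}. G a + G (q - a))" for G :: "nat \<Rightarrow> complex"
  proof -
    have "{1..<q} = {0<..h} \<union> {h<..<q}" using qh by auto
    moreover have "{0<..h} \<inter> {h<..<q} = {}" by auto
    ultimately have "(\<Sum>a\<in>{1..<q}. G a) = (\<Sum>a\<in>{0<..h}. G a) + (\<Sum>a\<in>{h<..<q}. G a)"
      by (simp only: sum.union_disjoint finite_greaterThanAtMost finite_greaterThanLessThan)
    also have "(\<Sum>a\<in>{h<..<q}. G a) = (\<Sum>a\<in>{0<..h}. G (q - a))"
      by (rule sum.reindex_bij_witness[where i = "\<lambda>a. q - a" and j = "\<lambda>a. q - a"]) (use qh in auto)
    finally show ?thesis by (simp add: sum.distrib)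
  qed
  \<comment> \<open>By evenness the half sum is half of the full character sum, which is 0.\<close>
  have zero: "(\<Sum>a\<in>{0<..h}. cnj (\<psi> (int a))) = 0"
  proof -
    have "(\<Sum>a\<in>{0..<int q}. \<psi> a) = 0" using nonprincipal_witness[OF \<psi> np] sum_residues_nonprincipal[OF \<psi>] by blast
    moreover have "{0..<int q} = insert 0 {1..<int q}" using q1 by auto
    moreover have "\<psi> 0 = 0" using \<psi> q by (auto simp: dirichlet_char_def)
    ultimately have "(\<Sum>a\<in>{1..<int q}. \<psi> a) = 0" by simp
    then have "(\<Sum>a\<in>{0<..h}. \<psi> (int a) + \<psi> (int (q - a))) = 0" unfolding sum_int_interval_nat half .
    moreover have "(\<Sum>a\<in>{0<..h}. \<psi> (int a) + \<psi> (int (q - a))) = 2 * (\<Sum>a\<in>{0<..h}. \<psi> (int a))"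
      unfolding sum_distrib_left using ev qh by (intro sum.cong refl) simp
    ultimately have "(\<Sum>a\<in>{0<..h}. \<psi> (int a)) = 0" by simp
    then show ?thesis by (metis cnj_sum complex_cnj_zero)
  qed
  have "(\<Sum>a\<in>{1..<q}. F a) = (\<Sum>a\<in>{0<..h}. cnj (\<psi> (int a)) * of_real (sin (2 * pi * real a * \<alpha>) / sin (pi * (real a / real q)) - 1))"
    unfolding half
  proof (rule sum.cong[OF refl])
    fix a assume a: "a \<in> {0<..h}"
    have "F a + F (q - a) = cnj (\<psi> (int a)) * (D a + D (q - a))" unfolding F_def using ev[of a] a qh by (simp add: distrib_left)
    then show "F a + F (q - a) = cnj (\<psi> (int a)) * of_real (sin (2 * pi * real a * \<alpha>) / sin (pi * (real a / real q)) - 1)"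
      unfolding Dc[OF a] .
  qed
  also have "\<dots> = (\<Sum>a\<in>{0<..h}. cnj (\<psi> (int a)) * of_real (sin (2 * pi * real a * \<alpha>) / sin (pi * (real a / real q)))) - (\<Sum>a\<in>{0<..h}. cnj (\<psi> (int a)))"
    unfolding sum_subtractf[symmetric] by (intro sum.cong refl) (simp add: algebra_simps)
  also have "\<dots> = (\<Sum>a\<in>{0<..h}. cnj (\<psi> (int a)) * of_real (sin (2 * pi * real a * \<alpha>) * (1 / (pi * (real a / real q)))))
     + (\<Sum>a\<in>{0<..h}. cnj (\<psi> (int a)) * of_real (sin (2 * pi * real a * \<alpha>) * (1 / sin (pi * (real a / real q)) - 1 / (pi * (real a / real q)))))"
    unfolding zero sum.distrib[symmetric] diff_0_right by (intro sum.cong refl) (simp add: algebra_simps)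
  finally have Feq: "(\<Sum>a\<in>{1..<q}. F a) = \<dots>" .
  have m1: "norm (\<Sum>a\<in>{0<..h}. cnj (\<psi> (int a)) * of_real (sin (2 * pi * real a * \<alpha>) * (1 / (pi * (real a / real q))))) \<le> real q * B"
  proof -
    have "(\<Sum>a\<in>{0<..h}. cnj (\<psi> (int a)) * of_real (sin (2 * pi * real a * \<alpha>) * (1 / (pi * (real a / real q))))) =
       of_real (real q / pi) * (\<Sum>n\<in>{0<..h}. cnj (\<psi> (int n)) * of_real (sin (2 * pi * real n * \<alpha>) / real n))"
      unfolding sum_distrib_left by (intro sum.cong refl) (simp add: field_simps)
    then have "norm (\<Sum>a\<in>{0<..h}. cnj (\<psi> (int a)) * of_real (sin (2 * pi * real a * \<alpha>) * (1 / (pi * (real a / real q))))) =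
       (real q / pi) * norm (\<Sum>n\<in>{0<..h}. cnj (\<psi> (int n)) * of_real (sin (2 * pi * real n * \<alpha>) / real n))"
      by (simp add: norm_mult norm_divide)
    also have "\<dots> \<le> real q * B"
    proof (rule mult_mono)
      have "real q / pi \<le> real q / 1" using pi_gt3 by (intro divide_left_mono) auto
      then show "real q / pi \<le> real q" by simp
      show "norm (\<Sum>n\<in>{0<..h}. cnj (\<psi> (int n)) * of_real (sin (2 * pi * real n * \<alpha>) / real n)) \<le> B" unfolding h_def by (rule S)
    qed auto
    finally show ?thesis .
  qed
  have m2: "norm (\<Sum>a\<in>{0<..h}. cnj (\<psi> (int a)) * of_real (sin (2 * pi * real a * \<alpha>) * (1 / sin (pi * (real a / real q)) - 1 / (pi * (real a / real q))))) \<le> real q * 8"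
  proof -
    have "norm (\<Sum>a\<in>{0<..h}. cnj (\<psi> (int a)) * of_real (sin (2 * pi * real a * \<alpha>) * (1 / sin (pi * (real a / real q)) - 1 / (pi * (real a / real q))))) \<le> (\<Sum>a\<in>{0<..h}. 8)"
    proof (rule sum_norm_le)
      fix a assume a: "a \<in> {0<..h}"
      have "real a / real q > 0" "real a / real q \<le> 1 / 2" using a qh by (auto simp: field_simps)
      then have "\<bar>sin (2 * pi * real a * \<alpha>)\<bar> * \<bar>1 / sin (pi * (real a / real q)) - 1 / (pi * (real a / real q))\<bar> \<le> 1 * 8"
        by (intro mult_mono inverse_sin_approx) auto
      then have "norm (cnj (\<psi> (int a))) * (\<bar>sin (2 * pi * real a * \<alpha>)\<bar> * \<bar>1 / sin (pi * (real a / real q)) - 1 / (pi * (real a / real q))\<bar>) \<le> 1 * (1 * 8)"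
        by (rule mult_mono[rotated]) (use dirichlet_char_norm_le[OF \<psi>] in auto)
      then show "norm (cnj (\<psi> (int a)) * of_real (sin (2 * pi * real a * \<alpha>) * (1 / sin (pi * (real a / real q)) - 1 / (pi * (real a / real q))))) \<le> 8"
        unfolding norm_mult norm_of_real abs_mult by simp
    qed
    also have "\<dots> \<le> real q * 8" using qh by simp
    finally show ?thesis .
  qed
  have "sqrt (real q) * norm (\<Sum>n\<in>{1..t}. \<psi> (int n)) = norm (\<Sum>a\<in>{1..<q}. F a)"
    unfolding character_sum_fourier[OF \<psi> np q(1)] sum_int_interval_nat F_def D_def by simp
  also have "\<dots> \<le> real q * B + real q * 8" unfolding Feq by (intro order.trans[OF norm_triangle_ineq] add_mono m1 m2)
  also have "\<dots> = (sqrt (real q) * sqrt (real q)) * (B + 8)" by (simp add: distrib_left)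
  also have "\<dots> = sqrt (real q) * (sqrt (real q) * (B + 8))" by (simp only: mult.assoc)
  finally show "norm (\<Sum>n\<in>{1..t}. \<psi> (int n)) \<le> sqrt (real q) * (B + 8)" using q1 by simp
qed

section \<open>Exponents of pretentious powers\<close>

text \<open>In a shortest signed zero-sum of odd length, the translates of A by every fourth partial sum
  are disjoint: otherwise a detour through A would give a shorter one of odd length.\<close>
lemma odd_zero_sum:
  fixes A :: "int set" and d :: nat
  assumes d: "odd d" and A: "A \<subseteq> {0..<int d}" "A \<noteq> {}"
  obtains xs where "odd (length xs)" "\<And>x. x \<in> set xs \<Longrightarrow> x \<in> A \<or> - x \<in> A" "int d dvd sum_list xs"
    "length xs * card A \<le> 4 * d"
proof -
  define P where "P g \<longleftrightarrow> odd g \<and> (\<exists>xs. length xs = g \<and> (\<forall>x\<in>set xs. x \<in> A \<or> - x \<in> A) \<and> int d dvd sum_list xs)" for g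
  obtain a where a: "a \<in> A" using A by blast
  \<comment> \<open>A first zero-sum of odd length: d copies of one element. This is where d odd
    enters.\<close>
  have "P d" unfolding P_def
  proof (intro conjI exI[of _ "replicate d a"])
    show "int d dvd sum_list (replicate d a)" by (simp add: sum_list_replicate)
  qed (use d a in auto)
  define g where "g = (LEAST g. P g)"
  have "P g" unfolding g_def using \<open>P d\<close> by (rule LeastI)
  then obtain xs where xs: "length xs = g" "odd g" "\<And>x. x \<in> set xs \<Longrightarrow> x \<in> A \<or> - x \<in> A" "int d dvd sum_list xs"
    unfolding P_def by blast
  have min: "g \<le> g'" if "P g'" for g' unfolding g_def using that by (rule Least_le)
  have fin: "finite A" using A(1) finite_subset by blast
  define J where "J = {j. 4 * j < g}"
  \<comment> \<open>\<open>(g + 3) div 4\<close> is g / 4 rounded up, the number of j with 4 j <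
    g.\<close>
  have Jeq: "J = {..<(g + 3) div 4}" unfolding J_def by auto
  define \<phi> where "\<phi> = (\<lambda>(j, a). (sum_list (take (4 * j) xs) + a) mod int d)"
  have no_coll: False if j: "j < j'" "j' \<in> J" and ab: "a \<in> A" "b \<in> A" and eq: "\<phi> (j, a) = \<phi> (j', b)" for j j' a b
  proof -
    define i where "i = 4 * j"
    define i' where "i' = 4 * j'"
    have ii: "i < i'" "i' < g" "i' - i = 4 * (j' - j)" "i' - i \<ge> 4" using j by (auto simp: i_def i'_def J_def)
    \<comment> \<open>The 4 (j' - j) terms between the two colliding partial sums are replaced by a
      and -b. The sum changes by a multiple of d, while the length keeps its parity and drops by at
      least 2; the spacing 4 is the least even number above the two added terms.\<close>
    define ys where "ys = take i xs @ drop i' xs @ [a, - b]"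
    have "length ys = i + (g - i') + 2" unfolding ys_def using ii xs(1) by simp
    then have len: "length ys = g - (i' - i) + 2" using ii by simp
    then have "length ys < g" using ii xs(1) by simp
    moreover have "P (length ys)" unfolding P_def
    proof (intro conjI exI[of _ ys])
      define t where "t = j' - j"
      have t: "i' - i = 4 * t" "i' - i \<le> g" using ii by (simp_all add: t_def)
      have par: "odd l" if "l = n - m + 2" "m = 4 * t" "m \<le> n" "odd n" for l m n :: nat
        using that by presburger
      show "odd (length ys)" by (rule par[OF len t xs(2)])
      show "\<forall>x\<in>set ys. x \<in> A \<or> - x \<in> A"
        unfolding ys_def using xs(3) ab by (auto dest: in_set_takeD in_set_dropD)
      have "sum_list xs = sum_list (take i' xs) + sum_list (drop i' xs)"
        by (metis append_take_drop_id sum_list.append)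
      then have s: "sum_list ys = sum_list xs + ((sum_list (take i xs) + a) - (sum_list (take i' xs) + b))"
        unfolding ys_def by simp
      have "int d dvd (sum_list (take i xs) + a) - (sum_list (take i' xs) + b)"
        using eq unfolding \<phi>_def i_def i'_def by (simp add: mod_eq_dvd_iff)
      then show "int d dvd sum_list ys" unfolding s using xs(4) by (rule dvd_add[rotated])
    qed simp
    ultimately show False using min by fastforce
  qed
  have "inj_on \<phi> (J \<times> A)"
  proof (rule inj_onI)
    fix u v assume u: "u \<in> J \<times> A" and v: "v \<in> J \<times> A" and e: "\<phi> u = \<phi> v"
    obtain j a where ua: "u = (j, a)" "j \<in> J" "a \<in> A" using u by blast
    obtain j' b where vb: "v = (j', b)" "j' \<in> J" "b \<in> A" using v by blast
    have "j = j'"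
    proof (rule linorder_cases[of j j'])
      assume "j < j'" then show ?thesis using no_coll[of j j' a b] ua vb e by blast
    next
      assume "j' < j" then show ?thesis using no_coll[of j' j b a] ua vb e by simp
    qed
    then have "int d dvd a - b" using e unfolding ua vb \<phi>_def by (simp add: mod_eq_dvd_iff)
    then have "a mod int d = b mod int d" by (simp add: mod_eq_dvd_iff)
    then have "a = b" using A(1) ua(3) vb(3) by (metis atLeastLessThan_iff mod_pos_pos_trivial subsetD)
    then show "u = v" using \<open>j = j'\<close> ua vb by simp
  qed
  moreover have "\<phi> ` (J \<times> A) \<subseteq> {0..<int d}"
    using d by (auto simp: \<phi>_def odd_pos)
  ultimately have "card (J \<times> A) \<le> card {0..<int d}" by (intro card_inj_on_le) auto
  then have "((g + 3) div 4) * card A \<le> d" by (simp add: card_cartesian_product Jeq)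
  moreover have "g \<le> 4 * ((g + 3) div 4)" by presburger
  then have "g * card A \<le> 4 * ((g + 3) div 4) * card A" by (rule mult_right_mono) simp
  ultimately have "g * card A \<le> 4 * d" by linarith
  then show ?thesis using that[of xs] xs by auto
qed

text \<open>The triangle inequality for the pretentious distance. For unimodular w, 2 (1 - Re w) =
  |1 - w|^2; the norm |1 - product| is at most the sum of the |1 - z i|, and Cauchy-Schwarz
  contributes the factor k. If some z i is 0, the left side is 1 and that single term already
  contributes 1 on the right.\<close>

lemma one_minus_Re_prod_le:
  fixes z :: "nat \<Rightarrow> complex"
  assumes z: "\<And>i. i < k \<Longrightarrow> z i = 0 \<or> norm (z i) = 1" and k: "k \<ge> 1"
  shows "1 - Re (\<Prod>i<k. z i) \<le> real k * (\<Sum>i<k. 1 - Re (z i))"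
proof -
  have nn: "1 - Re (z i) \<ge> 0" if "i < k" for i using z[OF that] abs_Re_le_cmod[of "z i"] by auto
  show ?thesis
  proof (cases "\<exists>i<k. z i = 0")
    case True
    then obtain i where i: "i < k" "z i = 0" by blast
    then have p0: "(\<Prod>i<k. z i) = 0" by (intro prod_zero) auto
    have "1 \<le> (\<Sum>i<k. 1 - Re (z i))"
      using member_le_sum[of i "{..<k}" "\<lambda>i. 1 - Re (z i)"] i nn by simp
    then have "1 * 1 \<le> real k * (\<Sum>i<k. 1 - Re (z i))" using k by (intro mult_mono) auto
    then show ?thesis unfolding p0 by simp
  next
    case False
    then have u: "norm (z i) = 1" if "i < k" for i using z that by blast
    have sq: "norm (1 - w) ^ 2 = 2 * (1 - Re w)" if "norm w = 1" for w
    proof -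
      have "norm (1 - w) ^ 2 = 1 - 2 * Re w + norm w ^ 2"
        by (simp only: cmod_power2) (simp add: power2_eq_square algebra_simps)
      then show ?thesis using that by simp
    qed
    have "norm (\<Prod>i<k. z i) = 1" using u by (simp add: prod_norm[symmetric])
    then have "2 * (1 - Re (\<Prod>i<k. z i)) = norm (1 - (\<Prod>i<k. z i)) ^ 2" by (rule sq[symmetric])
    also have "\<dots> \<le> (\<Sum>i<k. 1 * norm (1 - z i)) ^ 2"
    proof (rule power_mono)
      have "norm ((\<Prod>i<k. 1) - (\<Prod>i<k. z i)) \<le> (\<Sum>i<k. norm (1 - z i))" using u by (intro norm_prod_diff) auto
      then show "norm (1 - (\<Prod>i<k. z i)) \<le> (\<Sum>i<k. 1 * norm (1 - z i))" by simp
    qed simp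
    also have "\<dots> \<le> (\<Sum>i<k. 1) * (\<Sum>i<k. 1 * norm (1 - z i) ^ 2)" by (rule weighted_cauchy_schwarz) simp
    also have "\<dots> = real k * (\<Sum>i<k. 2 * (1 - Re (z i)))" using sq u by simp
    also have "\<dots> = 2 * (real k * (\<Sum>i<k. 1 - Re (z i)))" by (simp add: sum_distrib_left mult_ac)
    finally show ?thesis by simp
  qed
qed

lemma dirichlet_char_prod:
  fixes k :: nat and r :: "nat \<Rightarrow> nat"
  assumes "\<And>i. i < k \<Longrightarrow> dirichlet_char (r i) (\<xi> i)"
  shows "dirichlet_char (\<Prod>i<k. r i) (\<lambda>n. \<Prod>i<k. \<xi> i n)"
  using assms
proof (induction k)
  case 0
  then show ?case by (simp add: dirichlet_char_def)
next
  case (Suc k)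
  have "dirichlet_char ((\<Prod>i<k. r i) * r k) (\<lambda>n. (\<Prod>i<k. \<xi> i n) * \<xi> k n)"
    using Suc by (intro dirichlet_char_mult) auto
  then show ?case by simp
qed

lemma prod_power_int:
  fixes w :: complex and k :: nat
  assumes "w \<noteq> 0"
  shows "(\<Prod>i<k. w powi a i) = w powi (\<Sum>i<k. a i)"
  using assms by (induction k) (simp_all add: power_int_add)

text \<open>Since \<open>pdist\<close> measures the distance from 1, closeness of \<psi> to the odd
  character \<xi> is expressed through the product of \<xi> with the conjugate of \<psi>.\<close>

definition pretentious :: "real \<Rightarrow> real \<Rightarrow> real \<Rightarrow> (int \<Rightarrow> complex) \<Rightarrow> bool" where
  "pretentious s R \<Delta> \<psi> \<longleftrightarrow> (\<exists>r \<xi>. r \<ge> 1 \<and> real r \<le> R \<and> dirichlet_char r \<xi> \<and> \<xi> (-1) = -1 \<and>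
      (\<forall>N. pdist s (\<lambda>n. cnj (\<psi> (int n)) * \<xi> (int n)) N \<le> \<Delta>))"

text \<open>Multiply the twists over all entries of xs. As d divides their sum, the powers of chi
  cancel and only the product of the k odd characters remains: odd because k is, hence nonprincipal,
  with modulus at most R^k. Its distance from 1 is large, yet bounded by the distances of the
  factors.\<close>

lemma pretentious_product_bound:
  fixes chi :: "int \<Rightarrow> complex" and xs :: "int list" and d :: nat
  assumes q: "prime q" and chi: "dirichlet_char q chi" and ord: "\<And>n. coprime n (int q) \<Longrightarrow> chi n ^ d = 1"
    and s: "s > 1" and R: "R \<ge> 1" and xs: "odd (length xs)" "int d dvd sum_list xs"
    and pret: "\<And>x. x \<in> set xs \<Longrightarrow> (x > 0 \<and> pretentious s R \<Delta> (\<lambda>n. chi n ^ nat x)) \<or> (x < 0 \<and> pretentious s R \<Delta> (\<lambda>n. chi n ^ nat (- x)))"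
  shows "ln (1 / (s - 1)) - ln (real (length xs) * ln R + 2) - 5 \<le> 2 * real (length xs) ^ 2 * \<Delta>"
proof -
  define k where "k = length xs"
  have k1: "k \<ge> 1" using xs(1) unfolding k_def by (cases xs) auto
  define c where "c = (\<lambda>n. chi (int n))"
  \<comment> \<open>Entries of both signs are brought to one form with integer powers. For a
    negative entry everything is conjugated: real parts do not change, and the conjugate of \<xi> is
    again odd with the same modulus.\<close>
  have "\<forall>i\<in>{..<k}. \<exists>r \<xi>. r \<ge> 1 \<and> real r \<le> R \<and> dirichlet_char r \<xi> \<and> \<xi> (-1) = -1 \<and>
     (\<forall>N. pdist s (\<lambda>n. (if c n = 0 then 0 else c n powi (- (xs ! i))) * \<xi> (int n)) N \<le> \<Delta>)"
  proof
    fix i assume "i \<in> {..<k}"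
    then have "xs ! i \<in> set xs" by (simp add: k_def)
    define x where "x = xs ! i"
    have cn: "cnj (c n) = inverse (c n)" if "c n \<noteq> 0" for n
    proof -
      have "norm (c n) = 1" using that dirichlet_char_norm[OF chi, of "int n"] unfolding c_def by (auto split: if_splits)
      then have "c n * cnj (c n) = 1" by (simp add: complex_norm_square[symmetric])
      then show ?thesis using that by (simp add: field_simps)
    qed
    from pret[OF \<open>xs ! i \<in> set xs\<close>, folded x_def] show "\<exists>r \<xi>. r \<ge> 1 \<and> real r \<le> R \<and> dirichlet_char r \<xi> \<and> \<xi> (-1) = -1 \<and>
     (\<forall>N. pdist s (\<lambda>n. (if c n = 0 then 0 else c n powi (- (xs ! i))) * \<xi> (int n)) N \<le> \<Delta>)"
    proof (elim disjE conjE)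
      assume x0: "x > 0" and "pretentious s R \<Delta> (\<lambda>n. chi n ^ nat x)"
      then obtain r \<xi> where *: "r \<ge> 1" "real r \<le> R" "dirichlet_char r \<xi>" "\<xi> (-1) = -1"
        "\<And>N. pdist s (\<lambda>n. cnj (chi (int n) ^ nat x) * \<xi> (int n)) N \<le> \<Delta>" unfolding pretentious_def by blast
      have "cnj (chi (int n) ^ nat x) = (if c n = 0 then 0 else c n powi (- x))" for n
      proof (cases "c n = 0")
        case False
        have "cnj (chi (int n) ^ nat x) = inverse (c n) ^ nat x" using cn[OF False] by (simp add: c_def)
        also have "\<dots> = c n powi (- x)" using x0 by (simp add: power_int_def)
        finally show ?thesis using False by simp
      qed (use x0 in \<open>auto simp: c_def power_0_left\<close>)
      then show ?thesis using * unfolding x_def by (intro exI[of _ r] exI[of _ \<xi>]) auto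
    next
      assume x0: "x < 0" and "pretentious s R \<Delta> (\<lambda>n. chi n ^ nat (- x))"
      then obtain r \<xi> where *: "r \<ge> 1" "real r \<le> R" "dirichlet_char r \<xi>" "\<xi> (-1) = -1"
        "\<And>N. pdist s (\<lambda>n. cnj (chi (int n) ^ nat (- x)) * \<xi> (int n)) N \<le> \<Delta>" unfolding pretentious_def by blast
      have conj: "cnj (cnj (chi (int n) ^ nat (- x)) * \<xi> (int n)) = (if c n = 0 then 0 else c n powi (- x)) * cnj (\<xi> (int n))" for n
        using x0 by (auto simp: c_def power_int_def power_0_left)
      have "Re (cnj (chi (int n) ^ nat (- x)) * \<xi> (int n)) = Re ((if c n = 0 then 0 else c n powi (- x)) * cnj (\<xi> (int n)))" for n
        using arg_cong[OF conj[of n], of Re] by (simp only: cnj.sel)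
      then have "pdist s (\<lambda>n. (if c n = 0 then 0 else c n powi (- x)) * cnj (\<xi> (int n))) N \<le> \<Delta>" for N
        using *(5)[of N] unfolding pdist_def by (simp only:)
      then show ?thesis using * dirichlet_char_cnj[OF *(3)] unfolding x_def by (intro exI[of _ r] exI[of _ "\<lambda>n. cnj (\<xi> n)"]) auto
    qed
  qed
  note choices = this
  define G where "G i r \<xi> \<longleftrightarrow> r \<ge> (1::nat) \<and> real r \<le> R \<and> dirichlet_char r \<xi> \<and> \<xi> (-1) = -1 \<and>
     (\<forall>N. pdist s (\<lambda>n. (if c n = 0 then 0 else c n powi (- (xs ! i))) * \<xi> (int n)) N \<le> \<Delta>)" for i r \<xi>
  have "\<forall>i\<in>{..<k}. \<exists>r \<xi>. G i r \<xi>" using choices unfolding G_def .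
  from bchoice[OF this] obtain r where "\<forall>i\<in>{..<k}. \<exists>\<xi>. G i (r i) \<xi>" ..
  from bchoice[OF this] obtain \<xi> where "\<forall>i\<in>{..<k}. G i (r i) (\<xi> i)" ..
  then have rx: "r i \<ge> (1::nat) \<and> real (r i) \<le> R \<and> dirichlet_char (r i) (\<xi> i) \<and> \<xi> i (-1) = -1 \<and>
     (\<forall>N. pdist s (\<lambda>n. (if c n = 0 then 0 else c n powi (- (xs ! i))) * \<xi> i (int n)) N \<le> \<Delta>)" if "i < k" for i
    using that unfolding G_def by simp
  define z where "z i n = (if c n = 0 then 0 else c n powi (- (xs ! i))) * \<xi> i (int n)" for i n
  define m where "m = (\<Prod>i<k. r i)"
  define \<Xi> where "\<Xi> n = (\<Prod>i<k. \<xi> i n)" for n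
  have \<Xi>: "dirichlet_char m \<Xi>" unfolding m_def \<Xi>_def by (rule dirichlet_char_prod) (use rx in blast)
  have m1: "m \<ge> 1" using \<Xi> by (simp add: dirichlet_char_def)
  have "\<Xi> (-1) = (\<Prod>i<k. -1)" unfolding \<Xi>_def using rx by (intro prod.cong) auto
  also have "\<dots> = -1" using xs(1) by (simp add: k_def)
  finally have "\<Xi> (-1) = -1" .
  then have npr: "\<Xi> \<noteq> dprinc m" by (auto simp: dprinc_def)
  have zn: "z i n = 0 \<or> norm (z i n) = 1" if i: "i < k" for i n
  proof (cases "c n = 0 \<or> \<xi> i (int n) = 0")
    case False
    have "norm (c n) = 1" using False dirichlet_char_norm[OF chi, of "int n"] unfolding c_def by (auto split: if_splits)
    moreover have "norm (\<xi> i (int n)) = 1" using False rx[OF i] dirichlet_char_norm[of "r i" "\<xi> i" "int n"] by (auto split: if_splits)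
    ultimately show ?thesis using False by (simp add: z_def norm_mult norm_power_int)
  qed (auto simp: z_def)
  \<comment> \<open>The factor 2 serves primes where chi vanishes: there every z i p is 0, the sum
    is k, and the left side is at most 2. Elsewhere the factor k of
    \<open>one_minus_Re_prod_le\<close> suffices.\<close>
  have key: "1 - Re (\<Xi> (int p)) \<le> 2 * real k * (\<Sum>i<k. 1 - Re (z i p))" for p
  proof (cases "c p = 0")
    case True
    then have z0: "z i p = 0" for i by (simp add: z_def)
    have "norm (\<Xi> (int p)) \<le> 1" by (rule dirichlet_char_norm_le[OF \<Xi>])
    then have "1 - Re (\<Xi> (int p)) \<le> 2" using abs_Re_le_cmod[of "\<Xi> (int p)"] by linarith
    also have "\<dots> \<le> 2 * real k * real k" using k1 by (simp add: mult_ge1_I)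
    finally show ?thesis by (simp add: z0)
  next
    case False
    then have cop: "coprime (int p) (int q)" using chi unfolding c_def dirichlet_char_def by blast
    have cd: "c p ^ d = 1" unfolding c_def by (rule ord[OF cop])
    have "(\<Prod>i<k. c p powi (- (xs ! i))) = c p powi (- sum_list xs)"
    proof -
      have "(\<Prod>i<k. c p powi (- (xs ! i))) = c p powi (\<Sum>i<k. - (xs ! i))"
        by (rule prod_power_int[OF False])
      also have "(\<Sum>i<k. - (xs ! i)) = - sum_list xs"
        by (simp add: sum_negf sum_list_sum_nth k_def atLeast0LessThan)
      finally show ?thesis .
    qed
    also have "\<dots> = 1"
    proof -
      obtain e where e: "sum_list xs = int d * e" using xs(2) by blast
      have "c p powi (int d * (- e)) = (c p powi int d) powi (- e)" by (rule power_int_mult)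
      also have "\<dots> = 1" using cd by (simp add: power_int_of_nat)
      finally show ?thesis by (simp add: e)
    qed
    finally have "(\<Prod>i<k. z i p) = \<Xi> (int p)" using False by (simp add: z_def \<Xi>_def prod.distrib)
    then have "1 - Re (\<Xi> (int p)) \<le> real k * (\<Sum>i<k. 1 - Re (z i p))"
      using one_minus_Re_prod_le[of k "\<lambda>i. z i p"] zn k1 by simp
    moreover have "0 \<le> real k * (\<Sum>i<k. 1 - Re (z i p))"
    proof (intro mult_nonneg_nonneg sum_nonneg)
      fix i assume "i \<in> {..<k}"
      then show "0 \<le> 1 - Re (z i p)" using zn[of i p] abs_Re_le_cmod[of "z i p"] by auto
    qed simp
    ultimately show ?thesis by linarith
  qed
  have upper: "(\<Sum>p\<in>primes_upto N. (1 - Re (\<Xi> (int p))) * real p powr - s) \<le> 2 * real k ^ 2 * \<Delta>" for N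
  proof -
    have "(\<Sum>p\<in>primes_upto N. (1 - Re (\<Xi> (int p))) * real p powr - s) \<le> (\<Sum>p\<in>primes_upto N. (2 * real k * (\<Sum>i<k. 1 - Re (z i p))) * real p powr - s)"
      by (intro sum_mono mult_right_mono key) auto
    also have "\<dots> = 2 * real k * (\<Sum>i<k. \<Sum>p\<in>primes_upto N. (1 - Re (z i p)) * real p powr - s)"
      unfolding sum_distrib_left sum_distrib_right by (subst sum.swap) (simp only: mult.assoc)
    also have "\<dots> \<le> 2 * real k * (\<Sum>i<k. \<Delta>)"
      using rx unfolding pdist_def z_def by (intro mult_left_mono sum_mono) auto
    also have "\<dots> = 2 * real k ^ 2 * \<Delta>" by (simp add: power2_eq_square)
    finally show ?thesis .
  qed
  obtain N where "(\<Sum>p\<in>primes_upto N. (1 - Re (\<Xi> (int p))) * real p powr - s) \<ge> ln (1 / (s - 1)) - ln (ln (real m) + 2) - 5"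
    using character_prime_distance_lower[OF \<Xi> npr s] eventually_sequentially_obtain by blast
  then have low: "ln (1 / (s - 1)) - ln (ln (real m) + 2) - 5 \<le> 2 * real k ^ 2 * \<Delta>" using upper[of N] by linarith
  have "real m \<le> R ^ k"
  proof -
    have "real m = (\<Prod>i<k. real (r i))" by (simp add: m_def)
    also have "\<dots> \<le> (\<Prod>i<k. R)" using rx by (intro prod_mono) auto
    finally show ?thesis by simp
  qed
  then have "ln (real m) \<le> ln (R ^ k)" using m1 R by (subst ln_le_cancel_iff) auto
  also have "\<dots> = real k * ln R" using R by (simp add: ln_realpow)
  finally have "ln (real m) \<le> real k * ln R" .
  moreover have "ln (real m) \<ge> 0" using m1 by simp
  ultimately have "ln (ln (real m) + 2) \<le> ln (real k * ln R + 2)" by (subst ln_le_cancel_iff) linarith+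
  then show ?thesis using low unfolding k_def[symmetric] by linarith
qed

section \<open>Choice of scales and the final count\<close>

lemma eventually_scales:
  "\<forall>\<^sub>F q in sequentially. \<exists>z. scales (ln (real q)) (ln (ln (real q))) (ln (ln (ln (real q)))) z \<and>
     ln (ln (real q)) - ln (2 * ln (ln (real q)) + 2) - 5 > ln (ln (real q)) / 2"
proof -
  have "\<forall>\<^sub>F X in at_top. X \<ge> (1::real) \<and> ln X \<ge> 2 \<and> ln (ln X) \<ge> 1 \<and> ln X \<le> sqrt X \<and> ln (1 + sqrt X) + 2 \<le> ln X \<and>
      ln X ^ 5 \<le> X \<and> sqrt X \<ge> 3 \<and> ln (sqrt X - 1) - 2 \<ge> ln X / 4 \<and> ln X - ln (2 * ln X + 2) - 5 > ln X / 2"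
    by (intro eventually_conj; real_asymp)
  moreover have "filterlim (\<lambda>q. ln (real q)) at_top sequentially" by real_asymp
  ultimately have "\<forall>\<^sub>F q in sequentially. ln (real q) \<ge> (1::real) \<and> ln (ln (real q)) \<ge> 2 \<and> ln (ln (ln (real q))) \<ge> 1 \<and> ln (ln (real q)) \<le> sqrt (ln (real q)) \<and>
      ln (1 + sqrt (ln (real q))) + 2 \<le> ln (ln (real q)) \<and>
      ln (ln (real q)) ^ 5 \<le> ln (real q) \<and> sqrt (ln (real q)) \<ge> 3 \<and> ln (sqrt (ln (real q)) - 1) - 2 \<ge> ln (ln (real q)) / 4 \<and>
      ln (ln (real q)) - ln (2 * ln (ln (real q)) + 2) - 5 > ln (ln (real q)) / 2"
    by (rule eventually_compose_filterlim)
  then show ?thesis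
  proof eventually_elim
    case (elim q)
    define X where "X = ln (real q)"
    \<comment> \<open>The integer part is at least exp(sqrt X - 1), so the reciprocals of primes up
      to z add up to at least ln(sqrt X - 1) - 2. This is about Y/2, which leaves room for the Y/4
      in \<open>scales\<close>.\<close>
    define z where "z = nat \<lfloor>exp (sqrt X)\<rfloor>"
    have sX: "sqrt X \<ge> 3" using elim by (simp add: X_def)
    have e: "exp (sqrt X) \<ge> 1 + sqrt X" by (rule exp_ge_add_one_self)
    have z1: "real z \<le> exp (sqrt X)" unfolding z_def by simp
    have z2: "real z \<ge> exp (sqrt X) - 1" unfolding z_def by linarith
    have z3: "z \<ge> 2" using z2 e sX by linarith
    have "exp (sqrt X - 1) \<le> real z"
    proof -
      have "2 * exp (sqrt X - 1) \<le> exp 1 * exp (sqrt X - 1)"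
        using exp_ge_add_one_self[of "1::real"] by (intro mult_right_mono) auto
      also have "\<dots> = exp (sqrt X)" by (simp add: exp_add[symmetric])
      finally have "exp (sqrt X - 1) + exp (sqrt X - 1) \<le> exp (sqrt X)" by simp
      moreover have "sqrt X - 1 \<ge> 0" using sX by linarith
      then have "exp (sqrt X - 1) \<ge> 1" by (simp only: one_le_exp_iff)
      ultimately show ?thesis using z2 by linarith
    qed
    then have "ln (exp (sqrt X - 1)) \<le> ln (real z)" using z3 by (subst ln_le_cancel_iff) auto
    then have "sqrt X - 1 \<le> ln (real z)" by simp
    moreover have "0 < sqrt X - 1" using sX by linarith
    ultimately have "ln (sqrt X - 1) \<le> ln (ln (real z))" by (subst ln_le_cancel_iff) linarith+
    then have "ln X / 4 \<le> (\<Sum>p\<in>primes_upto z. 1 / real p)"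
      using prime_reciprocal_sum_lower[OF z3] elim unfolding X_def by linarith
    then have "scales X (ln X) (ln (ln X)) z" unfolding scales_def using elim z1 z3 unfolding X_def by simp
    then show ?case using elim unfolding X_def by blast
  qed
qed

lemma char_order_properties:
  assumes chi: "dirichlet_char q chi" and ord: "char_order q chi = d"
  shows "d \<ge> 1" "\<And>n. coprime n (int q) \<Longrightarrow> chi n ^ d = 1"
    "\<And>l. 1 \<le> l \<Longrightarrow> l < d \<Longrightarrow> (\<lambda>n. chi n ^ l) \<noteq> dprinc q"
proof -
  have "totient q \<ge> 1" using chi by (simp add: dirichlet_char_def Suc_le_eq)
  then have "\<exists>k. k \<ge> 1 \<and> (\<forall>n. coprime n (int q) \<longrightarrow> chi n ^ k = 1)"
    using dirichlet_char_root_of_unity[OF chi] by blast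
  then have "d \<ge> 1 \<and> (\<forall>n. coprime n (int q) \<longrightarrow> chi n ^ d = 1)"
    unfolding ord[symmetric] char_order_def by (rule LeastI_ex)
  then show "d \<ge> 1" "\<And>n. coprime n (int q) \<Longrightarrow> chi n ^ d = 1" by auto
  fix l assume l: "1 \<le> l" "l < d"
  show "(\<lambda>n. chi n ^ l) \<noteq> dprinc q"
  proof
    assume e: "(\<lambda>n. chi n ^ l) = dprinc q"
    have "chi n ^ l = 1" if "coprime n (int q)" for n using fun_cong[OF e, of n] that by (simp add: dprinc_def)
    then have "char_order q chi \<le> l" unfolding char_order_def using l by (intro Least_le) auto
    then show False using ord l by simp
  qed
qed

lemma dirichlet_char_power:
  assumes "dirichlet_char q chi" "l \<ge> 1"
  shows "dirichlet_char q (\<lambda>n. chi n ^ l)"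
  using assms by (auto simp: dirichlet_char_def power_mult_distrib)

text \<open>A set B of pretentious exponents admits an odd zero-sum of length k with k |B| \<le> 4
  d, while the product bound forces k to be at least sqrt(Y/Z)/10; together they give the constant
  40.\<close>

lemma pretentious_exponents_sparse:
  assumes sc: "scales X Y Z z" and q: "prime q" and chi: "dirichlet_char q chi" and ord: "char_order q chi = d"
    and d: "odd d" and big: "Y - ln (2 * Y + 2) - 5 > Y / 2"
  shows "real (card {l\<in>{1..d-1}. pretentious (1 + 1 / X) (Y ^ 2) (24 * Z) (\<lambda>n. chi n ^ l)}) \<le> 40 * real d * sqrt (Z / Y)"
proof -
  have X: "X \<ge> 1" "Y = ln X" and Z: "Z \<ge> 1" "Z = ln Y" and Y: "Y \<ge> 2" using sc by (auto simp: scales_def)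
  define B where "B = {l\<in>{1..d-1}. pretentious (1 + 1 / X) (Y ^ 2) (24 * Z) (\<lambda>n. chi n ^ l)}"
  have ZY: "sqrt (Z / Y) > 0" using Z Y by simp
  show ?thesis
  proof (cases "B = {}")
    case True
    then show ?thesis using ZY unfolding B_def[symmetric] by simp
  next
    case False
    define A where "A = int ` B"
    have A: "A \<subseteq> {0..<int d}" "A \<noteq> {}" using False by (auto simp: A_def B_def)
    have cardA: "card A = card B" unfolding A_def by (intro card_image) auto
    obtain xs where xs: "odd (length xs)" "\<And>x. x \<in> set xs \<Longrightarrow> x \<in> A \<or> - x \<in> A" "int d dvd sum_list xs"
      "length xs * card A \<le> 4 * d"
      using odd_zero_sum[OF d A] by blast
    define k where "k = length xs"
    have pos: "x > 0 \<and> pretentious (1 + 1 / X) (Y ^ 2) (24 * Z) (\<lambda>n. chi n ^ nat x)" if "x \<in> A" for x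
      using that by (auto simp: A_def B_def)
    have "ln (1 / (1 + 1 / X - 1)) - ln (real k * ln (Y ^ 2) + 2) - 5 \<le> 2 * real k ^ 2 * (24 * Z)"
      unfolding k_def
    proof (rule pretentious_product_bound[OF q chi char_order_properties(2)[OF chi ord] _ _ xs(1,3)])
      fix x assume "x \<in> set xs"
      then show "x > 0 \<and> pretentious (1 + 1 / X) (Y ^ 2) (24 * Z) (\<lambda>n. chi n ^ nat x) \<or>
          x < 0 \<and> pretentious (1 + 1 / X) (Y ^ 2) (24 * Z) (\<lambda>n. chi n ^ nat (- x))"
        using xs(2)[of x] pos[of x] pos[of "- x"] by auto
    qed (use X Y in auto)
    moreover have "ln (1 / (1 + 1 / X - 1)) = Y" using X by simp
    moreover have "ln (Y ^ 2) = 2 * Z" using Y Z by (simp add: ln_realpow)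
    ultimately have ineq: "Y - ln (2 * real k * Z + 2) - 5 \<le> 48 * real k ^ 2 * Z" by (simp add: mult_ac)
    \<comment> \<open>10 is chosen so that a smaller k would give 48 k^2 Z \<le> 0.48 Y, below the
      Y/2 left after the logarithm is subtracted.\<close>
    have large: "real k \<ge> sqrt (Y / Z) / 10"
    proof (rule ccontr)
      assume "\<not> ?thesis"
      then have lt: "real k < sqrt (Y / Z) / 10" by simp
      have YZ: "Y / Z > 0" using Y Z by simp
      have "real k ^ 2 \<le> (sqrt (Y / Z) / 10) ^ 2" using lt by (intro power_mono) auto
      also have "\<dots> = Y / Z / 100" using YZ by (simp add: power_divide)
      finally have "real k ^ 2 * Z \<le> Y / Z / 100 * Z" using Z by (intro mult_right_mono) auto
      then have k2: "real k ^ 2 * Z \<le> Y / 100" using Z by simp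
      have "Z \<le> Y" using Z(2) Y ln_le_minus_one[of Y] by simp
      have "real k * Z \<le> Y"
      proof (rule power2_le_imp_le)
        have "(real k * Z) ^ 2 = (real k ^ 2 * Z) * Z" by (simp add: power2_eq_square)
        also have "\<dots> \<le> Y * Y" using k2 \<open>Z \<le> Y\<close> Y Z by (intro mult_mono) auto
        finally show "(real k * Z) ^ 2 \<le> Y ^ 2" by (simp add: power2_eq_square)
      qed (use Y in simp)
      moreover have "real k * Z \<ge> 0" using Z by simp
      ultimately have "ln (2 * real k * Z + 2) \<le> ln (2 * Y + 2)" using Y by (subst ln_le_cancel_iff) auto
      then have "Y / 2 < 48 * real k ^ 2 * Z" using ineq big by linarith
      then show False using k2 Y by simp
    qed
    have "real k * real (card B) \<le> real (4 * d)"
      using xs(4) unfolding cardA k_def[symmetric] by (metis of_nat_le_iff of_nat_mult)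
    moreover have "sqrt (Y / Z) / 10 * real (card B) \<le> real k * real (card B)" using large by (intro mult_right_mono) auto
    ultimately have "sqrt (Y / Z) * real (card B) \<le> 40 * real d" by simp
    then have "sqrt (Z / Y) * (sqrt (Y / Z) * real (card B)) \<le> sqrt (Z / Y) * (40 * real d)" using ZY by (intro mult_left_mono) auto
    moreover have "sqrt (Z / Y) * sqrt (Y / Z) = 1" using Y Z by (simp add: real_sqrt_mult[symmetric])
    ultimately show ?thesis unfolding B_def[symmetric] by (simp add: mult_ac)
  qed
qed

theorem theorem3:
  shows "\<exists>C>0. \<exists>Q. \<forall>q::nat. \<forall>d::nat. \<forall>chi.
     prime q \<and> q \<ge> Q \<and> d \<ge> 2 \<and> d dvd (q - 1) \<and>
     primitive_char q chi \<and> char_order q chi = d \<longrightarrow>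
     (1 / real d) * (\<Sum>l\<in>{1..d-1}. M_char q (\<lambda>n. chi n ^ l))
       \<le> C * (sqrt (real q) * ln (real q)) *
           (sqrt (ln (ln (ln (real q))) / ln (ln (real q))) + 1 / real (Pminus d))"
proof (rule sine_sum_bound)
  fix C0 :: real
  assume C0: "C0 > 0" and ssb: "\<And>f q x \<alpha> z X Y Z. scales X Y Z z \<Longrightarrow> X = ln (real q) \<Longrightarrow> q \<ge> 3 \<Longrightarrow> x \<le> q \<Longrightarrow> completely_mult f \<Longrightarrow>
      (\<And>r \<xi>. r \<ge> 1 \<Longrightarrow> real r \<le> Y ^ 2 \<Longrightarrow> dirichlet_char r \<xi> \<Longrightarrow> \<xi> (-1) = -1 \<Longrightarrow>
         \<exists>N. 24 * Z \<le> pdist (1 + 1 / X) (\<lambda>n. f n * \<xi> (int n)) N) \<Longrightarrow>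
      norm (\<Sum>n\<in>{0<..x}. f n * of_real (sin (2 * pi * real n * \<alpha>) / real n)) \<le> C0 * X * sqrt (Z / Y)"
  \<comment> \<open>168 = 4 * 40 + 8: the trivial bound 4 W on the exceptional exponents, of which
    there are at most 40 d \<eta>, plus the bounded error in the Fourier expansion.\<close>
  define C where "C = C0 + 168"
  obtain Q0 where Q0: "\<And>q. q \<ge> Q0 \<Longrightarrow> \<exists>z. scales (ln (real q)) (ln (ln (real q))) (ln (ln (ln (real q)))) z \<and>
     ln (ln (real q)) - ln (2 * ln (ln (real q)) + 2) - 5 > ln (ln (real q)) / 2"
    using eventually_scales unfolding eventually_sequentially by blast
  show ?thesis
  proof (intro exI[of _ C] conjI exI[of _ "max Q0 3"] allI impI)
    show "C > 0" using C0 by (simp add: C_def)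
    fix q d :: nat and chi
    assume "prime q \<and> max Q0 3 \<le> q \<and> d \<ge> 2 \<and> d dvd q - 1 \<and> primitive_char q chi \<and> char_order q chi = d"
    then have q: "prime q" "max Q0 3 \<le> q" and d: "d \<ge> 2" and prim: "primitive_char q chi" and ord: "char_order q chi = d" by blast+
    define X where "X = ln (real q)"
    define Y where "Y = ln X"
    define Z where "Z = ln Y"
    obtain z where sc: "scales X Y Z z" and big: "Y - ln (2 * Y + 2) - 5 > Y / 2"
      using Q0[of q] q unfolding X_def Y_def Z_def by auto
    have X: "X \<ge> 1" and Z: "Z \<ge> 1" and Y: "Y \<ge> 2" using sc by (auto simp: scales_def)
    have q3: "q \<ge> 3" using q by simp
    have chi: "dirichlet_char q chi" using prim by (simp add: primitive_char_def)
    define W where "W = sqrt (real q) * X"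
    have W0: "W \<ge> 0" unfolding W_def using X by simp
    define \<eta> where "\<eta> = sqrt (Z / Y)"
    have \<eta>0: "\<eta> \<ge> 0" unfolding \<eta>_def using Y Z by simp
    have powers: "dirichlet_char q (\<lambda>n. chi n ^ l)" "(\<lambda>n. chi n ^ l) \<noteq> dprinc q" if "l \<in> {1..d-1}" for l
    proof -
      have "1 \<le> l" "l < d" using that d by auto
      then show "dirichlet_char q (\<lambda>n. chi n ^ l)" "(\<lambda>n. chi n ^ l) \<noteq> dprinc q"
        using dirichlet_char_power[OF chi, of l] char_order_properties(3)[OF chi ord, of l] by blast+
    qed
    have trivial: "M_char q (\<lambda>n. chi n ^ l) \<le> 4 * W" if l: "l \<in> {1..d-1}" for l
    proof -
      have "M_char q (\<lambda>n. chi n ^ l) \<le> 2 * sqrt (real q) * (X + 1)"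
        unfolding X_def by (rule polya_vinogradov[OF powers[OF l] q(1)])
      also have "\<dots> \<le> 2 * sqrt (real q) * (2 * X)" using X by (intro mult_left_mono) auto
      finally show ?thesis by (simp add: W_def)
    qed
    have "(1 / real d) * (\<Sum>l\<in>{1..d-1}. M_char q (\<lambda>n. chi n ^ l)) \<le> C * W * (\<eta> + 1 / real (Pminus d))"
    proof (cases "even d")
      case True
      have pf: "2 \<in> prime_factors d" using True d by (simp add: prime_factors_dvd)
      have "Pminus d = 2" unfolding Pminus_def
      proof (rule Min_eqI)
        fix p assume "p \<in> prime_factors d"
        then show "2 \<le> p" by (auto intro: prime_ge_2_nat)
      qed (use pf in auto)
      have "(\<Sum>l\<in>{1..d-1}. M_char q (\<lambda>n. chi n ^ l)) \<le> (\<Sum>l\<in>{1..d-1}. 4 * W)" by (intro sum_mono trivial)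
      also have "\<dots> \<le> real d * (4 * W)" using W0 by (simp add: mult_right_mono)
      finally have "(1 / real d) * (\<Sum>l\<in>{1..d-1}. M_char q (\<lambda>n. chi n ^ l)) \<le> (1 / real d) * (real d * (4 * W))"
        by (intro mult_left_mono) auto
      also have "\<dots> = 8 * W * (0 + 1 / 2)" using d by simp
      also have "\<dots> \<le> C * W * (\<eta> + 1 / 2)" using W0 \<eta>0 C0 by (intro mult_mono) (auto simp: C_def)
      finally show ?thesis using \<open>Pminus d = 2\<close> by simp
    next
      case False
      define A where "A = {l\<in>{1..d-1}. pretentious (1 + 1 / X) (Y ^ 2) (24 * Z) (\<lambda>n. chi n ^ l)}"
      have cardA: "real (card A) \<le> 40 * real d * \<eta>"
        unfolding A_def \<eta>_def using False by (intro pretentious_exponents_sparse[OF sc q(1) chi ord _ big]) auto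
      \<comment> \<open>chi(-1) is 1 or -1, and its odd power d is 1.\<close>
      have even: "chi (-1) = 1"
      proof -
        have "chi (-1) ^ d = 1" by (rule char_order_properties(2)[OF chi ord]) simp
        then show ?thesis using dirichlet_char_minus_one[OF chi] False by auto
      qed
      have generic: "M_char q (\<lambda>n. chi n ^ l) \<le> (C0 + 8) * W * \<eta>" if l: "l \<in> {1..d-1}" "l \<notin> A" for l
      proof -
        have np: "\<not> pretentious (1 + 1 / X) (Y ^ 2) (24 * Z) (\<lambda>n. chi n ^ l)" using l by (simp add: A_def)
        note pw = powers[OF l(1)]
        have cm: "completely_mult (\<lambda>n. cnj (chi (int n) ^ l))"
          unfolding completely_mult_def using dirichlet_char_cnj[OF pw(1)] dirichlet_char_norm_le[OF dirichlet_char_cnj[OF pw(1)]]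
          by (simp add: dirichlet_char_def)
        have "M_char q (\<lambda>n. chi n ^ l) \<le> sqrt (real q) * (C0 * X * sqrt (Z / Y) + 8)"
        proof (rule polya_even[OF pw q(1) q3])
          show "chi (-1) ^ l = 1" using even by simp
          fix \<alpha>
          show "norm (\<Sum>n\<in>{0<..(q - 1) div 2}. cnj (chi (int n) ^ l) * of_real (sin (2 * pi * real n * \<alpha>) / real n)) \<le> C0 * X * sqrt (Z / Y)"
          proof (rule ssb[OF sc X_def q3 _ cm])
            fix r \<xi> assume r: "r \<ge> 1" "real r \<le> Y ^ 2" "dirichlet_char r \<xi>" "\<xi> (-1) = -1"
            then obtain N where "\<not> pdist (1 + 1 / X) (\<lambda>n. cnj (chi (int n) ^ l) * \<xi> (int n)) N \<le> 24 * Z"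
              using np unfolding pretentious_def by blast
            then show "\<exists>N. 24 * Z \<le> pdist (1 + 1 / X) (\<lambda>n. cnj (chi (int n) ^ l) * \<xi> (int n)) N"
              by (meson linear)
          qed simp
        qed
        \<comment> \<open>The constant 8 is absorbed by X \<eta> \<ge> 1.\<close>
        also have "\<dots> \<le> sqrt (real q) * (C0 * X * \<eta> + 8 * (X * \<eta>))"
          using scales_saving(2)[OF sc] unfolding \<eta>_def by (intro mult_left_mono) auto
        also have "\<dots> = (C0 + 8) * W * \<eta>" unfolding W_def by (simp add: algebra_simps)
        finally show ?thesis .
      qed
      have W\<eta>: "0 \<le> (C0 + 8) * W * \<eta>" using C0 W0 \<eta>0 by simp
      have "(\<Sum>l\<in>{1..d-1}. M_char q (\<lambda>n. chi n ^ l)) \<le> (\<Sum>l\<in>{1..d-1}. (if l \<in> A then 4 * W else 0) + (C0 + 8) * W * \<eta>)"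
      proof (rule sum_mono)
        fix l assume l: "l \<in> {1..d-1}"
        show "M_char q (\<lambda>n. chi n ^ l) \<le> (if l \<in> A then 4 * W else 0) + (C0 + 8) * W * \<eta>"
        proof (cases "l \<in> A")
          case True
          then show ?thesis using trivial[OF l] W\<eta> by simp
        next
          case False
          then show ?thesis using generic[OF l False] by simp
        qed
      qed
      also have "\<dots> = real (card A) * (4 * W) + real (d - 1) * ((C0 + 8) * W * \<eta>)"
      proof -
        have "(\<Sum>l\<in>{1..d-1}. if l \<in> A then 4 * W else 0) = (\<Sum>l\<in>{l\<in>{1..d-1}. l \<in> A}. 4 * W)"
          by (rule sum.inter_filter[symmetric]) simp
        also have "{l\<in>{1..d-1}. l \<in> A} = A" unfolding A_def by auto
        finally show ?thesis by (simp add: sum.distrib)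
      qed
      also have "\<dots> \<le> (40 * real d * \<eta>) * (4 * W) + real d * ((C0 + 8) * W * \<eta>)"
        using cardA W0 W\<eta> by (intro add_mono mult_right_mono) auto
      also have "\<dots> = real d * (C * W * \<eta>)" unfolding C_def by (simp add: algebra_simps)
      finally have "(1 / real d) * (\<Sum>l\<in>{1..d-1}. M_char q (\<lambda>n. chi n ^ l)) \<le> (1 / real d) * (real d * (C * W * \<eta>))"
        by (intro mult_left_mono) auto
      also have "\<dots> = C * W * (\<eta> + 0)" using d by simp
      also have "\<dots> \<le> C * W * (\<eta> + 1 / real (Pminus d))" using C0 W0 by (intro mult_left_mono add_left_mono) (auto simp: C_def)
      finally show ?thesis .
    qed
    then show "(1 / real d) * (\<Sum>l\<in>{1..d-1}. M_char q (\<lambda>n. chi n ^ l))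
       \<le> C * (sqrt (real q) * ln (real q)) *
           (sqrt (ln (ln (ln (real q))) / ln (ln (real q))) + 1 / real (Pminus d))"
      unfolding W_def \<eta>_def X_def Y_def Z_def .
  qed
qed

end
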